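(* Let $$\langle f,g \rangle= \int_{-1}^{1} f(x) g(x) \,d\mu(x) +\sum_{j=1}^{N} \eta_{j,d_j} \,f^{(d_j)}(c_{j})\, g^{(d_j)}(c_{j})$$ be a sequentially-ordered discrete Sobolev inner product with $\mu\in\mathbf{M}(0,1)$. Then, for every integer $k\ge 1$, $$R_n^{[k]}(z)=\frac{S^{[k]}_{n}(z)}{S_{n+k}(z)}\longrightarrow \widehat{\mu}_{k}(z)= \int_{-1}^{1} \frac{Q_{k-1}(x)}{z-x}\, d\mu_{\rho}(x)\qquad (n\to\infty)$$ uniformly on every compact subset $K$ of $\Omega_\infty^*=\overline{\mathbb{C}}\setminus\big([-1,1]\cup\{c_1,\dots,c_N\}\big)$.
   Context: $\mu$ is a finite positive Borel measure on $[-1,1]$ whose support contains infinitely many points; $N\ge 0$ is an integer, $\eta_{j,d_j}>0$, $c_j\in\mathbb{R}\setminus[-1,1]$, and $d_j\in\mathbb{Z}_+=\{0,1,2,\dots\}$ for $j=1,\dots,N$. $\overline{\mathbb C}$ is the extended complex plane (rational functions and $\widehat\mu_k$ are extended to $\infty$ by their limits; in particular $\widehat{\mu}_k(\infty)=0$). Sequentially-ordered: the inner product is called sequentially-ordered if the pairs $(c_j,d_j)$, $1\le j\le N$, can be arranged into a finite sequence $(r_1,\nu_1),\dots,(r_N,\nu_N)$ such that (1) $0\le \nu_1\le\cdots\le\nu_N$, and (2) for each $k=1,\dots,N$, $r_k$ does not belong to the convex hull of $(-1,1)\cup\{r_1,\dots,r_{k-1}\}$. Nevai class: $\mu\in\mathbf{M}(0,1)$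 means that $\operatorname{supp}\mu=[-1,1]$ and the monic orthogonal polynomials $P_n$ of $\mu$, which satisfy $P_{n+1}(z)=(z-b_n)P_n(z)-a_n^2P_{n-1}(z)$ with $P_{-1}=0$, $P_0=1$, $b_n\in\mathbb{R}$, $a_n>0$ for $n\geq 1$, have $\lim_{n\to\infty} a_n=1/2$ and $\lim_{n\to\infty} b_n=0$. $S_n$ is the (unique) monic polynomial of degree $n$ with $\langle x^k,S_n\rangle=0$ for $k=0,\dots,n-1$. Put $\rho(z)=\prod_{c_j<-1}(z-c_j)^{d_j+1}\prod_{c_j>1}(c_j-z)^{d_j+1}$ and $d\mu_\rho(x)=\rho(x)\,d\mu(x)$; $\{Q_n\}_{n\ge0}$ are the monic orthogonal polynomials with respect to $\mu_\rho$. For integers $k\ge 1$, $n\ge 0$, the $k$th associated polynomials are $$S^{[k]}_{n}(z) = \int_{-1}^{1} \frac{S_{n+k}(z)-S_{n+k}(x)}{z-x}\, Q_{k-1}(x) \,d\mu_{\rho}(x).$$ *)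

theory Defs
  imports "HOL-Analysis.Analysis" "HOL-Computational_Algebra.Polynomial"
begin

definition measure_support :: "real measure \<Rightarrow> real set" where
  "measure_support M = {x. \<forall>U. open U \<and> x \<in> U \<longrightarrow> emeasure M U > 0}"

text \<open>A measure on \<open>[-1,1]\<close> is represented as a measure on the Borel sets of the line
  that is concentrated on \<open>[-1,1]\<close>.\<close>

definition borel_measure_Icc :: "real measure \<Rightarrow> bool" where
  "borel_measure_Icc M \<longleftrightarrow>
     sets M = sets borel \<and> finite_measure M \<and> emeasure M (- {-1..1}) = 0 \<and>
     infinite (measure_support M)"

definition monic_orthogonal ::
    "(real poly \<Rightarrow> real poly \<Rightarrow> real) \<Rightarrow> nat \<Rightarrow> real poly \<Rightarrow> bool" where
  "monic_orthogonal B n p \<longleftrightarrow>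
     degree p = n \<and> lead_coeff p = 1 \<and> (\<forall>k<n. B (monom 1 k) p = 0)"

text \<open>For the positive definite symmetric forms used below there is exactly one such polynomial.\<close>

definition monic_OP :: "(real poly \<Rightarrow> real poly \<Rightarrow> real) \<Rightarrow> nat \<Rightarrow> real poly" where
  "monic_OP B n = (THE p. monic_orthogonal B n p)"

definition L2_form :: "real measure \<Rightarrow> real poly \<Rightarrow> real poly \<Rightarrow> real" where
  "L2_form M f g = (LINT x:{-1..1}|M. poly f x * poly g x)"

definition sobolev_form ::
    "real measure \<Rightarrow> nat \<Rightarrow> (nat \<Rightarrow> real) \<Rightarrow> (nat \<Rightarrow> nat) \<Rightarrow> (nat \<Rightarrow> real) \<Rightarrow>
     real poly \<Rightarrow> real poly \<Rightarrow> real" where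
  "sobolev_form M N c d \<eta> f g =
     (LINT x:{-1..1}|M. poly f x * poly g x) +
     (\<Sum>j\<in>{1..N}. \<eta> j * poly ((pderiv ^^ d j) f) (c j) * poly ((pderiv ^^ d j) g) (c j))"

text \<open>The arrangement is \<open>(r\<^sub>k, \<nu>\<^sub>k) = (c (\<pi> k), d (\<pi> k))\<close>; the second condition
  forces the \<open>c j\<close> to be pairwise distinct.\<close>

definition sequentially_ordered :: "nat \<Rightarrow> (nat \<Rightarrow> real) \<Rightarrow> (nat \<Rightarrow> nat) \<Rightarrow> bool" where
  "sequentially_ordered N c d \<longleftrightarrow>
     (\<exists>\<pi>. bij_betw \<pi> {1..N} {1..N} \<and>
        (\<forall>i\<in>{1..N}. \<forall>j\<in>{1..N}. i \<le> j \<longrightarrow> d (\<pi> i) \<le> d (\<pi> j)) \<and>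
        (\<forall>k\<in>{1..N}. c (\<pi> k) \<notin> convex hull ({-1<..<1} \<union> (\<lambda>i. c (\<pi> i)) ` {1..<k})))"

text \<open>The convention \<open>P\<^bsub>-1\<^esub> = 0\<close> is expressed by the case distinction at \<open>n = 0\<close>.\<close>

definition Nevai_class_0_1 :: "real measure \<Rightarrow> bool" where
  "Nevai_class_0_1 M \<longleftrightarrow>
     measure_support M = {-1..1} \<and>
     (\<exists>a b. (\<forall>n\<ge>1. a n > 0) \<and>
        (\<forall>n. monic_OP (L2_form M) (Suc n) =
               [:- b n, 1:] * monic_OP (L2_form M) n -
               (if n = 0 then 0 else smult ((a n)\<^sup>2) (monic_OP (L2_form M) (n - 1)))) \<and>
        a \<longlonglongrightarrow> (1/2 :: real) \<and> b \<longlonglongrightarrow> (0 :: real))"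

definition rho :: "nat \<Rightarrow> (nat \<Rightarrow> real) \<Rightarrow> (nat \<Rightarrow> nat) \<Rightarrow> real \<Rightarrow> real" where
  "rho N c d x =
     (\<Prod>j\<in>{j\<in>{1..N}. c j < -1}. (x - c j) ^ (d j + 1)) *
     (\<Prod>j\<in>{j\<in>{1..N}. c j > 1}. (c j - x) ^ (d j + 1))"

text \<open>The truncation by \<open>ennreal\<close> is harmless: \<open>rho\<close> is positive on \<open>[-1,1]\<close>, where
  the measure is concentrated.\<close>

definition mu_rho :: "real measure \<Rightarrow> nat \<Rightarrow> (nat \<Rightarrow> real) \<Rightarrow> (nat \<Rightarrow> nat) \<Rightarrow> real measure" where
  "mu_rho M N c d = density M (\<lambda>x. ennreal (rho N c d x))"

abbreviation cpoly :: "real poly \<Rightarrow> complex \<Rightarrow> complex" where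
  "cpoly p z \<equiv> poly (map_poly complex_of_real p) z"

text \<open>The diagonal value is the derivative, so that the quotient is a polynomial in \<open>z\<close> and \<open>x\<close>.\<close>

definition diff_quot :: "real poly \<Rightarrow> complex \<Rightarrow> real \<Rightarrow> complex" where
  "diff_quot p z x =
     (if z = complex_of_real x then cpoly (pderiv p) z
      else (cpoly p z - complex_of_real (poly p x)) / (z - complex_of_real x))"

definition assoc_poly ::
    "real measure \<Rightarrow> nat \<Rightarrow> (nat \<Rightarrow> real) \<Rightarrow> (nat \<Rightarrow> nat) \<Rightarrow> (nat \<Rightarrow> real) \<Rightarrow>
     nat \<Rightarrow> nat \<Rightarrow> complex \<Rightarrow> complex" where
  "assoc_poly M N c d \<eta> k n z =
     (LINT x:{-1..1}|mu_rho M N c d.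
        diff_quot (monic_OP (sobolev_form M N c d \<eta>) (n + k)) z x *
        complex_of_real (poly (monic_OP (L2_form (mu_rho M N c d)) (k - 1)) x))"

definition assoc_ratio ::
    "real measure \<Rightarrow> nat \<Rightarrow> (nat \<Rightarrow> real) \<Rightarrow> (nat \<Rightarrow> nat) \<Rightarrow> (nat \<Rightarrow> real) \<Rightarrow>
     nat \<Rightarrow> nat \<Rightarrow> complex \<Rightarrow> complex" where
  "assoc_ratio M N c d \<eta> k n z =
     assoc_poly M N c d \<eta> k n z / cpoly (monic_OP (sobolev_form M N c d \<eta>) (n + k)) z"

definition mu_hat ::
    "real measure \<Rightarrow> nat \<Rightarrow> (nat \<Rightarrow> real) \<Rightarrow> (nat \<Rightarrow> nat) \<Rightarrow> nat \<Rightarrow> complex \<Rightarrow> complex" where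
  "mu_hat M N c d k z =
     (LINT x:{-1..1}|mu_rho M N c d.
        complex_of_real (poly (monic_OP (L2_form (mu_rho M N c d)) (k - 1)) x) /
        (z - complex_of_real x))"

text \<open>The extended complex plane, with \<open>None\<close> as the point at infinity.\<close>

abbreviation Riemann_sphere :: "complex option topology" where
  "Riemann_sphere \<equiv> Alexandroff_compactification euclidean"

definition sphere_at :: "complex option \<Rightarrow> complex filter" where
  "sphere_at p = (case p of None \<Rightarrow> at_infinity | Some z \<Rightarrow> at z)"

definition finite_at :: "(complex \<Rightarrow> complex) \<Rightarrow> complex option \<Rightarrow> bool" where
  "finite_at f p \<longleftrightarrow> (\<exists>L. (f \<longlongrightarrow> L) (sphere_at p))"

text \<open>Extension by limits; meaningful at points satisfying \<^const>\<open>finite_at\<close>. Values given by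
  division by zero at a singularity do not enter.\<close>

definition limit_ext :: "(complex \<Rightarrow> complex) \<Rightarrow> complex option \<Rightarrow> complex" where
  "limit_ext f p = Lim (sphere_at p) f"

text \<open>The value \<open>0\<close> is the limit of \<^const>\<open>mu_hat\<close> at infinity.\<close>

definition mu_hat_ext ::
    "real measure \<Rightarrow> nat \<Rightarrow> (nat \<Rightarrow> real) \<Rightarrow> (nat \<Rightarrow> nat) \<Rightarrow> nat \<Rightarrow> complex option \<Rightarrow> complex" where
  "mu_hat_ext M N c d k p = (case p of None \<Rightarrow> 0 | Some z \<Rightarrow> mu_hat M N c d k z)"

definition Omega_star :: "nat \<Rightarrow> (nat \<Rightarrow> real) \<Rightarrow> complex option set" where
  "Omega_star N c =
     topspace Riemann_sphere - Some ` complex_of_real ` ({-1..1} \<union> c ` {1..N})"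

end

theory Submission
  imports Defs "HOL-Complex_Analysis.Complex_Analysis"
    "HOL-Computational_Algebra.Fundamental_Theorem_Algebra"
begin

text \<open>Write \<open>P\<^sub>n\<close> and \<open>S\<^sub>n\<close> for the monic orthogonal polynomials of \<open>\<mu>\<close> and of the Sobolev product,
\<open>\<parallel>\<cdot>\<parallel>\<close> for the norm of \<open>L\<^sup>2(\<mu>)\<close>, and \<open>q\<close> for the polynomial \<open>Q\<close> of index \<open>k - 1\<close>. Expanding the
associated polynomial gives
\<open>S\<^sub>n(z) (R(z) - \<mu>\<^sub>k(z)) = - \<integral> S\<^sub>n(x) q(x) \<rho>(x) / (z - x) d\<mu>(x)\<close>
where \<open>R\<close> is the quotient in question and \<open>\<mu>\<^sub>k\<close> the function it should approach. The integral is
at most a constant times \<open>\<parallel>S\<^sub>n\<parallel>\<close>, divided by the distance of \<open>z\<close> to \<open>[-1,1]\<close>. Therefore it suffices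
that \<open>|S\<^sub>n(z)|\<close> exceeds \<open>\<parallel>S\<^sub>n\<parallel>\<close> by an unbounded factor, uniformly on closed sets that avoid \<open>[-1,1]\<close>
and the points \<open>c\<^sub>j\<close>. This has two parts, \<open>|P\<^sub>n| / \<parallel>P\<^sub>n\<parallel>\<close> and \<open>S\<^sub>n / P\<^sub>n\<close>.

First, \<open>f(z) \<integral> P\<^sub>n(x) / (z - x) d\<mu>(x) = \<integral> P\<^sub>n(x) f(x) / (z - x) d\<mu>(x)\<close> for every polynomial \<open>f\<close> of
degree at most \<open>n\<close>. Comparing this with the case \<open>f = P\<^sub>n\<close>, in which the right-hand side is free of
cancellation, shows that \<open>|f(z)| / |P\<^sub>n(z)|\<close> is bounded by \<open>\<parallel>f\<parallel> / \<parallel>P\<^sub>n\<parallel>\<close> up to a factor that depends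
only on \<open>z\<close> (\<open>poly_comparison\<close>). Taking powers \<open>f = (x - w)\<^sup>n\<close> yields geometric growth
of \<open>|P\<^sub>n| / \<parallel>P\<^sub>n\<parallel>\<close> (\<open>OP_growth\<close>).

Second, the minimality of \<open>S\<^sub>n\<close> and the lower bound on the recurrence coefficients give
\<open>\<langle>S\<^sub>n, S\<^sub>n\<rangle> \<le> C \<parallel>P\<^sub>n\<parallel>\<^sup>2\<close> (\<open>sobolev_norm_bound\<close>), so by the same comparison the quotients
\<open>S\<^sub>n / P\<^sub>n\<close> form a normal family on the complement of \<open>[-1,1]\<close>, uniformly close to 1 far out. The
derivative of order \<open>d\<^sub>j\<close> of \<open>S\<^sub>n\<close> at \<open>c\<^sub>j\<close> is at most a constant times \<open>\<parallel>P\<^sub>n\<parallel>\<close>, hence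
negligible compared with \<open>P\<^sub>n(c\<^sub>j)\<close>, and this forces \<open>S\<^sub>n / P\<^sub>n\<close> to tend to 0 at \<open>c\<^sub>j\<close> (\<open>SP_ratio_tendsto_0_at_mass_point\<close>). By the theorems of
Montel and Hurwitz (\<open>zero_near_small_value\<close>) \<open>S\<^sub>n\<close> then has a zero near each \<open>c\<^sub>j\<close>. The sequential
order yields \<open>n - N\<close> further zeros inside \<open>(-1,1)\<close> (\<open>sobolev_zeros_in_interval\<close>). If \<open>S\<^sub>n / P\<^sub>n\<close> came
close to 0 anywhere else, there would be one more zero, that is \<open>n + 1\<close> zeros in total; so
\<open>|S\<^sub>n / P\<^sub>n|\<close> stays above a positive constant (\<open>SP_ratio_bounded_below\<close>).\<close>

section \<open>Polynomials annihilated by finitely many functionals\<close>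

text \<open>A linear functional removes at most one value from the set of degrees of a linear space of
polynomials: if \<open>v\<close> has the least degree among the elements on which the functional is nonzero,
then an element of any larger degree is corrected by a multiple of \<open>v\<close> without changing its degree.\<close>

lemma kernel_degrees:
  fixes L :: "'i \<Rightarrow> real poly \<Rightarrow> real"
  assumes "finite I"
    and "\<And>i p q. i \<in> I \<Longrightarrow> L i (p + q) = L i p + L i q"
    and "\<And>i a p. i \<in> I \<Longrightarrow> L i (smult a p) = a * L i p"
  shows "\<exists>X. finite X \<and> card X \<le> card I \<and>
           (\<forall>n. n \<notin> X \<longrightarrow> (\<exists>p. p \<noteq> 0 \<and> degree p = n \<and> (\<forall>i\<in>I. L i p = 0)))"
  using assms
proof (induction I rule: finite_induct)
  case empty
  have "\<exists>p::real poly. p \<noteq> 0 \<and> degree p = n" for n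
    by (rule exI[of _ "monom 1 n"]) (simp add: degree_monom_eq)
  then show ?case by (intro exI[of _ "{}"]) auto
next
  case (insert i I)
  obtain X where X: "finite X" "card X \<le> card I"
    and kill: "\<And>n. n \<notin> X \<Longrightarrow> \<exists>p. p \<noteq> 0 \<and> degree p = n \<and> (\<forall>i\<in>I. L i p = 0)"
    using insert by auto
  let ?bad = "\<lambda>n. \<exists>p. p \<noteq> 0 \<and> degree p = n \<and> (\<forall>j\<in>I. L j p = 0) \<and> L i p \<noteq> 0"
  show ?case
  proof (cases "\<exists>n. ?bad n")
    case False
    then show ?thesis
      using X kill insert.hyps by (intro exI[of _ X]) (simp, metis)
  next
    case True
    define \<delta> where "\<delta> = (LEAST n. ?bad n)"
    have "?bad \<delta>" unfolding \<delta>_def using True by (rule LeastI_ex)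
    then obtain v where v: "v \<noteq> 0" "degree v = \<delta>" "\<forall>j\<in>I. L j v = 0" "L i v \<noteq> 0" by blast
    have "\<exists>q. q \<noteq> 0 \<and> degree q = n \<and> (\<forall>j\<in>insert i I. L j q = 0)"
      if n: "n \<notin> insert \<delta> X" for n
    proof -
      obtain p where p: "p \<noteq> 0" "degree p = n" "\<forall>j\<in>I. L j p = 0" using kill n by auto
      show ?thesis
      proof (cases "L i p = 0")
        case True
        with p show ?thesis by auto
      next
        case False
        then have "\<delta> \<le> n" unfolding \<delta>_def using p by (intro Least_le) auto
        with n have "\<delta> < n" by auto
        define q where "q = p + smult (- (L i p / L i v)) v"
        have "degree (smult (- (L i p / L i v)) v) < degree p"
          using v p \<open>\<delta> < n\<close> by (meson degree_smult_le le_less_trans)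
        then have deg: "degree q = n" unfolding q_def using p by (metis degree_add_eq_left)
        then have "q \<noteq> 0" using \<open>\<delta> < n\<close> by auto
        moreover have "L j q = 0" if "j \<in> insert i I" for j
          unfolding q_def insert.prems(1)[OF that] insert.prems(2)[OF that] using that v p by auto
        ultimately show ?thesis using deg by auto
      qed
    qed
    moreover have "card (insert \<delta> X) \<le> card (insert i I)"
      using X insert.hyps by (simp add: card_insert_if)
    ultimately show ?thesis using X by (intro exI[of _ "insert \<delta> X"]) auto
  qed
qed

lemma exists_poly_in_kernel:
  fixes L :: "'i \<Rightarrow> real poly \<Rightarrow> real"
  assumes "finite I"
    and "\<And>i p q. i \<in> I \<Longrightarrow> L i (p + q) = L i p + L i q"
    and "\<And>i a p. i \<in> I \<Longrightarrow> L i (smult a p) = a * L i p"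
  obtains p where "p \<noteq> 0" "degree p \<le> card I" "\<And>i. i \<in> I \<Longrightarrow> L i p = 0"
proof -
  obtain X where X: "finite X" "card X \<le> card I"
    and kill: "\<And>n. n \<notin> X \<Longrightarrow> \<exists>p. p \<noteq> 0 \<and> degree p = n \<and> (\<forall>i\<in>I. L i p = 0)"
    using kernel_degrees[of I L] assms by auto
  have "\<not> {..card I} \<subseteq> X" using X card_mono[of X "{..card I}"] by auto
  then obtain n where "n \<le> card I" "n \<notin> X" by auto
  with kill that show ?thesis by metis
qed

lemma degree_less_if_coeff_zero:
  assumes "degree r \<le> n" "coeff r n = 0" "r \<noteq> 0"
  shows "degree r < n"
proof -
  have "degree r \<noteq> n" using assms(2,3) leading_coeff_0_iff by blast
  with assms(1) show ?thesis by simp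
qed

section \<open>Monic orthogonal polynomials\<close>

text \<open>Both \<open>L2_form\<close> and \<open>sobolev_form\<close> are instances. Positive definiteness is what gives the definite
description in \<open>monic_OP\<close> a meaning.\<close>

locale poly_inner_product =
  fixes B :: "real poly \<Rightarrow> real poly \<Rightarrow> real"
  assumes sym: "B p q = B q p"
    and add_right: "B p (q + r) = B p q + B p r"
    and smult_right: "B p (smult a q) = a * B p q"
    and pos: "p \<noteq> 0 \<Longrightarrow> B p p > 0"
begin

lemma add_left: "B (q + r) p = B q p + B r p"
  by (simp only: sym[of q p] sym[of r p] sym[of "q + r" p] add_right)

lemma smult_left: "B (smult a q) p = a * B q p"
  by (simp only: sym[of q p] sym[of "smult a q" p] smult_right)

lemma zero_left: "B 0 p = 0"
  using smult_left[of 0 0 p] by simp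

lemma diff_left: "B (q - r) p = B q p - B r p"
  using add_left[of q "smult (-1) r" p] smult_left[of "-1" r p] by simp

lemma diff_right: "B p (q - r) = B p q - B p r"
  using add_right[of p q "smult (-1) r"] smult_right[of p "-1" r] by simp

lemma sum_left: "B (\<Sum>i\<in>A. f i) p = (\<Sum>i\<in>A. B (f i) p)"
  by (induction A rule: infinite_finite_induct) (auto simp: zero_left add_left)

lemma orthogonal_lower_degree:
  assumes "\<forall>k<n. B (monom 1 k) p = 0" and "degree q < n"
  shows "B q p = 0"
proof -
  have "q = (\<Sum>i\<le>degree q. smult (coeff q i) (monom 1 i))"
    by (subst poly_as_sum_of_monoms[symmetric]) (simp add: smult_monom)
  from arg_cong[OF this, of "\<lambda>q. B q p"]
  have "B q p = (\<Sum>i\<le>degree q. coeff q i * B (monom 1 i) p)"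
    by (simp only: sum_left smult_left)
  also have "\<dots> = 0" using assms by (intro sum.neutral) auto
  finally show ?thesis .
qed

lemma monic_OP_unique:
  assumes "monic_orthogonal B n p" "monic_orthogonal B n q"
  shows "p = q"
proof (rule ccontr)
  assume "p \<noteq> q"
  then have ne: "p - q \<noteq> 0" by simp
  have pq: "degree p = n" "degree q = n" "coeff p n = 1" "coeff q n = 1"
    using assms by (auto simp: monic_orthogonal_def)
  then have "coeff (p - q) n = 0" "degree (p - q) \<le> n" by (auto intro: degree_diff_le)
  then have "degree (p - q) < n" using ne by (intro degree_less_if_coeff_zero)
  then have "B (p - q) p = 0" "B (p - q) q = 0"
    using assms orthogonal_lower_degree[of n _ "p - q"] unfolding monic_orthogonal_def by blast+
  then have "B (p - q) (p - q) = 0"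
    using add_right[of "p - q" "p - q" q] by simp
  with pos[OF ne] show False by simp
qed

text \<open>The orthogonality relations are \<open>n\<close> homogeneous conditions, so a nonzero polynomial of degree at
most \<open>n\<close> satisfies them; if its degree were smaller, it would be orthogonal to itself.\<close>

lemma monic_OP_exists: "\<exists>p. monic_orthogonal B n p"
proof -
  obtain p where p: "p \<noteq> 0" "degree p \<le> card {..<n}" "\<And>k. k \<in> {..<n} \<Longrightarrow> B (monom 1 k) p = 0"
    by (rule exists_poly_in_kernel[of "{..<n}" "\<lambda>k. B (monom 1 k)"])
       (auto simp: add_right smult_right)
  have "degree p = n"
  proof (rule ccontr)
    assume "degree p \<noteq> n"
    with p have "B p p = 0" by (intro orthogonal_lower_degree[of n]) auto
    with pos p show False by force
  qed
  have "lead_coeff p \<noteq> 0" using p by simp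
  then have "degree (smult (inverse (lead_coeff p)) p) = n"
    "lead_coeff (smult (inverse (lead_coeff p)) p) = 1"
    using \<open>degree p = n\<close> by simp_all
  moreover have "\<forall>k<n. B (monom 1 k) (smult (inverse (lead_coeff p)) p) = 0"
    using p(3) by (simp add: smult_right)
  ultimately show ?thesis unfolding monic_orthogonal_def by blast
qed

lemma monic_OP: "monic_orthogonal B n (monic_OP B n)"
proof -
  obtain p where p: "monic_orthogonal B n p" using monic_OP_exists by blast
  have "monic_OP B n = p"
    unfolding monic_OP_def using p by (rule the_equality) (rule monic_OP_unique[OF _ p])
  with p show ?thesis by simp
qed

lemma degree_monic_OP [simp]: "degree (monic_OP B n) = n"
  using monic_OP[of n] unfolding monic_orthogonal_def by blast

lemma lead_coeff_monic_OP: "coeff (monic_OP B n) n = 1"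
  using monic_OP[of n] unfolding monic_orthogonal_def by metis

lemma orthogonal_monic_OP: "degree q < n \<Longrightarrow> B q (monic_OP B n) = 0"
  using monic_OP[of n] orthogonal_lower_degree[of n "monic_OP B n" q]
  unfolding monic_orthogonal_def by blast

lemma monic_OP_nonzero [simp]: "monic_OP B n \<noteq> 0"
  using lead_coeff_monic_OP[of n] by (metis coeff_0 zero_neq_one)

lemma degree_diff_monic_OP:
  assumes "degree p = n" "coeff p n = 1" "p \<noteq> monic_OP B n"
  shows "degree (p - monic_OP B n) < n"
proof -
  have "degree (p - monic_OP B n) \<le> n"
    by (rule degree_diff_le) (simp_all add: assms)
  moreover have "coeff (p - monic_OP B n) n = 0"
    by (simp add: assms lead_coeff_monic_OP)
  moreover have "p - monic_OP B n \<noteq> 0" using assms by simp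
  ultimately show ?thesis by (rule degree_less_if_coeff_zero)
qed

lemma monic_OP_minimal:
  assumes "degree p = n" "coeff p n = 1"
  shows "B (monic_OP B n) (monic_OP B n) \<le> B p p"
proof (cases "p = monic_OP B n")
  case True
  then show ?thesis by (rule ssubst) (rule order_refl)
next
  case False
  define S q where "S = monic_OP B n" and "q = p - S"
  have "B q S = 0" unfolding S_def q_def
    by (rule orthogonal_monic_OP[OF degree_diff_monic_OP[OF assms False]])
  moreover have "B S q = B q S" by (rule sym)
  moreover have "B p p = B S S + B S q + (B q S + B q q)"
    using add_left[of S q "S + q"] add_right[of S S q] add_right[of q S q] by (simp add: q_def)
  moreover have "B q q > 0" using False by (intro pos) (simp add: q_def S_def)
  ultimately show ?thesis unfolding S_def by linarith
qed

end

section \<open>Zeros with multiplicity and Rolle's theorem\<close>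

definition zero_count :: "real set \<Rightarrow> real poly \<Rightarrow> nat" where
  "zero_count I p = (\<Sum>x\<in>{x\<in>I. poly p x = 0}. order x p)"

lemma finite_zeros_in: "p \<noteq> 0 \<Longrightarrow> finite {x\<in>I. poly p x = 0}" for p :: "real poly"
  by (rule finite_subset[OF _ poly_roots_finite[of p]]) auto

lemma zero_count_le_degree:
  assumes "p \<noteq> 0" shows "zero_count I p \<le> degree p"
proof -
  have "zero_count I p \<le> (\<Sum>x\<in>{x. poly p x = 0}. order x p)"
    unfolding zero_count_def using poly_roots_finite[OF assms] by (intro sum_mono2) auto
  also have "\<dots> \<le> degree p" using assms by (rule sum_order_le_degree)
  finally show ?thesis .
qed

lemma zero_count_insert_zero:
  assumes "p \<noteq> 0" "I \<subseteq> J" "r \<in> J" "r \<notin> I" "poly p r = 0"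
  shows "zero_count I p + 1 \<le> zero_count J p"
proof -
  have "order r p \<ge> 1" using assms order_root[of p r] by auto
  then have "zero_count I p + 1 \<le> order r p + zero_count I p" by simp
  also have "\<dots> = (\<Sum>x\<in>insert r {x\<in>I. poly p x = 0}. order x p)"
    unfolding zero_count_def using assms finite_zeros_in[OF assms(1), of I]
    by (subst sum.insert) auto
  also have "\<dots> \<le> zero_count J p" unfolding zero_count_def
    using assms finite_zeros_in[OF assms(1), of J] by (intro sum_mono2) auto
  finally show ?thesis .
qed

text \<open>The new zeros are kept away from \<open>Z\<close>, so that they can be added to those zeros of the derivative
that come from multiple zeros in \<open>Z\<close>.\<close>

lemma rolle_between_zeros:
  fixes p :: "real poly"
  assumes "finite Z" "Z \<noteq> {}" "\<forall>x\<in>Z. poly p x = 0"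
  shows "\<exists>W. finite W \<and> W \<inter> Z = {} \<and> card Z \<le> card W + 1 \<and>
             W \<subseteq> {Min Z<..<Max Z} \<and> (\<forall>w\<in>W. poly (pderiv p) w = 0)"
  using assms
proof (induction Z rule: finite_linorder_max_induct)
  case empty
  then show ?case by simp
next
  case (insert b A)
  show ?case
  proof (cases "A = {}")
    case True
    then show ?thesis by (intro exI[of _ "{}"]) auto
  next
    case False
    obtain W where W: "finite W" "W \<inter> A = {}" "card A \<le> card W + 1"
      "W \<subseteq> {Min A<..<Max A}" "\<forall>w\<in>W. poly (pderiv p) w = 0"
      using insert False by auto
    have mA: "Max A \<in> A" "Min A \<in> A" using insert False by auto
    then have mb: "Max A < b" using insert by auto
    obtain w where w: "Max A < w" "w < b" "poly (pderiv p) w = 0"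
    proof -
      obtain w where w: "Max A < w" "w < b" "poly p b - poly p (Max A) = (b - Max A) * poly (pderiv p) w"
        using poly_MVT[OF mb] by blast
      moreover have "poly p b = 0" "poly p (Max A) = 0" using insert.prems mA by auto
      ultimately have "poly (pderiv p) w = 0" using mb by simp
      with w show ?thesis using that by blast
    qed
    have "Min A \<le> Max A" using insert.hyps(1) mA(2) by simp
    then have MM: "Max (insert b A) = b" "Min (insert b A) = Min A"
      using mb by (simp_all add: Max_insert Min_insert insert.hyps(1) False)
    have "w \<notin> W" using W(4) w(1) by auto
    moreover have "b \<notin> W" using W(4) mb by auto
    moreover have "w \<notin> A" using Max_ge[OF insert.hyps(1), of w] w(1) by linarith
    ultimately have "insert w W \<inter> insert b A = {}" using W(2) w(2) by auto
    moreover have "insert w W \<subseteq> {Min A<..<b}"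
      using W(4) w(1,2) mb \<open>Min A \<le> Max A\<close> by auto
    moreover have "card (insert b A) \<le> card (insert w W) + 1"
      using W(1,3) insert.hyps \<open>w \<notin> W\<close> by (simp add: card_insert_if)
    ultimately show ?thesis unfolding MM using W(1,5) w(3)
      by (intro exI[of _ "insert w W"]) auto
  qed
qed

text \<open>A zero of multiplicity \<open>m\<close> leaves one of multiplicity \<open>m - 1\<close>, and Rolle's theorem adds a zero
between any two consecutive ones, which convexity keeps inside \<open>I\<close>.\<close>

lemma zero_count_pderiv:
  assumes "convex I" "pderiv p \<noteq> 0"
  shows "zero_count I p \<le> zero_count I (pderiv p) + 1"
proof -
  have p: "p \<noteq> 0" using assms(2) by auto
  define Z where "Z = {x\<in>I. poly p x = 0}"
  have fin: "finite Z" unfolding Z_def using p by (rule finite_zeros_in)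
  show ?thesis
  proof (cases "Z = {}")
    case True
    then show ?thesis unfolding zero_count_def Z_def[symmetric] by simp
  next
    case False
    obtain W where W: "finite W" "W \<inter> Z = {}" "card Z \<le> card W + 1"
      "W \<subseteq> {Min Z<..<Max Z}" "\<forall>w\<in>W. poly (pderiv p) w = 0"
      using rolle_between_zeros[OF fin False, of p] unfolding Z_def by auto
    have MZ: "Min Z \<in> I" "Max Z \<in> I" using Min_in[OF fin False] Max_in[OF fin False]
      by (auto simp: Z_def)
    have WI: "W \<subseteq> I"
    proof
      fix w assume "w \<in> W"
      then have "w \<in> closed_segment (Min Z) (Max Z)"
        using W(4) by (auto simp: closed_segment_eq_real_ivl)
      then show "w \<in> I" using closed_segment_subset[OF MZ assms(1)] by auto
    qed
    define Y where "Y = {x\<in>I. poly (pderiv p) x = 0}"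
    have finY: "finite Y" unfolding Y_def using assms(2) by (rule finite_zeros_in)
    have "(\<Sum>x\<in>Z. order x p) = (\<Sum>x\<in>Z. order x (pderiv p) + 1)"
      using order_pderiv[OF p] by (intro sum.cong) (auto simp: Z_def)
    also have "\<dots> = (\<Sum>x\<in>Z \<inter> Y. order x (pderiv p)) + card Z"
    proof -
      have "(\<Sum>x\<in>Z. order x (pderiv p)) = (\<Sum>x\<in>Z \<inter> Y. order x (pderiv p))"
        using fin assms(2) by (intro sum.mono_neutral_right) (auto simp: Z_def Y_def order_root)
      then show ?thesis by (simp only: sum.distrib) simp
    qed
    also have "\<dots> \<le> (\<Sum>x\<in>Z \<inter> Y. order x (pderiv p)) + (\<Sum>x\<in>W. 1) + 1"
      using W by simp
    also have "\<dots> \<le> (\<Sum>x\<in>Z \<inter> Y. order x (pderiv p)) + (\<Sum>x\<in>W. order x (pderiv p)) + 1"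
    proof -
      have "1 \<le> order x (pderiv p)" if "x \<in> W" for x
        using that W(5) assms(2) order_root[of "pderiv p" x] by auto
      then show ?thesis by (intro add_mono sum_mono order_refl) auto
    qed
    also have "\<dots> = (\<Sum>x\<in>(Z \<inter> Y) \<union> W. order x (pderiv p)) + 1"
      using W fin by (subst sum.union_disjoint) auto
    also have "\<dots> \<le> (\<Sum>x\<in>Y. order x (pderiv p)) + 1"
      using W WI finY by (intro add_mono sum_mono2 order_refl) (auto simp: Y_def)
    finally show ?thesis unfolding zero_count_def Z_def Y_def .
  qed
qed

lemma degree_pderiv_funpow: "degree ((pderiv ^^ m) p) = degree p - m" for p :: "real poly"
  by (induction m) (auto simp: degree_pderiv)

lemma pderiv_funpow_nonzero:
  fixes p :: "real poly"
  assumes "p \<noteq> 0" "m \<le> degree p"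
  shows "(pderiv ^^ m) p \<noteq> 0"
  using assms(2)
proof (induction m)
  case (Suc m)
  have "degree ((pderiv ^^ m) p) \<noteq> 0" using Suc.prems by (simp add: degree_pderiv_funpow)
  then show ?case by (simp add: pderiv_eq_0_iff)
qed (use assms in simp)

lemma zero_count_pderiv_funpow:
  assumes "convex I" "p \<noteq> 0" "m \<le> degree p"
  shows "zero_count I p \<le> zero_count I ((pderiv ^^ m) p) + m"
  using assms(3)
proof (induction m)
  case (Suc m)
  have "pderiv ((pderiv ^^ m) p) \<noteq> 0" using pderiv_funpow_nonzero[OF assms(2) Suc.prems] by simp
  from zero_count_pderiv[OF assms(1) this] Suc show ?case by simp
qed simp

lemma pderiv_funpow_eq_0: "degree p < m \<Longrightarrow> (pderiv ^^ m) p = 0" for p :: "real poly"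
proof (induction m)
  case (Suc m)
  then show ?case
    by (cases "degree p < m") (auto simp: pderiv_eq_0_iff degree_pderiv_funpow)
qed simp

lemma poly_pderiv_funpow_add:
  "poly ((pderiv ^^ m) (p + q)) x = poly ((pderiv ^^ m) p) x + poly ((pderiv ^^ m) q) x"
  for p q :: "real poly"
proof -
  have "(pderiv ^^ m) (p + q) = (pderiv ^^ m) p + (pderiv ^^ m) q"
    by (induction m) (auto simp: pderiv_add)
  then show ?thesis by simp
qed

lemma poly_pderiv_funpow_smult:
  "poly ((pderiv ^^ m) (smult a p)) x = a * poly ((pderiv ^^ m) p) x" for p :: "real poly"
proof -
  have "(pderiv ^^ m) (smult a p) = smult a ((pderiv ^^ m) p)"
    by (induction m) (auto simp: pderiv_smult)
  then show ?thesis by simp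
qed

text \<open>Passing from the derivative of order \<open>\<nu>\<^sub>i\<close> to the one of order \<open>\<nu>\<^sub>i\<^sub>+\<^sub>1\<close> loses at most
\<open>\<nu>\<^sub>i\<^sub>+\<^sub>1 - \<nu>\<^sub>i\<close> zeros in the hull of the interval and of the points used so far, and the condition
at the next point, which lies outside this hull, provides a new zero. The conditions of order
above \<open>degree Q\<close> hold trivially and do not count.\<close>

lemma degree_bound_sequentially_ordered:
  fixes c :: "nat \<Rightarrow> real"
  assumes seq: "sequentially_ordered N c d" and Q: "Q \<noteq> 0"
    and van: "\<And>j. j \<in> {1..N} \<Longrightarrow> poly ((pderiv ^^ d j) Q) (c j) = 0"
  shows "zero_count {-1<..<1} Q + card {j\<in>{1..N}. d j \<le> degree Q} \<le> degree Q"
proof -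
  obtain \<pi> where bij: "bij_betw \<pi> {1..N} {1..N}"
    and mono: "\<And>i j. i \<in> {1..N} \<Longrightarrow> j \<in> {1..N} \<Longrightarrow> i \<le> j \<Longrightarrow> d (\<pi> i) \<le> d (\<pi> j)"
    and hull: "\<And>k. k \<in> {1..N} \<Longrightarrow> c (\<pi> k) \<notin> convex hull ({-1<..<1} \<union> (\<lambda>i. c (\<pi> i)) ` {1..<k})"
    using seq unfolding sequentially_ordered_def by blast
  define \<nu> where "\<nu> i = (if i = 0 then 0 else d (\<pi> i))" for i
  define I where "I i = convex hull ({-1<..<1} \<union> (\<lambda>i. c (\<pi> i)) ` {1..i})" for i :: nat
  have step: "zero_count {-1<..<1} Q + i \<le> zero_count (I i) ((pderiv ^^ \<nu> i) Q) + \<nu> i"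
    if "i \<le> N" "\<nu> i \<le> degree Q" for i
    using that
  proof (induction i)
    case 0
    have "convex hull {-1<..<1} = {-1<..<1::real}" by (rule hull_same) simp
    then show ?case by (simp add: I_def \<nu>_def)
  next
    case (Suc i)
    define R where "R = (pderiv ^^ \<nu> i) Q"
    define T where "T = (pderiv ^^ \<nu> (Suc i)) Q"
    have le: "\<nu> i \<le> \<nu> (Suc i)" using mono[of i "Suc i"] Suc.prems by (simp add: \<nu>_def)
    have IH: "zero_count {-1<..<1} Q + i \<le> zero_count (I i) R + \<nu> i"
      using Suc le unfolding R_def by simp
    have R: "R \<noteq> 0" using pderiv_funpow_nonzero[OF Q] le Suc.prems unfolding R_def by simp
    have TR: "T = (pderiv ^^ (\<nu> (Suc i) - \<nu> i)) R"
      unfolding T_def R_def using le by (metis comp_apply funpow_add le_add_diff_inverse2)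
    have T0: "T \<noteq> 0" using pderiv_funpow_nonzero[OF Q] Suc.prems unfolding T_def by simp
    have "zero_count (I i) R \<le> zero_count (I i) T + (\<nu> (Suc i) - \<nu> i)"
      unfolding TR using Suc.prems le
      by (intro zero_count_pderiv_funpow R)
        (auto simp: I_def R_def degree_pderiv_funpow convex_convex_hull)
    moreover have "zero_count (I i) T + 1 \<le> zero_count (I (Suc i)) T"
    proof (rule zero_count_insert_zero[OF T0])
      show "I i \<subseteq> I (Suc i)" unfolding I_def by (rule hull_mono) auto
      show "c (\<pi> (Suc i)) \<in> I (Suc i)" unfolding I_def by (rule hull_inc) auto
      show "c (\<pi> (Suc i)) \<notin> I i" using hull[of "Suc i"] Suc.prems
        unfolding I_def by (simp add: atLeastLessThanSuc_atLeastAtMost)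
      have "\<pi> (Suc i) \<in> {1..N}" using bij Suc.prems by (auto simp: bij_betw_def)
      from van[OF this] show "poly T (c (\<pi> (Suc i))) = 0" by (simp add: T_def \<nu>_def)
    qed
    ultimately show ?case using IH le unfolding T_def by linarith
  qed
  define A where "A = {j\<in>{1..N}. d (\<pi> j) \<le> degree Q}"
  have cardA: "card {j\<in>{1..N}. d j \<le> degree Q} = card A"
  proof -
    have "\<pi> ` {1..N} = {1..N}" using bij by (simp add: bij_betw_def)
    then have "{j\<in>{1..N}. d j \<le> degree Q} = {j\<in>\<pi> ` {1..N}. d j \<le> degree Q}" by simp
    also have "\<dots> = \<pi> ` A" unfolding A_def by blast
    finally have "{j\<in>{1..N}. d j \<le> degree Q} = \<pi> ` A" .
    moreover have "inj_on \<pi> A"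
      using bij unfolding bij_betw_def A_def by (blast intro: inj_on_subset)
    ultimately show ?thesis by (simp add: card_image)
  qed
  define i where "i = (if A = {} then 0 else Max A)"
  have fA: "finite A" unfolding A_def by simp
  have "card A \<le> i"
  proof -
    have "A \<subseteq> {1..i}" unfolding i_def using fA by (auto simp: A_def)
    from card_mono[OF _ this] show ?thesis by simp
  qed
  moreover have "i \<le> N \<and> \<nu> i \<le> degree Q"
    using Max_in[OF fA] by (auto simp: i_def \<nu>_def A_def)
  moreover have "zero_count (I i) ((pderiv ^^ \<nu> i) Q) \<le> degree Q - \<nu> i"
    if "\<nu> i \<le> degree Q"
    using zero_count_le_degree[OF pderiv_funpow_nonzero[OF Q that]] by (simp add: degree_pderiv_funpow)
  ultimately show ?thesis using step[of i] cardA by linarith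
qed

section \<open>Polynomials with prescribed sign changes\<close>

text \<open>The conclusion covers the end points because a measure on \<open>[-1,1]\<close> may have mass there.\<close>

lemma constant_sign_if_even_zeros:
  fixes p :: "real poly"
  assumes "p \<noteq> 0" "\<And>x. a < x \<Longrightarrow> x < b \<Longrightarrow> even (order x p)"
  shows "(\<forall>x\<in>{a..b}. poly p x \<ge> 0) \<or> (\<forall>x\<in>{a..b}. poly p x \<le> 0)"
  using assms
proof (induction "degree p" arbitrary: p rule: less_induct)
  case less
  show ?case
  proof (cases "\<exists>r. a < r \<and> r < b \<and> poly p r = 0")
    case False
    show ?thesis
    proof (rule ccontr)
      assume "\<not> ?thesis"
      then obtain x y where xy: "x \<in> {a..b}" "y \<in> {a..b}" "poly p x < 0" "poly p y > 0"
        by (force simp: not_le)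
      then have "x \<noteq> y" by auto
      then consider "x < y" | "y < x" by linarith
      then show False
      proof cases
        case 1
        from poly_IVT_pos[OF this, of p] xy False show False by force
      next
        case 2
        from poly_IVT_neg[OF this, of p] xy False show False by force
      qed
    qed
  next
    case True
    then obtain r where r: "a < r" "r < b" "poly p r = 0" by blast
    have "order r p \<noteq> 0" "even (order r p)" using r less.prems order_root by auto
    then have "2 \<le> order r p" by presburger
    then have "[:- r, 1:] ^ 2 dvd p" using less.prems order_divides by blast
    then obtain q where q: "p = [:- r, 1:] ^ 2 * q" by (auto simp: dvd_def)
    have q0: "q \<noteq> 0" using q less.prems by auto
    have "degree p = 2 + degree q" unfolding q using q0
      by (subst degree_mult_eq) (auto simp: degree_power_eq)
    moreover have "even (order x q)" if "a < x" "x < b" for x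
    proof -
      have "order x p = order x ([:- r, 1:] ^ 2) + order x q"
        using order_mult[of "[:- r, 1:] ^ 2" q x] less.prems q by simp
      also have "order x ([:- r, 1:] ^ 2) = 2 * order x [:- r, 1:]"
        unfolding power2_eq_square by (subst order_mult) auto
      finally show ?thesis using less.prems(2)[OF that] by simp
    qed
    ultimately have IH: "(\<forall>x\<in>{a..b}. poly q x \<ge> 0) \<or> (\<forall>x\<in>{a..b}. poly q x \<le> 0)"
      using less.hyps[of q] q0 by auto
    have "poly p x = (x - r)\<^sup>2 * poly q x" for x by (simp add: q)
    with IH show ?thesis by (auto simp: zero_le_mult_iff mult_le_0_iff)
  qed
qed

text \<open>Choose \<open>Q\<close> of least degree among the nonzero polynomials that vanish on \<open>X\<close> and satisfy the
derivative conditions, and let \<open>k\<close> be the number of conditions of order at most \<open>degree Q\<close>.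
Counting conditions, \<open>degree Q \<le> card X + k\<close>; counting zeros by Rolle's theorem, \<open>degree Q\<close> is at
least \<open>k\<close> plus the number of zeros in \<open>(-1,1)\<close>. Hence \<open>Q\<close> has no zeros there besides simple ones at
\<open>X\<close>, and \<open>Q * S\<close> has only zeros of even order. Minimality is needed because a polynomial of low
degree may satisfy conditions of high order trivially.\<close>

lemma exists_sign_matching_poly:
  fixes S :: "real poly"
  assumes seq: "sequentially_ordered N c d" and S: "S \<noteq> 0"
    and X: "X = {x\<in>{-1<..<1}. odd (order x S)}"
  obtains Q where "Q \<noteq> 0" "degree Q \<le> card X + N"
    "\<And>j. j \<in> {1..N} \<Longrightarrow> poly ((pderiv ^^ d j) Q) (c j) = 0"
    "(\<forall>x\<in>{-1..1}. poly (Q * S) x \<ge> 0) \<or> (\<forall>x\<in>{-1..1}. poly (Q * S) x \<le> 0)"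
proof -
  have finX: "finite X"
    by (rule finite_subset[OF _ poly_roots_finite[OF S]]) (auto simp: X order_root intro: ccontr)
  define adm where "adm Q \<longleftrightarrow> Q \<noteq> 0 \<and> (\<forall>x\<in>X. poly Q x = 0) \<and>
      (\<forall>j\<in>{1..N}. poly ((pderiv ^^ d j) Q) (c j) = 0)" for Q :: "real poly"
  have ex: "\<exists>Q. Q \<noteq> 0 \<and> degree Q \<le> card X + card {j\<in>{1..N}. d j \<le> e} \<and> (\<forall>x\<in>X. poly Q x = 0) \<and>
      (\<forall>j\<in>{1..N}. d j \<le> e \<longrightarrow> poly ((pderiv ^^ d j) Q) (c j) = 0)" for e
  proof -
    define J where "J = X <+> {j\<in>{1..N}. d j \<le> e}"
    define L where "L i Q = (case i of Inl x \<Rightarrow> poly Q x | Inr j \<Rightarrow> poly ((pderiv ^^ d j) Q) (c j))"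
      for i and Q :: "real poly"
    obtain Q where "Q \<noteq> 0" "degree Q \<le> card J" "\<And>i. i \<in> J \<Longrightarrow> L i Q = 0"
      by (rule exists_poly_in_kernel[of J L])
        (auto simp: J_def L_def finX poly_pderiv_funpow_add poly_pderiv_funpow_smult split: sum.splits)
    moreover have "card J = card X + card {j\<in>{1..N}. d j \<le> e}"
      unfolding J_def using finX by (simp add: card_Plus)
    ultimately show ?thesis by (force simp: J_def L_def)
  qed
  define e where "e = (LEAST e. \<exists>Q. adm Q \<and> degree Q = e)"
  have "\<exists>Q. adm Q \<and> degree Q = e"
    unfolding e_def
  proof (rule LeastI_ex)
    obtain Q where "Q \<noteq> 0" "\<forall>x\<in>X. poly Q x = 0"
      "\<forall>j\<in>{1..N}. d j \<le> Max (d ` {1..N}) \<longrightarrow> poly ((pderiv ^^ d j) Q) (c j) = 0"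
      using ex[of "Max (d ` {1..N})"] by blast
    then have "adm Q" unfolding adm_def by auto
    then show "\<exists>e Q. adm Q \<and> degree Q = e" by blast
  qed
  then obtain Q where Q: "adm Q" "degree Q = e" by blast
  have min: "e \<le> degree R" if "adm R" for R
    unfolding e_def using that by (intro Least_le) blast
  define k where "k = card {j\<in>{1..N}. d j \<le> e}"
  have "e \<le> card X + k"
  proof (rule ccontr)
    assume less: "\<not> e \<le> card X + k"
    obtain R where R: "R \<noteq> 0" "degree R \<le> card X + k" "\<forall>x\<in>X. poly R x = 0"
      "\<forall>j\<in>{1..N}. d j \<le> e \<longrightarrow> poly ((pderiv ^^ d j) R) (c j) = 0"
      using ex[of e] unfolding k_def by blast
    have "poly ((pderiv ^^ d j) R) (c j) = 0" if "j \<in> {1..N}" for j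
      using R that less by (cases "d j \<le> e") (auto simp: pderiv_funpow_eq_0)
    with R have "adm R" unfolding adm_def by blast
    from min[OF this] R less show False by simp
  qed
  moreover have "zero_count {-1<..<1} Q + k \<le> e"
    using degree_bound_sequentially_ordered[OF seq, of Q] Q unfolding adm_def k_def by auto
  ultimately have count: "zero_count {-1<..<1} Q \<le> card X" by simp
  define Z where "Z = {x\<in>{-1<..<1}. poly Q x = 0}"
  have Q0: "Q \<noteq> 0" using Q by (simp add: adm_def)
  have finZ: "finite Z" unfolding Z_def by (rule finite_zeros_in[OF Q0])
  have XZ: "X \<subseteq> Z" using Q unfolding Z_def adm_def X by auto
  have ord: "1 \<le> order x Q" if "x \<in> Z" for x
    using that Q0 order_root[of Q x] by (auto simp: Z_def)
  have Zord: "order x Q = 1" if x: "x \<in> Z" for x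
  proof (rule ccontr)
    assume "order x Q \<noteq> 1"
    then have "(\<Sum>x\<in>Z. 1) < (\<Sum>x\<in>Z. order x Q)"
      using ord x finZ by (intro sum_strict_mono_ex1) (auto intro!: bexI[of _ x] simp: le_neq_implies_less)
    then show False using count card_mono[OF finZ XZ] by (simp add: zero_count_def Z_def)
  qed
  then have "card Z \<le> card X" using count by (simp add: zero_count_def Z_def)
  then have "X = Z" using card_seteq[OF finZ XZ] by simp
  have QS: "Q * S \<noteq> 0" using Q0 S by simp
  \<comment> \<open>Simple zeros of \<open>Q\<close> sit exactly at the zeros of odd order of \<open>S\<close>.\<close>
  have "even (order x (Q * S))" if "-1 < x" "x < 1" for x
  proof (cases "x \<in> X")
    case True
    then have "odd (order x S)" "order x Q = 1" using Zord \<open>X = Z\<close> by (auto simp: X)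
    then show ?thesis by (simp add: order_mult[OF QS])
  next
    case False
    then have "even (order x S)" "poly Q x \<noteq> 0" using that \<open>X = Z\<close> by (auto simp: X Z_def)
    then show ?thesis by (simp add: order_mult[OF QS] order_0I)
  qed
  then have sign: "(\<forall>x\<in>{-1..1}. poly (Q * S) x \<ge> 0) \<or> (\<forall>x\<in>{-1..1}. poly (Q * S) x \<le> 0)"
    by (intro constant_sign_if_even_zeros[OF QS]) auto
  have "k \<le> card {1..N}" unfolding k_def by (intro card_mono) auto
  then have "degree Q \<le> card X + N" using \<open>e \<le> card X + k\<close> Q(2) by simp
  moreover have "\<And>j. j \<in> {1..N} \<Longrightarrow> poly ((pderiv ^^ d j) Q) (c j) = 0"
    using Q(1) unfolding adm_def by blast
  ultimately show thesis using that[OF Q0] sign by blast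
qed

section \<open>Orthogonal polynomials of a measure on the interval\<close>

locale measure_on_Icc =
  fixes M :: "real measure"
  assumes measure_Icc: "borel_measure_Icc M"
begin

sublocale finite_measure M
  using measure_Icc by (simp add: borel_measure_Icc_def)

lemma sets_M [measurable_cong]: "sets M = sets borel"
  using measure_Icc by (simp add: borel_measure_Icc_def)

lemma AE_Icc: "AE x in M. x \<in> {-1..1}"
  using measure_Icc
  by (intro AE_I[of _ _ "- {-1..1}"]) (auto simp: borel_measure_Icc_def sets_M)

lemma integrable_bounded:
  fixes f :: "real \<Rightarrow> 'b::{banach, second_countable_topology}"
  assumes "f \<in> borel_measurable borel" "\<And>x. x \<in> {-1..1} \<Longrightarrow> norm (f x) \<le> B"
  shows "integrable M f"
proof (rule integrable_const_bound)
  show "AE x in M. norm (f x) \<le> B"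
    using AE_Icc by eventually_elim (rule assms(2))
  show "f \<in> borel_measurable M" using assms(1) by (simp add: measurable_cong_sets[OF sets_M refl])
qed

lemma integrable_continuous:
  fixes f :: "real \<Rightarrow> 'b::{banach, second_countable_topology}"
  assumes "f \<in> borel_measurable borel" "continuous_on {-1..1} f"
  shows "integrable M f"
proof -
  have "bounded (f ` {-1..1})"
    by (intro compact_imp_bounded compact_continuous_image assms(2)) simp
  then obtain B where "\<forall>x\<in>{-1..1}. norm (f x) \<le> B"
    by (auto simp: bounded_iff)
  then have "\<And>x. x \<in> {-1..1} \<Longrightarrow> norm (f x) \<le> B" by blast
  with assms(1) show ?thesis by (rule integrable_bounded)
qed

lemma integrable_everywhere_continuous:
  fixes f :: "real \<Rightarrow> 'b::{banach, second_countable_topology}"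
  assumes "continuous_on UNIV f"
  shows "integrable M f"
  using assms by (intro integrable_continuous borel_measurable_continuous_onI)
    (auto intro: continuous_on_subset)

lemma set_integral_Icc:
  fixes f :: "real \<Rightarrow> 'b::{banach, second_countable_topology}"
  assumes [measurable]: "f \<in> borel_measurable borel"
  shows "(LINT x:{-1..1}|M. f x) = (LINT x|M. f x)"
  unfolding set_lebesgue_integral_def
proof (rule integral_cong_AE)
  show "AE x in M. indicat_real {-1..1} x *\<^sub>R f x = f x"
    using AE_Icc by eventually_elim simp
qed (simp_all add: measurable_cong_sets[OF sets_M refl])

lemma integral_mono_Icc:
  fixes f g :: "real \<Rightarrow> real"
  assumes "integrable M f" "integrable M g" "\<And>x. x \<in> {-1..1} \<Longrightarrow> f x \<le> g x"
  shows "(LINT x|M. f x) \<le> (LINT x|M. g x)"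
proof (rule integral_mono_AE[OF assms(1,2)])
  show "AE x in M. f x \<le> g x"
    using AE_Icc by eventually_elim (rule assms(3))
qed

lemma L2_form_eq: "L2_form M f g = (LINT x|M. poly f x * poly g x)"
  unfolding L2_form_def
  by (intro set_integral_Icc borel_measurable_continuous_onI continuous_intros)

lemma poly_eq_0_if_AE:
  assumes "AE x in M. poly p x = 0"
  shows "p = 0"
proof (rule ccontr)
  assume p: "p \<noteq> 0"
  let ?U = "{x. poly p x \<noteq> 0}"
  have op: "open ?U"
    by (intro open_Collect_neq continuous_intros)
  have "emeasure M ?U = 0"
    using AE_iff_measurable[of ?U M "\<lambda>x. poly p x = 0"] assms op
    by (simp add: sets_M sets_eq_imp_space_eq[OF sets_M])
  then have "measure_support M \<subseteq> {x. poly p x = 0}"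
    using op unfolding measure_support_def by auto
  then have "finite (measure_support M)"
    using poly_roots_finite[OF p] finite_subset by blast
  then show False using measure_Icc by (simp add: borel_measure_Icc_def)
qed

lemma L2_form_pos:
  assumes "p \<noteq> 0" shows "L2_form M p p > 0"
proof -
  have int: "integrable M (\<lambda>x. poly p x * poly p x)"
    by (intro integrable_everywhere_continuous continuous_intros)
  have "L2_form M p p \<ge> 0" unfolding L2_form_eq by (intro integral_nonneg_AE) simp
  moreover have "L2_form M p p \<noteq> 0"
  proof
    assume "L2_form M p p = 0"
    then have "AE x in M. poly p x * poly p x = 0"
      using integral_nonneg_eq_0_iff_AE[OF int] by (simp add: L2_form_eq)
    then have "AE x in M. poly p x = 0" by simp
    from poly_eq_0_if_AE[OF this] assms show False by simp
  qed
  ultimately show ?thesis by simp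
qed

sublocale L2: poly_inner_product "L2_form M"
proof
  fix p q r :: "real poly" and a :: real
  have int: "integrable M (\<lambda>x. poly f x * poly g x)" for f g
    by (intro integrable_everywhere_continuous continuous_intros)
  show "L2_form M p q = L2_form M q p" by (simp add: L2_form_eq mult.commute)
  show "L2_form M p (q + r) = L2_form M p q + L2_form M p r"
    using int by (simp add: L2_form_eq distrib_left)
  show "L2_form M p (smult a q) = a * L2_form M p q"
    by (simp add: L2_form_eq mult.left_commute)
  show "p \<noteq> 0 \<Longrightarrow> L2_form M p p > 0" by (rule L2_form_pos)
qed

lemma L2_form_mult_shift: "L2_form M (r * p) q = L2_form M p (r * q)"
  by (simp add: L2_form_eq mult_ac)

abbreviation P :: "nat \<Rightarrow> real poly" where "P \<equiv> monic_OP (L2_form M)"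

text \<open>Pair the recurrence with \<open>P\<^sub>n\<close> and move the factor \<open>x\<close> to the other side.\<close>

lemma norm_recurrence:
  assumes rec: "P (Suc (Suc n)) = [:- b, 1:] * P (Suc n) - smult (a\<^sup>2) (P n)"
  shows "L2_form M (P (Suc n)) (P (Suc n)) = a\<^sup>2 * L2_form M (P n) (P n)"
proof -
  let ?B = "L2_form M" and ?xP = "[:0, 1:] * P n"
  have "0 = ?B (P n) (P (Suc (Suc n)))" by (simp add: L2.orthogonal_monic_OP)
  also have "\<dots> = ?B (P n) ([:0, 1:] * P (Suc n)) - b * ?B (P n) (P (Suc n)) - a\<^sup>2 * ?B (P n) (P n)"
    unfolding rec by (simp add: L2.diff_right L2.smult_right)
  also have "?B (P n) ([:0, 1:] * P (Suc n)) = ?B ?xP (P (Suc n))" by (rule L2_form_mult_shift[symmetric])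
  also have "?B (P n) (P (Suc n)) = 0" by (simp add: L2.orthogonal_monic_OP)
  finally have *: "?B ?xP (P (Suc n)) = a\<^sup>2 * ?B (P n) (P n)" by simp
  have "degree ?xP = Suc n" "coeff ?xP (Suc n) = 1"
    using L2.lead_coeff_monic_OP[of n] by (simp_all add: degree_pCons_eq)
  then have "?B (?xP - P (Suc n)) (P (Suc n)) = 0"
    by (cases "?xP = P (Suc n)")
      (auto simp: L2.zero_left intro!: L2.orthogonal_monic_OP L2.degree_diff_monic_OP)
  then show ?thesis using * unfolding L2.diff_left by simp
qed

text \<open>As \<open>a\<^sub>n\<close> tends to \<open>1/2\<close>, it is eventually at least \<open>1/4\<close>, so that the squared norms lose at most a
factor of 16 in each step.\<close>

lemma norm_bounded_below:
  assumes "Nevai_class_0_1 M"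
  shows "\<exists>n0. \<forall>n\<ge>n0. \<forall>m. L2_form M (P n) (P n) \<le> 16 ^ m * L2_form M (P (n + m)) (P (n + m))"
proof -
  obtain a b where a: "\<And>n. n \<ge> 1 \<Longrightarrow> a n > 0" "a \<longlonglongrightarrow> (1/2 :: real)"
    and rec: "\<And>n. P (Suc n) = [:- b n, 1:] * P n - (if n = 0 then 0 else smult ((a n)\<^sup>2) (P (n - 1)))"
    using assms unfolding Nevai_class_0_1_def by blast
  have "eventually (\<lambda>n. a n > 1/4) sequentially"
    using a(2) by (rule order_tendstoD) simp
  then obtain n0 where n0: "\<And>n. n \<ge> n0 \<Longrightarrow> a n > 1/4"
    by (auto simp: eventually_sequentially)
  have one: "L2_form M (P n) (P n) \<le> 16 * L2_form M (P (Suc n)) (P (Suc n))" if "n \<ge> n0" for n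
  proof -
    have "P (Suc (Suc n)) = [:- b (Suc n), 1:] * P (Suc n) - smult ((a (Suc n))\<^sup>2) (P n)"
      using rec[of "Suc n"] by simp
    then have *: "L2_form M (P (Suc n)) (P (Suc n)) = (a (Suc n))\<^sup>2 * L2_form M (P n) (P n)"
      by (rule norm_recurrence)
    have "(1/4)\<^sup>2 \<le> (a (Suc n))\<^sup>2" using n0[of "Suc n"] that by (intro power_mono) auto
    then have "(1/4)\<^sup>2 * L2_form M (P n) (P n) \<le> (a (Suc n))\<^sup>2 * L2_form M (P n) (P n)"
      using L2.pos[OF L2.monic_OP_nonzero[of n]] by (intro mult_right_mono) auto
    then show ?thesis unfolding * by (simp add: power2_eq_square)
  qed
  have "L2_form M (P n) (P n) \<le> 16 ^ m * L2_form M (P (n + m)) (P (n + m))" if "n \<ge> n0" for n m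
  proof (induction m)
    case (Suc m)
    have "16 ^ m * L2_form M (P (n + m)) (P (n + m))
        \<le> 16 ^ m * (16 * L2_form M (P (Suc (n + m))) (P (Suc (n + m))))"
      using one[of "n + m"] that by (intro mult_left_mono) auto
    with Suc.IH show ?case by (simp only: power_Suc add_Suc_right mult_ac)
  qed simp
  then show ?thesis by blast
qed

end

section \<open>The Sobolev inner product\<close>

lemma dvd_pderiv_if_power_dvd:
  fixes p :: "real poly"
  assumes "[:- c, 1:] ^ Suc m dvd p"
  shows "[:- c, 1:] ^ m dvd pderiv p"
proof -
  obtain q where q: "p = [:- c, 1:] ^ Suc m * q" using assms by (auto simp: dvd_def)
  have "pderiv p = [:- c, 1:] ^ m * ([:- c, 1:] * pderiv q + smult (of_nat (Suc m)) q)"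
    unfolding q pderiv_mult pderiv_power_Suc
    by (simp add: pderiv_pCons algebra_simps)
  then show ?thesis by (simp only: dvd_triv_left)
qed

lemma poly_pderiv_funpow_eq_0:
  fixes p :: "real poly"
  assumes "[:- c, 1:] ^ Suc m dvd p"
  shows "poly ((pderiv ^^ m) p) c = 0"
  using assms
proof (induction m arbitrary: p)
  case 0
  then show ?case by (simp add: poly_eq_0_iff_dvd)
next
  case (Suc m)
  from Suc.IH[OF dvd_pderiv_if_power_dvd[OF Suc.prems]] show ?case
    by (simp add: funpow_Suc_right del: funpow.simps)
qed

locale sobolev = measure_on_Icc +
  fixes N :: nat and c :: "nat \<Rightarrow> real" and d :: "nat \<Rightarrow> nat" and \<eta> :: "nat \<Rightarrow> real"
  assumes \<eta>_pos: "\<And>j. j \<in> {1..N} \<Longrightarrow> \<eta> j > 0"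
begin

abbreviation B :: "real poly \<Rightarrow> real poly \<Rightarrow> real" where "B \<equiv> sobolev_form M N c d \<eta>"
abbreviation S :: "nat \<Rightarrow> real poly" where "S \<equiv> monic_OP B"

lemma sobolev_form_eq:
  "B f g = L2_form M f g +
     (\<Sum>j\<in>{1..N}. \<eta> j * poly ((pderiv ^^ d j) f) (c j) * poly ((pderiv ^^ d j) g) (c j))"
  by (simp add: sobolev_form_def L2_form_def)

lemma sobolev_mass_le:
  shows "L2_form M p p \<le> B p p"
    and "j \<in> {1..N} \<Longrightarrow> \<eta> j * (poly ((pderiv ^^ d j) p) (c j))\<^sup>2 \<le> B p p"
proof -
  let ?t = "\<lambda>j. \<eta> j * poly ((pderiv ^^ d j) p) (c j) * poly ((pderiv ^^ d j) p) (c j)"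
  have t: "?t j \<ge> 0" if "j \<in> {1..N}" for j
    using \<eta>_pos[OF that] by (simp add: mult.assoc)
  show "L2_form M p p \<le> B p p" unfolding sobolev_form_eq using sum_nonneg[of "{1..N}" ?t, OF t] by simp
  have "L2_form M p p \<ge> 0" using L2.pos[of p] by (cases "p = 0") (auto simp: L2.zero_left)
  moreover assume "j \<in> {1..N}"
  then have "?t j \<le> sum ?t {1..N}" by (intro member_le_sum t) auto
  ultimately show "\<eta> j * (poly ((pderiv ^^ d j) p) (c j))\<^sup>2 \<le> B p p"
    unfolding sobolev_form_eq by (simp add: power2_eq_square mult.assoc)
qed

sublocale sob: poly_inner_product B
proof
  fix p q r :: "real poly" and a :: real
  show "B p q = B q p" unfolding sobolev_form_eq
    by (simp add: L2.sym[of p q] mult.assoc mult.commute[of "poly ((pderiv ^^ _) p) _"])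
  show "B p (q + r) = B p q + B p r"
    by (simp add: sobolev_form_eq L2.add_right poly_pderiv_funpow_add distrib_left sum.distrib)
  show "B p (smult a q) = a * B p q"
    by (simp add: sobolev_form_eq L2.smult_right poly_pderiv_funpow_smult distrib_left sum_distrib_left mult_ac)
  show "p \<noteq> 0 \<Longrightarrow> B p p > 0"
    using sobolev_mass_le(1)[of p] L2.pos[of p] by simp
qed

text \<open>A competitor in the minimum problem for \<open>S\<^sub>n\<close> is \<open>\<sigma> P\<^sub>m\<close> with \<open>m = n - degree \<sigma>\<close>, where \<open>\<sigma>\<close>
vanishes at each \<open>c\<^sub>j\<close> to an order above \<open>d\<^sub>j\<close>: this removes the discrete part of the product.\<close>

lemma sobolev_norm_bound:
  assumes "Nevai_class_0_1 M"
  shows "\<exists>C\<ge>0. \<exists>n0. \<forall>n\<ge>n0. B (S n) (S n) \<le> C * L2_form M (P n) (P n)"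
proof -
  define \<sigma> where "\<sigma> = (\<Prod>j\<in>{1..N}. [:- c j, 1:] ^ (d j + 1))"
  define D where "D = degree \<sigma>"
  have monic: "lead_coeff \<sigma> = 1"
    unfolding \<sigma>_def by (simp add: lead_coeff_prod lead_coeff_power del: power_Suc)
  have "bounded ((\<lambda>x. (poly \<sigma> x)\<^sup>2) ` {-1..1})"
    by (intro compact_imp_bounded compact_continuous_image continuous_intros) simp
  then obtain A where "\<forall>x\<in>{-1..1}. \<bar>(poly \<sigma> x)\<^sup>2\<bar> \<le> A"
    by (auto simp: bounded_iff)
  then have A: "\<And>x. x \<in> {-1..1} \<Longrightarrow> \<bar>(poly \<sigma> x)\<^sup>2\<bar> \<le> A" by blast
  have "A \<ge> 0" by (rule order_trans[OF abs_ge_zero A[of 0]]) simp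
  obtain n0 where n0: "\<And>n m. n \<ge> n0 \<Longrightarrow>
      L2_form M (P n) (P n) \<le> 16 ^ m * L2_form M (P (n + m)) (P (n + m))"
    using norm_bounded_below[OF assms] by blast
  have "B (S n) (S n) \<le> (A * 16 ^ D) * L2_form M (P n) (P n)" if n: "n \<ge> n0 + D" for n
  proof -
    let ?p = "P (n - D)"
    have "degree (\<sigma> * ?p) = n" "coeff (\<sigma> * ?p) n = 1"
    proof -
      have "\<sigma> \<noteq> 0" using monic by auto
      then show deg: "degree (\<sigma> * ?p) = n" using n by (simp add: degree_mult_eq D_def)
      have "lead_coeff (\<sigma> * ?p) = 1"
        using monic L2.lead_coeff_monic_OP[of "n - D"] by (simp add: lead_coeff_mult)
      then show "coeff (\<sigma> * ?p) n = 1" unfolding deg .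
    qed
    then have "B (S n) (S n) \<le> B (\<sigma> * ?p) (\<sigma> * ?p)" by (rule sob.monic_OP_minimal)
    also have "\<dots> = L2_form M (\<sigma> * ?p) (\<sigma> * ?p)"
    proof -
      have "poly ((pderiv ^^ d j) (\<sigma> * ?p)) (c j) = 0" if "j \<in> {1..N}" for j
      proof (rule poly_pderiv_funpow_eq_0)
        have "[:- c j, 1:] ^ (d j + 1) dvd \<sigma>"
          unfolding \<sigma>_def using that by (intro dvd_prodI) auto
        then show "[:- c j, 1:] ^ Suc (d j) dvd \<sigma> * ?p" by simp
      qed
      then show ?thesis unfolding sobolev_form_eq by simp
    qed
    also have "\<dots> = (LINT x|M. poly (\<sigma> * ?p) x * poly (\<sigma> * ?p) x)"
      by (rule L2_form_eq)
    also have "\<dots> \<le> (LINT x|M. A * (poly ?p x * poly ?p x))"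
    proof (rule integral_mono_Icc)
      show "poly (\<sigma> * ?p) x * poly (\<sigma> * ?p) x \<le> A * (poly ?p x * poly ?p x)"
        if x: "x \<in> {-1..1}" for x
      proof -
        from A[OF x] have "(poly \<sigma> x)\<^sup>2 * (poly ?p x * poly ?p x) \<le> A * (poly ?p x * poly ?p x)"
          by (intro mult_right_mono) auto
        then show ?thesis by (simp add: power2_eq_square mult_ac)
      qed
    qed (intro integrable_everywhere_continuous continuous_intros)+
    also have "\<dots> = A * L2_form M ?p ?p" unfolding L2_form_eq[of ?p ?p] by simp
    also have "\<dots> \<le> A * (16 ^ D * L2_form M (P n) (P n))"
      using n0[of "n - D" D] n \<open>A \<ge> 0\<close> by (intro mult_left_mono) auto
    finally show ?thesis by (simp add: mult_ac)
  qed
  then show ?thesis using \<open>A \<ge> 0\<close>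
    by (intro exI[of _ "A * 16 ^ D"] conjI exI[of _ "n0 + D"]) auto
qed

text \<open>With fewer sign changes of \<open>S\<^sub>n\<close> the polynomial \<open>Q\<close> of \<open>exists_sign_matching_poly\<close> would have
degree below \<open>n\<close>. Then \<open>\<langle>Q, S\<^sub>n\<rangle> = 0\<close>, although its discrete part vanishes and \<open>Q S\<^sub>n\<close> has constant
sign.\<close>

lemma sobolev_zeros_in_interval:
  assumes seq: "sequentially_ordered N c d"
  obtains X where "finite X" "X \<subseteq> {-1<..<1}" "n \<le> card X + N" "\<And>x. x \<in> X \<Longrightarrow> poly (S n) x = 0"
proof -
  define X where "X = {x\<in>{-1<..<1}. odd (order x (S n))}"
  have "n \<le> card X + N"
  proof (rule ccontr)
    assume less: "\<not> n \<le> card X + N"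
    obtain Q where Q: "Q \<noteq> 0" "degree Q \<le> card X + N"
      "\<And>j. j \<in> {1..N} \<Longrightarrow> poly ((pderiv ^^ d j) Q) (c j) = 0"
      and sign: "(\<forall>x\<in>{-1..1}. poly (Q * S n) x \<ge> 0) \<or> (\<forall>x\<in>{-1..1}. poly (Q * S n) x \<le> 0)"
      using exists_sign_matching_poly[OF seq sob.monic_OP_nonzero X_def] by blast
    have "0 = B Q (S n)" using Q(2) less by (simp add: sob.orthogonal_monic_OP)
    also have "\<dots> = (LINT x|M. poly (Q * S n) x)"
      unfolding sobolev_form_eq using Q(3) by (simp add: L2_form_eq)
    finally have zero: "(LINT x|M. poly (Q * S n) x) = 0" ..
    have int: "integrable M (poly (Q * S n))"
      by (intro integrable_everywhere_continuous continuous_intros)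
    have "AE x in M. poly (Q * S n) x = 0"
      using sign
    proof
      assume "\<forall>x\<in>{-1..1}. poly (Q * S n) x \<ge> 0"
      then have "AE x in M. poly (Q * S n) x \<ge> 0" using AE_Icc by (auto elim: eventually_mono)
      from integral_nonneg_eq_0_iff_AE[OF int this] zero show ?thesis by simp
    next
      assume "\<forall>x\<in>{-1..1}. poly (Q * S n) x \<le> 0"
      then have nn: "AE x in M. - poly (Q * S n) x \<ge> 0" using AE_Icc by (auto elim: eventually_mono)
      have "(LINT x|M. - poly (Q * S n) x) = 0" using zero by simp
      with integral_nonneg_eq_0_iff_AE[OF integrable_minus[OF int] nn] show ?thesis by simp
    qed
    then have "Q * S n = 0" by (rule poly_eq_0_if_AE)
    with Q(1) show False by simp
  qed
  moreover have "finite X"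
    by (rule finite_subset[OF _ poly_roots_finite[OF sob.monic_OP_nonzero[of n]]])
      (auto simp: X_def order_root intro: ccontr)
  moreover have "poly (S n) x = 0" if "x \<in> X" for x
    using that by (auto simp: X_def order_root intro: ccontr)
  ultimately show thesis using that[of X] unfolding X_def by blast
qed

end

section \<open>Distance to the segment\<close>

definition seg :: "complex set" where "seg = complex_of_real ` {-1..1}"

definition seg_dist :: "complex \<Rightarrow> real" where "seg_dist z = dist z (closest_point seg z)"

lemma seg_eq: "seg = closed_segment (-1) 1"
proof -
  have "seg = complex_of_real ` closed_segment (-1) 1"
    by (simp add: seg_def closed_segment_eq_real_ivl)
  also have "\<dots> = closed_segment (complex_of_real (-1)) (complex_of_real 1)"
    by (rule closed_segment_linear_image[symmetric]) (rule bounded_linear.linear[OF bounded_linear_of_real])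
  finally show ?thesis by simp
qed

lemma compact_seg: "compact seg" and convex_seg: "convex seg" and seg_nonempty: "seg \<noteq> {}"
  by (simp_all add: seg_eq)

lemma closed_seg: "closed seg"
  using compact_seg by (rule compact_imp_closed)

lemma seg_dist_le: "x \<in> {-1..1} \<Longrightarrow> seg_dist z \<le> cmod (z - complex_of_real x)"
  unfolding seg_dist_def using closest_point_le[OF closed_seg, of "complex_of_real x" z]
  by (auto simp: seg_def dist_norm)

lemma seg_dist_nonneg: "0 \<le> seg_dist z"
  by (simp add: seg_dist_def)

lemma seg_dist_pos: "z \<notin> seg \<Longrightarrow> 0 < seg_dist z"
  unfolding seg_dist_def using closest_point_in_set[OF closed_seg seg_nonempty, of z] by auto

lemma not_in_seg: "z \<notin> seg \<Longrightarrow> x \<in> {-1..1} \<Longrightarrow> z - complex_of_real x \<noteq> 0"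
  by (auto simp: seg_def)

lemma not_in_seg_if_seg_dist_pos: "0 < seg_dist z \<Longrightarrow> z \<notin> seg"
  by (auto simp: seg_dist_def closest_point_self)

lemma seg_dist_far: "cmod z - 1 \<le> seg_dist z"
proof -
  obtain x where x: "x \<in> {-1..1}" "closest_point seg z = complex_of_real x"
    using closest_point_in_set[OF closed_seg seg_nonempty, of z] by (auto simp: seg_def)
  have "cmod z - cmod (complex_of_real x) \<le> cmod (z - complex_of_real x)" by (rule norm_triangle_ineq2)
  with x show ?thesis by (auto simp: seg_dist_def dist_norm)
qed

text \<open>By convexity the segment lies in the half-plane beyond its point nearest to \<open>z\<close>.\<close>

lemma inner_nearest: 
  assumes "x \<in> {-1..1}"
  shows "(z - closest_point seg z) \<bullet> (complex_of_real x - closest_point seg z) \<le> 0"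
  using assms by (intro closest_point_dot convex_seg closed_seg) (simp add: seg_def)

text \<open>The bound below turns pointwise estimates into uniform ones. The set may be unbounded, since
\<open>seg_dist z\<close> grows like \<open>|z|\<close>; this will include neighbourhoods of infinity.\<close>

lemma exists_seg_dist_ratio:
  assumes "closed K" "K \<inter> seg = {}"
  shows "\<exists>\<kappa>>0. \<forall>z\<in>K. cmod z + 1 \<le> \<kappa> * seg_dist z"
proof -
  obtain e where e: "e > 0" "\<forall>x\<in>seg. \<forall>y\<in>K. e \<le> dist x y"
    using separate_compact_closed[OF compact_seg assms(1)] assms(2) by blast
  have "cmod z + 1 \<le> max 3 (3 / e) * seg_dist z" if "z \<in> K" for z
  proof (cases "cmod z \<ge> 2")
    case True
    then have "cmod z + 1 \<le> 3 * seg_dist z" using seg_dist_far[of z] by simp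
    also have "\<dots> \<le> max 3 (3 / e) * seg_dist z" using seg_dist_nonneg by (intro mult_right_mono) auto
    finally show ?thesis .
  next
    case False
    have "e \<le> seg_dist z" using e(2) that closest_point_in_set[OF closed_seg seg_nonempty, of z]
      by (auto simp: seg_dist_def dist_commute)
    then have "3 \<le> 3 / e * seg_dist z" using e(1) by (simp add: field_simps)
    also have "\<dots> \<le> max 3 (3 / e) * seg_dist z" using seg_dist_nonneg by (intro mult_right_mono) auto
    finally show ?thesis using False by simp
  qed
  then show ?thesis by (intro exI[of _ "max 3 (3 / e)"]) auto
qed

section \<open>Cauchy transforms and comparison with orthogonal polynomials\<close>

lemma cpoly_of_real: "cpoly p (complex_of_real x) = complex_of_real (poly p x)"
  by (induction p) (auto simp: map_poly_pCons)

lemma measurable_transform: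
  assumes "f \<in> borel_measurable borel"
  shows "(\<lambda>x. f x / (z - complex_of_real x)) \<in> borel_measurable borel"
  using assms by measurable

lemma measurable_continuous: "continuous_on UNIV f \<Longrightarrow> f \<in> borel_measurable borel"
  by (rule borel_measurable_continuous_onI)

context measure_on_Icc
begin

lemma integrable_transform:
  fixes f :: "real \<Rightarrow> complex"
  assumes "continuous_on UNIV f" "z \<notin> seg"
  shows "integrable M (\<lambda>x. f x / (z - complex_of_real x))"
  using assms not_in_seg[OF assms(2)]
  by (intro integrable_continuous measurable_transform measurable_continuous continuous_intros)
    (auto intro: continuous_on_subset)

lemma norm_transform_le:
  fixes f :: "real \<Rightarrow> complex"
  assumes f: "continuous_on UNIV f" and z: "z \<notin> seg"
  shows "cmod (LINT x|M. f x / (z - complex_of_real x)) \<le> (LINT x|M. cmod (f x)) / seg_dist z"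
proof -
  have "cmod (LINT x|M. f x / (z - complex_of_real x)) \<le> (LINT x|M. cmod (f x / (z - complex_of_real x)))"
    by (rule integral_norm_bound)
  also have "\<dots> \<le> (LINT x|M. cmod (f x) / seg_dist z)"
  proof (rule integral_mono_Icc)
    show "integrable M (\<lambda>x. cmod (f x / (z - complex_of_real x)))"
      by (rule integrable_norm[OF integrable_transform[OF f z]])
    show "integrable M (\<lambda>x. cmod (f x) / seg_dist z)"
      using f by (intro integrable_divide integrable_everywhere_continuous continuous_intros)
    fix x :: real assume "x \<in> {-1..1}"
    then show "cmod (f x / (z - complex_of_real x)) \<le> cmod (f x) / seg_dist z"
      unfolding norm_divide using seg_dist_le[of x z] seg_dist_pos[OF z]
        by (intro divide_left_mono mult_pos_pos) auto
  qed
  finally show ?thesis by simp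
qed

text \<open>For the point \<open>x\<^sub>0\<close> of the segment nearest to \<open>z\<close>, the quotients \<open>(z - x\<^sub>0) / (z - x)\<close> have real parts
bounded below by a positive constant, so there is no cancellation in the integral.\<close>

lemma norm_transform_ge:
  assumes h: "continuous_on UNIV h" "\<And>x. h x \<ge> 0" and z: "z \<notin> seg"
  shows "seg_dist z * (LINT x|M. h x) \<le> (cmod z + 1)\<^sup>2 *
            cmod (LINT x|M. complex_of_real (h x) / (z - complex_of_real x))"
proof -
  define x0 where "x0 = closest_point seg z"
  let ?T = "LINT x|M. complex_of_real (h x) / (z - complex_of_real x)"
  have g: "seg_dist z = cmod (z - x0)" "seg_dist z > 0" using seg_dist_pos[OF z]
    by (simp_all add: seg_dist_def x0_def dist_norm)
  have cont: "continuous_on UNIV (\<lambda>x. complex_of_real (h x))"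
    using h(1) by (intro continuous_intros)
  have int: "integrable M (\<lambda>x. complex_of_real (h x) / (z - complex_of_real x))"
    by (rule integrable_transform[OF cont z])
  have pt: "(seg_dist z)\<^sup>2 / (cmod z + 1)\<^sup>2 * h x \<le> Re ((z - x0) * (complex_of_real (h x) / (z - complex_of_real x)))"
    if x: "x \<in> {-1..1}" for x
  proof -
    define y where "y = z - complex_of_real x"
    have y0: "y \<noteq> 0" using not_in_seg[OF z x] by (simp add: y_def)
    have "cmod y \<le> cmod z + 1"
      using norm_triangle_ineq4[of z "complex_of_real x"] x by (auto simp: y_def)
    then have yl: "(cmod y)\<^sup>2 \<le> (cmod z + 1)\<^sup>2" by (intro power_mono) auto
    have "(z - x0) \<bullet> y = (z - x0) \<bullet> (z - x0) - (z - x0) \<bullet> (complex_of_real x - x0)"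
      by (simp add: y_def inner_diff_right)
    also have "\<dots> \<ge> (seg_dist z)\<^sup>2"
      using inner_nearest[OF x, of z] by (simp add: x0_def[symmetric] g(1) power2_norm_eq_inner)
    finally have ip: "(seg_dist z)\<^sup>2 \<le> (z - x0) \<bullet> y" .
    have "Re ((z - x0) * (complex_of_real (h x) / y)) = h x * ((z - x0) \<bullet> y) / (cmod y)\<^sup>2"
      by (simp add: Re_divide Im_divide inner_complex_def cmod_power2 field_simps complex_eq_iff)
    also have "\<dots> \<ge> h x * (seg_dist z)\<^sup>2 / (cmod z + 1)\<^sup>2"
    proof (rule frac_le)
      show "0 \<le> h x * ((z - x0) \<bullet> y)" 
        using h(2)[of x] ip by (intro mult_nonneg_nonneg) (auto intro: order_trans[OF zero_le_power2])
      show "h x * (seg_dist z)\<^sup>2 \<le> h x * ((z - x0) \<bullet> y)" using ip h(2)[of x]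
        by (rule mult_left_mono)
    qed (use y0 yl in auto)
    finally show ?thesis by (simp add: y_def mult.commute)
  qed
  have "(seg_dist z)\<^sup>2 / (cmod z + 1)\<^sup>2 * (LINT x|M. h x) = (LINT x|M. (seg_dist z)\<^sup>2 / (cmod z + 1)\<^sup>2 * h x)" by simp
  also have "\<dots> \<le> (LINT x|M. Re ((z - x0) * (complex_of_real (h x) / (z - complex_of_real x))))"
  proof (rule integral_mono_Icc[OF _ _ pt])
    show "integrable M (\<lambda>x. (seg_dist z)\<^sup>2 / (cmod z + 1)\<^sup>2 * h x)"
      using h(1) by (intro integrable_mult_right integrable_everywhere_continuous)
    show "integrable M (\<lambda>x. Re ((z - x0) * (complex_of_real (h x) / (z - complex_of_real x))))"
      using int by (intro integrable_Re integrable_mult_right)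
  qed
  also have "\<dots> = Re ((z - x0) * ?T)"
  proof -
    have "integrable M (\<lambda>x. (z - x0) * (complex_of_real (h x) / (z - complex_of_real x)))"
      using int by (intro integrable_mult_right)
    from integral_Re[OF this] show ?thesis by (simp only: integral_mult_right_zero)
  qed
  also have "\<dots> \<le> seg_dist z * cmod ?T"
    unfolding g(1) norm_mult[symmetric] by (rule complex_Re_le_cmod)
  finally have "(seg_dist z)\<^sup>2 * (LINT x|M. h x) \<le> seg_dist z * cmod ?T * (cmod z + 1)\<^sup>2"
    using zero_less_power[of "cmod z + 1" 2] norm_ge_zero[of z]
    by (simp add: pos_divide_le_eq mult_ac)
  then have "seg_dist z * (seg_dist z * (LINT x|M. h x)) \<le> seg_dist z * ((cmod z + 1)\<^sup>2 * cmod ?T)"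
    by (simp add: power2_eq_square mult_ac)
  then show ?thesis using g(2) by simp
qed

lemma orthogonal_complex_poly:
  assumes "degree g < n"
  shows "(LINT x|M. complex_of_real (poly (P n) x) * poly g (complex_of_real x)) = 0"
proof -
  have "(LINT x|M. complex_of_real (poly (P n) x) * poly g (complex_of_real x)) =
    (LINT x|M. (\<Sum>i\<le>degree g. coeff g i * complex_of_real (poly (monom 1 i) x * poly (P n) x)))"
    by (simp only: poly_altdef[of g] sum_distrib_left poly_monom of_real_mult of_real_power
        of_real_1 mult_1 mult_ac)
  also have "\<dots> = (\<Sum>i\<le>degree g. coeff g i * complex_of_real (L2_form M (monom 1 i) (P n)))"
    unfolding L2_form_eq integral_complex_of_real[symmetric]
    by (subst Bochner_Integration.integral_sum)
       (auto intro!: integrable_mult_right integrable_everywhere_continuous continuous_intros)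
  also have "\<dots> = 0"
    using assms by (intro sum.neutral ballI) (simp add: L2.orthogonal_monic_OP degree_monom_eq)
  finally show ?thesis .
qed

text \<open>The difference quotient \<open>(f(z) - f(x)) / (z - x)\<close> is a polynomial in \<open>x\<close> of degree below \<open>n\<close>, hence
orthogonal to \<open>P\<^sub>n\<close>.\<close>

lemma transform_reproducing:
  assumes f: "degree f \<le> n" and z: "z \<notin> seg"
  shows "poly f z * (LINT x|M. complex_of_real (poly (P n) x) / (z - complex_of_real x)) =
         (LINT x|M. complex_of_real (poly (P n) x) * poly f (complex_of_real x) / (z - complex_of_real x))"
proof -
  let ?p = "\<lambda>x. complex_of_real (poly (P n) x)"
  have "[:- z, 1:] dvd f - [:poly f z:]" by (simp add: poly_eq_0_iff_dvd[symmetric])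
  then obtain g where g: "f - [:poly f z:] = [:- z, 1:] * g" by (auto simp: dvd_def)
  have "(LINT x|M. ?p x * poly g (complex_of_real x)) = 0"
  proof (cases "g = 0")
    case False
    have "degree (f - [:poly f z:]) \<le> n" using f by (intro degree_diff_le) auto
    moreover have "degree (f - [:poly f z:]) = Suc (degree g)"
      unfolding g using False by (subst degree_mult_eq) auto
    ultimately show ?thesis by (intro orthogonal_complex_poly) simp
  qed simp
  also have "(LINT x|M. ?p x * poly g (complex_of_real x)) =
    (LINT x|M. poly f z * (?p x / (z - complex_of_real x)) - ?p x * poly f (complex_of_real x) / (z - complex_of_real x))"
  proof (rule integral_cong_AE)
    show "AE x in M. ?p x * poly g (complex_of_real x) =
       poly f z * (?p x / (z - complex_of_real x)) - ?p x * poly f (complex_of_real x) / (z - complex_of_real x)"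
      using AE_Icc
    proof eventually_elim
      case (elim x)
      have "poly (f - [:poly f z:]) (complex_of_real x) = poly ([:- z, 1:] * g) (complex_of_real x)"
        by (simp only: g)
      then have "poly f z - poly f (complex_of_real x) = (z - complex_of_real x) * poly g (complex_of_real x)"
        by (simp add: algebra_simps)
      then have "poly g (complex_of_real x) = (poly f z - poly f (complex_of_real x)) / (z - complex_of_real x)"
        using not_in_seg[OF z elim] by simp
      then show ?case by (simp only: diff_divide_distrib right_diff_distrib times_divide_eq_right mult.commute)
    qed
  next
    show "(\<lambda>x. ?p x * poly g (complex_of_real x)) \<in> borel_measurable M"
      unfolding measurable_cong_sets[OF sets_M refl] by (intro measurable_continuous continuous_intros)
    show "(\<lambda>x. poly f z * (?p x / (z - complex_of_real x)) - ?p x * poly f (complex_of_real x) / (z - complex_of_real x)) \<in> borel_measurable M"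
      unfolding measurable_cong_sets[OF sets_M refl]
      by (intro borel_measurable_diff borel_measurable_times borel_measurable_const measurable_transform measurable_continuous continuous_intros)
  qed
  also have "\<dots> = poly f z * (LINT x|M. ?p x / (z - complex_of_real x)) -
      (LINT x|M. ?p x * poly f (complex_of_real x) / (z - complex_of_real x))"
  proof (subst Bochner_Integration.integral_diff)
    show "integrable M (\<lambda>x. poly f z * (?p x / (z - complex_of_real x)))"
      by (intro integrable_mult_right integrable_transform z continuous_intros)
    show "integrable M (\<lambda>x. ?p x * poly f (complex_of_real x) / (z - complex_of_real x))"
      by (intro integrable_transform z continuous_intros)
  qed (simp only: integral_mult_right_zero)
  finally show ?thesis by simp
qed

text \<open>Use \<open>transform_reproducing\<close> for \<open>f\<close> and for \<open>P\<^sub>n\<close>: dividing the two identities eliminates the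
common integral, and \<open>norm_transform_ge\<close> bounds the transform of \<open>P\<^sub>n\<^sup>2\<close> from below. That
the zeros of \<open>P\<^sub>n\<close> lie in the segment is a corollary.\<close>

lemma poly_comparison:
  assumes f: "degree f \<le> n" and z: "z \<notin> seg"
  shows "(seg_dist z)\<^sup>2 * cmod (poly f z) * L2_form M (P n) (P n) \<le>
     (cmod z + 1)\<^sup>2 * cmod (cpoly (P n) z) *
       (LINT x|M. \<bar>poly (P n) x\<bar> * cmod (poly f (complex_of_real x)))"
proof -
  let ?p = "\<lambda>x. complex_of_real (poly (P n) x)"
  define A where "A = (LINT x|M. ?p x / (z - complex_of_real x))"
  define J where "J = (LINT x|M. \<bar>poly (P n) x\<bar> * cmod (poly f (complex_of_real x)))"
  have g: "seg_dist z > 0" by (rule seg_dist_pos[OF z])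
  have "cpoly (P n) z * A = (LINT x|M. complex_of_real (poly (P n) x * poly (P n) x) / (z - complex_of_real x))"
    unfolding A_def by (subst transform_reproducing[OF _ z]) (simp_all add: cpoly_of_real degree_map_poly)
  then have 1: "seg_dist z * L2_form M (P n) (P n) \<le> (cmod z + 1)\<^sup>2 * (cmod (cpoly (P n) z) * cmod A)"
    unfolding L2_form_eq[of "P n" "P n"] norm_mult[symmetric]
    using norm_transform_ge[of "\<lambda>x. poly (P n) x * poly (P n) x", OF _ _ z]
    by (simp add: continuous_intros)
  have "cmod (poly f z) * cmod A \<le> (LINT x|M. cmod (?p x * poly f (complex_of_real x))) / seg_dist z"
    unfolding norm_mult[symmetric] A_def transform_reproducing[OF f z]
    by (intro norm_transform_le z continuous_intros)
  then have 2: "seg_dist z * (cmod (poly f z) * cmod A) \<le> J"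
    using g by (simp add: J_def norm_mult field_simps)
  have "(seg_dist z)\<^sup>2 * cmod (poly f z) * L2_form M (P n) (P n) =
     seg_dist z * cmod (poly f z) * (seg_dist z * L2_form M (P n) (P n))" by (simp add: power2_eq_square)
  also have "\<dots> \<le> seg_dist z * cmod (poly f z) * ((cmod z + 1)\<^sup>2 * (cmod (cpoly (P n) z) * cmod A))"
    using 1 g by (intro mult_left_mono) auto
  also have "\<dots> = (cmod z + 1)\<^sup>2 * cmod (cpoly (P n) z) * (seg_dist z * (cmod (poly f z) * cmod A))"
    by (simp add: mult_ac)
  also have "\<dots> \<le> (cmod z + 1)\<^sup>2 * cmod (cpoly (P n) z) * J"
    using 2 by (intro mult_left_mono) auto
  finally show ?thesis unfolding J_def .
qed

lemma OP_nonzero_off_seg: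
  assumes "z \<notin> seg" shows "cpoly (P n) z \<noteq> 0"
proof
  assume "cpoly (P n) z = 0"
  with poly_comparison[of "[:1:]" n, OF _ assms]
  have "(seg_dist z)\<^sup>2 * L2_form M (P n) (P n) \<le> 0" by simp
  moreover have "(seg_dist z)\<^sup>2 * L2_form M (P n) (P n) > 0"
    using seg_dist_pos[OF assms] by (intro mult_pos_pos L2.pos) auto
  ultimately show False by simp
qed

lemma poly_bound_by_OP:
  assumes f: "degree f \<le> n" and z: "0 < \<kappa>" "cmod z + 1 \<le> \<kappa> * seg_dist z"
    and C: "(LINT x|M. (cmod (poly f (complex_of_real x)))\<^sup>2) \<le> C * L2_form M (P n) (P n)"
  shows "cmod (poly f z) \<le> \<kappa>\<^sup>2 * ((1 + C) / 2) * cmod (cpoly (P n) z)"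
proof -
  let ?L = "L2_form M (P n) (P n)"
  have L: "?L > 0" by (rule L2.pos) simp
  have "0 < \<kappa> * seg_dist z" using z norm_ge_zero[of z] by linarith
  then have g: "seg_dist z > 0" using z(1) by (simp add: zero_less_mult_iff)
  have zs: "z \<notin> seg" by (rule not_in_seg_if_seg_dist_pos[OF g])
  have "(LINT x|M. \<bar>poly (P n) x\<bar> * cmod (poly f (complex_of_real x))) \<le>
     (LINT x|M. (poly (P n) x * poly (P n) x + (cmod (poly f (complex_of_real x)))\<^sup>2) / 2)"
  proof (rule integral_mono_Icc)
    fix x :: real
    have "0 \<le> (\<bar>poly (P n) x\<bar> - cmod (poly f (complex_of_real x)))\<^sup>2" by simp
    then show "\<bar>poly (P n) x\<bar> * cmod (poly f (complex_of_real x))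
        \<le> (poly (P n) x * poly (P n) x + (cmod (poly f (complex_of_real x)))\<^sup>2) / 2"
      by (simp add: power2_diff power2_abs) (simp add: power2_eq_square)
  qed (intro integrable_everywhere_continuous continuous_intros; simp)+
  also have "\<dots> = (?L + (LINT x|M. (cmod (poly f (complex_of_real x)))\<^sup>2)) / 2"
    unfolding L2_form_eq[of "P n" "P n"]
    by (subst Bochner_Integration.integral_add[symmetric])
      (auto intro!: integrable_everywhere_continuous continuous_intros)
  also have "\<dots> \<le> (1 + C) / 2 * ?L" using C by (simp add: field_simps)
  finally have J: "(LINT x|M. \<bar>poly (P n) x\<bar> * cmod (poly f (complex_of_real x))) \<le> (1 + C) / 2 * ?L" .
  have C0: "0 \<le> (1 + C) / 2 * ?L"
    by (rule order_trans[OF _ J]) (intro integral_nonneg_AE, simp)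
  have "(seg_dist z)\<^sup>2 * cmod (poly f z) * ?L \<le> (cmod z + 1)\<^sup>2 * cmod (cpoly (P n) z) * ((1 + C) / 2 * ?L)"
    by (rule order_trans[OF poly_comparison[OF f zs] mult_left_mono[OF J]]) simp
  also have "\<dots> \<le> (\<kappa> * seg_dist z)\<^sup>2 * cmod (cpoly (P n) z) * ((1 + C) / 2 * ?L)"
    using z(2) C0 by (intro mult_right_mono power_mono) auto
  finally have "((seg_dist z)\<^sup>2 * ?L) * cmod (poly f z) \<le> ((seg_dist z)\<^sup>2 * ?L) * (\<kappa>\<^sup>2 * ((1 + C) / 2) * cmod (cpoly (P n) z))"
    by (simp only: power_mult_distrib mult_ac)
  then show ?thesis using g L by (simp only: mult_le_cancel_left_pos zero_less_power mult_pos_pos)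
qed

end

section \<open>Derivatives of polynomials with all zeros in the interval\<close>

lemma cpoly_mult: "cpoly (p * q) z = cpoly p z * cpoly q z"
proof -
  have "map_poly complex_of_real (p * q) = map_poly complex_of_real p * map_poly complex_of_real q"
    by (rule poly_eqI) (simp add: coeff_map_poly coeff_mult)
  then show ?thesis by simp
qed

lemma cpoly_diff: "cpoly (p - q) z = cpoly p z - cpoly q z"
proof -
  have "map_poly complex_of_real (p - q) = map_poly complex_of_real p - map_poly complex_of_real q"
    by (rule poly_eqI) (simp add: coeff_map_poly)
  then show ?thesis by simp
qed

lemma deriv_cpoly_funpow: "(deriv ^^ m) (cpoly p) = cpoly ((pderiv ^^ m) p)"
proof (induction m)
  case (Suc m)
  have "pderiv (map_poly complex_of_real q) = map_poly complex_of_real (pderiv q)" for q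
    by (rule poly_eqI) (simp add: coeff_map_poly coeff_pderiv)
  moreover have "deriv (cpoly q) = poly (pderiv (map_poly complex_of_real q))" for q
    by (rule ext) (rule DERIV_imp_deriv[OF poly_DERIV])
  ultimately show ?case using Suc by simp
qed simp

lemma holomorphic_cpoly: "cpoly p holomorphic_on A"
  by (intro holomorphic_onI) (auto simp: field_differentiable_def intro: has_field_derivative_at_within[OF poly_DERIV])

lemma real_rooted_factorization:
  fixes p :: "real poly"
  assumes "lead_coeff p = 1" "\<And>z. cpoly p z = 0 \<Longrightarrow> z \<in> seg"
  shows "\<exists>xs. set xs \<subseteq> {-1..1} \<and> length xs = degree p \<and> p = (\<Prod>x\<leftarrow>xs. [:- x, 1:])"
  using assms
proof (induction "degree p" arbitrary: p)
  case 0
  then have "p = 1" by (metis degree_eq_zeroE lead_coeff_pCons(2) one_pCons pCons_0_0 lead_coeff_pCons(1))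
  then show ?case by (intro exI[of _ "[]"]) simp
next
  case (Suc n)
  have "\<not> constant (poly (map_poly complex_of_real p))"
    using Suc.hyps(2) constant_degree[of "map_poly complex_of_real p"] by (simp add: degree_map_poly)
  then obtain z where z: "cpoly p z = 0" using fundamental_theorem_of_algebra by blast
  obtain a where a: "a \<in> {-1..1}" "z = complex_of_real a"
    using Suc.prems(2)[OF z] by (auto simp: seg_def)
  then have "poly p a = 0" using z by (simp add: cpoly_of_real)
  then obtain q where q: "p = [:- a, 1:] * q" by (auto simp: poly_eq_0_iff_dvd dvd_def)
  have q0: "q \<noteq> 0" using q Suc.prems(1) by auto
  have "degree p = 1 + degree q" unfolding q using q0 by (subst degree_mult_eq) auto
  then have dq: "n = degree q" using Suc.hyps(2) by simp
  moreover have "lead_coeff q = 1"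
    using Suc.prems(1) lead_coeff_mult[of "[:- a, 1:]" q] unfolding q[symmetric] by simp
  moreover have "z \<in> seg" if "cpoly q z = 0" for z
    using that by (intro Suc.prems(2)) (simp only: q cpoly_mult mult_zero_right)
  ultimately obtain xs where "set xs \<subseteq> {-1..1}" "length xs = degree q" "q = (\<Prod>x\<leftarrow>xs. [:- x, 1:])"
    using Suc.hyps(1)[of q] by blast
  then show ?case using a q dq Suc.hyps(2) by (intro exI[of _ "a # xs"]) auto
qed

lemma pderiv_funpow_linear_mult:
  fixes p :: "real poly"
  shows "(pderiv ^^ m) ([:- a, 1:] * p) =
           [:- a, 1:] * (pderiv ^^ m) p + smult (of_nat m) ((pderiv ^^ (m - 1)) p)"
proof (induction m)
  case (Suc m)
  have "(pderiv ^^ Suc m) ([:- a, 1:] * p) = pderiv ((pderiv ^^ m) ([:- a, 1:] * p))" by simp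
  also have "\<dots> = [:- a, 1:] * (pderiv ^^ Suc m) p + (pderiv ^^ m) p +
      smult (of_nat m) (pderiv ((pderiv ^^ (m - 1)) p))"
  proof -
    have "pderiv [:- a, 1:] = 1" by (simp add: pderiv_pCons)
    then show ?thesis
      unfolding Suc by (simp only: pderiv_add pderiv_mult pderiv_smult mult_1_right funpow.simps comp_apply)
  qed
  also have "smult (of_nat m) (pderiv ((pderiv ^^ (m - 1)) p)) = smult (of_nat m) ((pderiv ^^ m) p)"
    by (cases m) auto
  also have "[:- a, 1:] * (pderiv ^^ Suc m) p + (pderiv ^^ m) p + smult (of_nat m) ((pderiv ^^ m) p) =
     [:- a, 1:] * (pderiv ^^ Suc m) p + smult (of_nat (Suc m)) ((pderiv ^^ m) p)"
    by (simp add: smult_add_left)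
  finally show ?case by simp
qed simp

text \<open>The quotient of two successive derivatives at \<open>c\<close> is a sum of \<open>n - m\<close> terms \<open>1 / (c - y)\<close> with \<open>y\<close>
in \<open>[-1,1]\<close>, all of the same sign and of modulus at least \<open>1 / (|c| + 1)\<close>. The induction adds the
zeros one by one and so avoids the zeros of the derivatives; the powers of the sign \<open>s\<close> of \<open>c\<close> make
all quantities nonnegative.\<close>

lemma signed_derivative_growth:
  fixes c s :: real and xs :: "real list"
  assumes s: "s * s = 1" "s * c = \<bar>c\<bar>" and c: "1 < \<bar>c\<bar>" and xs: "set xs \<subseteq> {-1..1}"
  defines "p \<equiv> \<Prod>x\<leftarrow>xs. [:- x, 1:]"
  defines "u \<equiv> \<lambda>m. s ^ (length xs + m) * poly ((pderiv ^^ m) p) c"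
  shows "0 \<le> u m \<and> (real (length xs) - real m) * u m \<le> (\<bar>c\<bar> + 1) * u (Suc m)"
  using xs unfolding p_def u_def
proof (induction xs arbitrary: m)
  case Nil
  have "(pderiv ^^ Suc k) (1 :: real poly) = 0" for k by (rule pderiv_funpow_eq_0) simp
  then show ?case by (cases m) (auto simp del: funpow.simps)
next
  case (Cons a xs)
  define p where "p = (\<Prod>x\<leftarrow>xs. [:- x, 1:])"
  define u where "u m = s ^ (length xs + m) * poly ((pderiv ^^ m) p) c" for m
  define v where "v m = s ^ (length (a # xs) + m) * poly ((pderiv ^^ m) ([:- a, 1:] * p)) c" for m
  define n where "n = real (length xs)"
  define y where "y = s * (c - a)"
  have IH: "0 \<le> u m" "(n - real m) * u m \<le> (\<bar>c\<bar> + 1) * u (Suc m)" for m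
    using Cons unfolding u_def p_def n_def by auto
  have abs_s: "\<bar>s\<bar> = 1" using s(1)
    by (metis abs_mult abs_mult_self_eq abs_one mult.right_neutral power2_eq_square abs_square_eq_1)
  have "\<bar>s * a\<bar> \<le> 1" using Cons.prems abs_s by (auto simp: abs_mult)
  then have y: "0 \<le> y" "y \<le> \<bar>c\<bar> + 1" using s(2) c by (auto simp: y_def right_diff_distrib)
  have v: "v m = y * u m + real m * u (m - 1)" for m
  proof -
    have 1: "s ^ (Suc (length xs) + m) = s * s ^ (length xs + m)" by simp
    have 2: "real m * s ^ (Suc (length xs) + m) = real m * s ^ (length xs + (m - 1))"
    proof (cases m)
      case (Suc k)
      have "s ^ (Suc (length xs) + m) = (s * s) * s ^ (length xs + k)" by (simp add: Suc)
      then show ?thesis by (simp add: s(1) Suc)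
    qed simp
    have "v m = s ^ (Suc (length xs) + m) * ((c - a) * poly ((pderiv ^^ m) p) c)
       + (real m * s ^ (Suc (length xs) + m)) * poly ((pderiv ^^ (m - 1)) p) c"
      unfolding v_def pderiv_funpow_linear_mult by (simp add: algebra_simps)
    then show ?thesis unfolding 2 unfolding 1 y_def u_def by (simp add: algebra_simps)
  qed
  have v0: "0 \<le> v m" unfolding v using IH(1) y(1) by simp
  have "(n + 1 - real m) * v m \<le> (\<bar>c\<bar> + 1) * v (Suc m)"
  proof -
    have a: "(n - real m) * u m * y \<le> (\<bar>c\<bar> + 1) * u (Suc m) * y"
      using IH(2) y(1) by (rule mult_right_mono)
    have b: "y * u m \<le> (\<bar>c\<bar> + 1) * u m" using y(2) IH(1) by (rule mult_right_mono)
    have c: "real m * ((n + 1 - real m) * u (m - 1)) \<le> real m * ((\<bar>c\<bar> + 1) * u m)"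
    proof (cases m)
      case (Suc k)
      have "(n - real k) * u k \<le> (\<bar>c\<bar> + 1) * u m" using IH(2)[of k] by (simp add: Suc)
      then have "(n + 1 - real m) * u (m - 1) \<le> (\<bar>c\<bar> + 1) * u m" by (simp add: Suc)
      then show ?thesis by (intro mult_left_mono) auto
    qed simp
    have "(n + 1 - real m) * v m = (n - real m) * u m * y + y * u m + real m * ((n + 1 - real m) * u (m - 1))"
      unfolding v by (simp add: algebra_simps)
    also have "\<dots> \<le> (\<bar>c\<bar> + 1) * u (Suc m) * y + (\<bar>c\<bar> + 1) * u m + real m * ((\<bar>c\<bar> + 1) * u m)"
      using a b c by linarith
    also have "\<dots> = (\<bar>c\<bar> + 1) * v (Suc m)" unfolding v by (simp add: algebra_simps)
    finally show ?thesis .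
  qed
  with v0 show ?case unfolding v_def p_def n_def by (simp add: algebra_simps)
qed

lemma derivative_growth:
  fixes p :: "real poly"
  assumes "lead_coeff p = 1" "\<And>z. cpoly p z = 0 \<Longrightarrow> z \<in> seg" "1 < \<bar>c\<bar>"
  shows "(real (degree p) - real m) * \<bar>poly ((pderiv ^^ m) p) c\<bar> \<le>
           (\<bar>c\<bar> + 1) * \<bar>poly ((pderiv ^^ Suc m) p) c\<bar>"
proof -
  obtain xs where xs: "set xs \<subseteq> {-1..1}" "length xs = degree p" "p = (\<Prod>x\<leftarrow>xs. [:- x, 1:])"
    using real_rooted_factorization[OF assms(1,2)] by blast
  define s where "s = sgn c"
  have s: "s * s = 1" "s * c = \<bar>c\<bar>" using assms(3) by (auto simp: s_def sgn_if)
  define u where "u m = s ^ (length xs + m) * poly ((pderiv ^^ m) p) c" for m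
  have g: "0 \<le> u m" "(real (length xs) - real m) * u m \<le> (\<bar>c\<bar> + 1) * u (Suc m)" for m
    using signed_derivative_growth[OF s assms(3) xs(1), of m] unfolding u_def xs(3) by auto
  have "\<bar>s\<bar> = 1" using assms(3) by (auto simp: s_def sgn_if)
  then have "\<bar>poly ((pderiv ^^ m) p) c\<bar> = \<bar>u m\<bar>" for m
    by (simp add: u_def abs_mult power_abs)
  then have "\<bar>poly ((pderiv ^^ m) p) c\<bar> = u m" for m using g(1)[of m] by simp
  then show ?thesis using g(2)[of m] by (simp only: xs(2))
qed

lemma derivative_dominates:
  fixes p :: "real poly"
  assumes p: "lead_coeff p = 1" "\<And>z. cpoly p z = 0 \<Longrightarrow> z \<in> seg" and c: "1 < \<bar>c\<bar>"
    and L: "1 \<le> L" "real m + L * (\<bar>c\<bar> + 1) \<le> real (degree p)" and i: "i < m"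
  shows "L * \<bar>poly ((pderiv ^^ i) p) c\<bar> \<le> \<bar>poly ((pderiv ^^ m) p) c\<bar>"
proof -
  define q where "q i = \<bar>poly ((pderiv ^^ i) p) c\<bar>" for i
  have step: "L * q k \<le> q (Suc k)" if "k < m" for k
  proof -
    have "L * (\<bar>c\<bar> + 1) \<le> real (degree p) - real k" using L(2) that by linarith
    then have "L * (\<bar>c\<bar> + 1) * q k \<le> (real (degree p) - real k) * q k"
      by (intro mult_right_mono) (auto simp: q_def)
    also have "\<dots> \<le> (\<bar>c\<bar> + 1) * q (Suc k)" unfolding q_def
      by (rule derivative_growth[OF p c])
    finally have "(\<bar>c\<bar> + 1) * (L * q k) \<le> (\<bar>c\<bar> + 1) * q (Suc k)"
      by (simp only: mult_ac)
    then show ?thesis using c by (simp only: mult_le_cancel_left_pos)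
  qed
  have "L * q i \<le> q (i + Suc k)" if "i + Suc k \<le> m" for k
    using that
  proof (induction k)
    case 0
    then show ?case using step[of i] by simp
  next
    case (Suc k)
    have "L * q i \<le> q (i + Suc k)" using Suc by simp
    also have "\<dots> \<le> L * q (i + Suc k)" using L(1) by (simp add: q_def mult_le_cancel_right1)
    also have "\<dots> \<le> q (Suc (i + Suc k))" using Suc.prems by (intro step) simp
    finally show ?case by simp
  qed
  from this[of "m - Suc i"] i show ?thesis by (simp add: q_def)
qed

section \<open>Geometric growth of orthogonal polynomials\<close>

context measure_on_Icc
begin

text \<open>Some disc contains the segment but not \<open>z\<close>. If \<open>w\<close> is its centre and \<open>R\<close> its radius, then
\<open>((x - w) / R)\<^sup>n\<close> is bounded by 1 on the segment and geometrically large at \<open>z\<close>, and \<open>P\<^sub>n\<close> inherits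
this by comparison. The centre lies on the ray from \<open>z\<close> through its nearest point \<open>x\<^sub>0\<close>, at distance
\<open>t\<close> beyond \<open>x\<^sub>0\<close>; for \<open>t = 2 \<kappa>\<close> one radius serves all \<open>z\<close> in question, as \<open>seg_dist z\<close> is at least \<open>1 / \<kappa>\<close>.\<close>

lemma OP_growth:
  assumes \<kappa>: "\<kappa> > 0"
  shows "\<exists>\<theta>>1. \<exists>C>0. \<forall>n z. cmod z + 1 \<le> \<kappa> * seg_dist z \<longrightarrow>
    L2_form M (P n) (P n) * \<theta> ^ n \<le> C * (cmod (cpoly (P n) z))\<^sup>2"
proof -
  define t where "t = 2 * \<kappa>"
  \<comment> \<open>Points of the segment are within 2 of \<open>x\<^sub>0\<close>, whence the 4.\<close>
  define R where "R = sqrt (4 + t\<^sup>2)"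
  define \<theta> where "\<theta> = (1 / \<kappa> + t) / R"
  define m where "m = measure M (space M) + 1"
  have t: "t > 0" using \<kappa> by (simp add: t_def)
  have R: "R > 0" "R\<^sup>2 = 4 + t\<^sup>2" unfolding R_def by (simp_all add: add_pos_nonneg)
  have m: "m > 0" unfolding m_def by (simp add: add_nonneg_pos)
  have "(1 / \<kappa> + t)\<^sup>2 = (1 / \<kappa>)\<^sup>2 + t\<^sup>2 + 4"
    using \<kappa> unfolding power2_sum by (simp add: t_def)
  moreover have "(1 / \<kappa>)\<^sup>2 > 0" using \<kappa> by simp
  ultimately have "R\<^sup>2 < (1 / \<kappa> + t)\<^sup>2" unfolding R(2) by linarith
  moreover have "0 \<le> 1 / \<kappa> + t" using \<kappa> t by (simp add: less_imp_le)
  ultimately have "R < 1 / \<kappa> + t" by (rule power2_less_imp_less)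
  then have \<theta>: "\<theta> > 1" using R(1) by (simp add: \<theta>_def)
  have "L2_form M (P n) (P n) * (\<theta>\<^sup>2) ^ n \<le> (\<kappa> ^ 4 * m) * (cmod (cpoly (P n) z))\<^sup>2"
    if z: "cmod z + 1 \<le> \<kappa> * seg_dist z" for n z
  proof -
    let ?L = "L2_form M (P n) (P n)"
    have L: "?L > 0" by (rule L2.pos) simp
    have "1 \<le> \<kappa> * seg_dist z" using z norm_ge_zero[of z] by linarith
    then have gk: "1 / \<kappa> \<le> seg_dist z" using \<kappa> by (simp add: field_simps)
    then have g: "seg_dist z > 0" using \<kappa> by (meson divide_pos_pos less_le_trans zero_less_one)
    define x0 where "x0 = closest_point seg z"
    define r where "r = t / seg_dist z"
    define w where "w = x0 - complex_of_real r * (z - x0)"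
    define s where "s = sqrt (?L / m)"
    define f where "f = smult (complex_of_real (s / R ^ n)) ([:- w, 1:] ^ n)"
    have gz: "seg_dist z = cmod (z - x0)" by (simp add: seg_dist_def x0_def dist_norm)
    have r: "r \<ge> 0" "r * seg_dist z = t" using t g by (simp_all add: r_def)
    have s: "s \<ge> 0" "s\<^sup>2 = ?L / m" using L m by (simp_all add: s_def)
    have expand: "(cmod (a + r *\<^sub>R b))\<^sup>2 = (cmod a)\<^sup>2 + 2 * r * (b \<bullet> a) + (r * cmod b)\<^sup>2" for a b
    proof -
      have "(r * cmod b)\<^sup>2 = r * (r * (b \<bullet> b))"
        unfolding power_mult_distrib power2_norm_eq_inner by (simp add: power2_eq_square)
      then show ?thesis unfolding power2_norm_eq_inner
        by (simp add: inner_add_left inner_add_right inner_commute[of a b] distrib_left)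
    qed
    have near: "cmod (complex_of_real x - w) \<le> R" if x: "x \<in> {-1..1}" for x
    proof -
      let ?u = "complex_of_real x - x0" and ?v = "z - x0"
      have "x0 \<in> seg" unfolding x0_def by (rule closest_point_in_set[OF closed_seg seg_nonempty])
      then have "cmod ?u \<le> 2" using x by (auto simp: seg_def simp flip: of_real_diff)
      then have "(cmod ?u)\<^sup>2 \<le> 2\<^sup>2" by (intro power_mono) auto
      then have u2: "(cmod ?u)\<^sup>2 \<le> 4" by simp
      have "?v \<bullet> ?u \<le> 0" unfolding x0_def by (rule inner_nearest[OF x])
      then have neg: "2 * r * (?v \<bullet> ?u) \<le> 0" using r by (simp add: mult_nonneg_nonpos)
      have "(cmod (?u + r *\<^sub>R ?v))\<^sup>2 = (cmod ?u)\<^sup>2 + 2 * r * (?v \<bullet> ?u) + (r * seg_dist z)\<^sup>2"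
        unfolding gz by (rule expand)
      also have "\<dots> \<le> 4 + t\<^sup>2" unfolding r(2) using neg u2 by linarith
      also have "?u + r *\<^sub>R ?v = complex_of_real x - w"
        by (simp add: w_def scaleR_conv_of_real)
      finally have "(cmod (complex_of_real x - w))\<^sup>2 \<le> R\<^sup>2" unfolding R(2) .
      then show ?thesis using R(1) by (rule power2_le_imp_le[OF _ less_imp_le])
    qed
    have int: "(LINT x|M. (cmod (poly f (complex_of_real x)))\<^sup>2) \<le> 1 * ?L"
    proof -
      have "(LINT x|M. (cmod (poly f (complex_of_real x)))\<^sup>2) \<le> (LINT x|M. s\<^sup>2)"
      proof (rule integral_mono_Icc)
        show "(cmod (poly f (complex_of_real x)))\<^sup>2 \<le> s\<^sup>2" if x: "x \<in> {-1..1}" for x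
        proof -
          have "cmod (poly f (complex_of_real x)) = s / R ^ n * cmod (complex_of_real x - w) ^ n"
            using s R by (simp add: f_def norm_mult norm_power norm_divide)
          also have "\<dots> \<le> s / R ^ n * R ^ n" using s R near[OF x]
            by (intro mult_left_mono power_mono) auto
          also have "\<dots> = s" using R by simp
          finally show ?thesis by (intro power_mono) auto
        qed
      qed (auto intro!: integrable_everywhere_continuous continuous_intros)
      also have "\<dots> = ?L / m * (m - 1)" unfolding s(2) by (simp add: m_def)
      also have "\<dots> \<le> ?L" using L m by (simp add: field_simps)
      finally show ?thesis by simp
    qed
    have "degree f \<le> n"
      unfolding f_def by (rule order_trans[OF degree_smult_le]) (simp add: degree_power_eq)
    from poly_bound_by_OP[OF this \<kappa> z int]
    have up: "cmod (poly f z) \<le> \<kappa>\<^sup>2 * cmod (cpoly (P n) z)" by simp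
    have "z - w = complex_of_real (1 + r) * (z - x0)" by (simp add: w_def algebra_simps)
    then have "cmod (z - w) = (1 + r) * seg_dist z" unfolding gz using r(1)
      by (simp only: norm_mult norm_of_real)
    then have zw: "cmod (z - w) = seg_dist z + t" using r(2) by (simp add: algebra_simps)
    have "s * \<theta> ^ n = s / R ^ n * (1 / \<kappa> + t) ^ n" by (simp add: \<theta>_def power_divide)
    also have "\<dots> \<le> s / R ^ n * cmod (z - w) ^ n"
      unfolding zw using s R gk \<kappa> t by (intro mult_left_mono power_mono) auto
    also have "\<dots> = cmod (poly f z)" using s R by (simp add: f_def norm_mult norm_power norm_divide)
    finally have "s * \<theta> ^ n \<le> \<kappa>\<^sup>2 * cmod (cpoly (P n) z)" using up by simp
    then have "(s * \<theta> ^ n)\<^sup>2 \<le> (\<kappa>\<^sup>2 * cmod (cpoly (P n) z))\<^sup>2" using s \<theta>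
      by (intro power_mono) auto
    then have "?L / m * (\<theta>\<^sup>2) ^ n \<le> \<kappa> ^ 4 * (cmod (cpoly (P n) z))\<^sup>2"
      by (simp add: power_mult_distrib s(2) flip: power_mult) (simp add: mult.commute)
    then show ?thesis using m by (simp add: field_simps)
  qed
  moreover have "\<theta>\<^sup>2 > 1" using \<theta> by simp
  moreover have "\<kappa> ^ 4 * m > 0" using \<kappa> m by simp
  ultimately show ?thesis by blast
qed

end

section \<open>Zeros of normal families\<close>

text \<open>Otherwise there are functions of the family with values tending to 0 at points \<open>\<zeta>\<^sub>m\<close> and no zeros
near \<open>\<zeta>\<^sub>m\<close>. By Montel's theorem a subsequence converges to a function \<open>g\<close> that vanishes at a limit
point \<open>l\<close> of the \<open>\<zeta>\<^sub>m\<close>, and by Hurwitz's theorem \<open>g\<close> is constant near \<open>l\<close>, hence zero everywhere.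
The lower bound at \<open>z0\<close> excludes this.\<close>

lemma zero_near_small_value:
  fixes G :: "nat \<Rightarrow> complex \<Rightarrow> complex"
  assumes \<Omega>: "open \<Omega>" "connected \<Omega>" and hol: "\<And>n. G n holomorphic_on \<Omega>"
    and bdd: "\<And>K. compact K \<Longrightarrow> K \<subseteq> \<Omega> \<Longrightarrow> \<exists>B. \<forall>n. \<forall>z\<in>K. cmod (G n z) \<le> B"
    and z0: "z0 \<in> \<Omega>" "\<And>n. a \<le> cmod (G n z0)" "a > 0"
    and K: "compact K" "K \<subseteq> \<Omega>" and \<epsilon>: "\<epsilon> > 0"
  shows "\<exists>\<delta>>0. \<forall>n. \<forall>z\<in>K. cmod (G n z) < \<delta> \<longrightarrow> (\<exists>w\<in>\<Omega>. dist z w < \<epsilon> \<and> G n w = 0)"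
proof (rule ccontr)
  assume neg: "\<not> ?thesis"
  have "\<exists>n z. z \<in> K \<and> cmod (G n z) < 1 / real (Suc m) \<and> (\<forall>w\<in>\<Omega>. dist z w < \<epsilon> \<longrightarrow> G n w \<noteq> 0)" for m
    using neg[unfolded not_ex, rule_format, of "1 / real (Suc m)"] by force
  then obtain \<nu> \<zeta> where \<zeta>: "\<And>m. \<zeta> m \<in> K" "\<And>m. cmod (G (\<nu> m) (\<zeta> m)) < 1 / real (Suc m)"
    "\<And>m w. w \<in> \<Omega> \<Longrightarrow> dist (\<zeta> m) w < \<epsilon> \<Longrightarrow> G (\<nu> m) w \<noteq> 0"
    by metis
  define F where "F m = G (\<nu> m)" for m
  have fam: "h holomorphic_on \<Omega>" if "h \<in> range G" for h using that hol by auto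
  have fam_bdd: "\<exists>B. \<forall>h\<in>range G. \<forall>z\<in>A. cmod (h z) \<le> B"
    if "compact A" "A \<subseteq> \<Omega>" for A
    using bdd[OF that] by auto
  have sub: "range F \<subseteq> range G" unfolding F_def by blast
  have "\<exists>g r. g holomorphic_on \<Omega> \<and> strict_mono (r :: nat \<Rightarrow> nat) \<and>
      (\<forall>x\<in>\<Omega>. (\<lambda>n. F (r n) x) \<longlonglongrightarrow> g x) \<and>
      (\<forall>A. compact A \<and> A \<subseteq> \<Omega> \<longrightarrow> uniform_limit A (F \<circ> r) g sequentially)" (is ?limit)
  proof (rule Montel[OF \<Omega>(1) fam fam_bdd sub])
    fix g and r :: "nat \<Rightarrow> nat"
    assume "g holomorphic_on \<Omega>" "strict_mono r"
      "\<And>x. x \<in> \<Omega> \<Longrightarrow> (\<lambda>n. F (r n) x) \<longlonglongrightarrow> g x"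
      "\<And>A. compact A \<Longrightarrow> A \<subseteq> \<Omega> \<Longrightarrow> uniform_limit A (F \<circ> r) g sequentially"
    then show ?limit by (intro exI[of _ g] exI[of _ r]) simp
  qed
  then obtain g r where g: "g holomorphic_on \<Omega>" and r: "strict_mono (r :: nat \<Rightarrow> nat)"
    and pw: "\<And>x. x \<in> \<Omega> \<Longrightarrow> (\<lambda>n. F (r n) x) \<longlonglongrightarrow> g x"
    and unif: "\<And>A. compact A \<Longrightarrow> A \<subseteq> \<Omega> \<Longrightarrow> uniform_limit A (F \<circ> r) g sequentially"
    by blast
  obtain l q where l: "l \<in> K" and q: "strict_mono (q :: nat \<Rightarrow> nat)" and lim: "(\<zeta> \<circ> r \<circ> q) \<longlonglongrightarrow> l"
  proof -
    have "\<forall>n. (\<zeta> \<circ> r) n \<in> K" using \<zeta>(1) by simp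
    then show ?thesis using K(1) that unfolding compact_def by blast
  qed
  define s where "s = r \<circ> q"
  have s: "strict_mono s" unfolding s_def by (rule strict_mono_o[OF r q])
  have limz: "(\<lambda>m. \<zeta> (s m)) \<longlonglongrightarrow> l" using lim by (simp add: s_def comp_def)
  have unifs: "uniform_limit A (\<lambda>m. F (s m)) g sequentially"
    if "compact A" "A \<subseteq> \<Omega>" for A
  proof -
    have "filterlim q sequentially sequentially" by (rule filterlim_subseq[OF q])
    from filterlim_compose[OF unif[OF that, unfolded comp_def] this] show ?thesis
      by (simp add: s_def comp_def)
  qed
  have "l \<in> \<Omega>" using l K by auto
  have gl: "g l = 0"
  proof -
    have "continuous_on \<Omega> g" using g by (rule holomorphic_on_imp_continuous_on)
    then have "(\<lambda>m. g (\<zeta> (s m))) \<longlonglongrightarrow> g l"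
      by (rule continuous_on_tendsto_compose[OF _ limz \<open>l \<in> \<Omega>\<close>]) (use \<zeta>(1) K(2) in \<open>blast intro: always_eventually\<close>)
    moreover have "(\<lambda>m. g (\<zeta> (s m))) \<longlonglongrightarrow> 0"
    proof -
      have 1: "(\<lambda>m. F (s m) (\<zeta> (s m))) \<longlonglongrightarrow> 0"
      proof (rule Lim_null_comparison)
        show "\<forall>\<^sub>F m in sequentially. cmod (F (s m) (\<zeta> (s m))) \<le> 1 / real (Suc m)"
        proof (intro always_eventually allI)
          fix m
          have "1 / real (Suc (s m)) \<le> 1 / real (Suc m)"
            using strict_mono_imp_increasing[OF s, of m] by (simp add: frac_le)
          then show "cmod (F (s m) (\<zeta> (s m))) \<le> 1 / real (Suc m)"
            using \<zeta>(2)[of "s m"] unfolding F_def by linarith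
        qed
        show "(\<lambda>m. 1 / real (Suc m)) \<longlonglongrightarrow> 0" using LIMSEQ_inverse_real_of_nat
          by (simp add: inverse_eq_divide)
      qed
      have 2: "(\<lambda>m. g (\<zeta> (s m)) - F (s m) (\<zeta> (s m))) \<longlonglongrightarrow> 0"
      proof (rule LIMSEQ_I)
        fix e :: real assume "e > 0"
        then have "\<forall>\<^sub>F m in sequentially. \<forall>x\<in>K. dist (F (s m) x) (g x) < e"
          using unifs[OF K] unfolding uniform_limit_iff by blast
        then obtain m0 where "\<And>m x. m \<ge> m0 \<Longrightarrow> x \<in> K \<Longrightarrow> dist (F (s m) x) (g x) < e"
          by (auto simp: eventually_sequentially)
        then show "\<exists>m0. \<forall>m\<ge>m0. cmod (g (\<zeta> (s m)) - F (s m) (\<zeta> (s m)) - 0) < e"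
          using \<zeta>(1) by (intro exI[of _ m0]) (auto simp: dist_norm norm_minus_commute)
      qed
      from tendsto_add[OF 1 2] show ?thesis by simp
    qed
    ultimately show ?thesis by (rule LIMSEQ_unique)
  qed
  obtain e where e: "e > 0" "e \<le> \<epsilon> / 2" "ball l e \<subseteq> \<Omega>"
  proof -
    obtain e where "e > 0" "ball l e \<subseteq> \<Omega>" using \<Omega>(1) \<open>l \<in> \<Omega>\<close>
      by (meson openE)
    then show ?thesis using \<epsilon> by (intro that[of "min e (\<epsilon> / 2)"]) auto
  qed
  have "\<forall>\<^sub>F m in sequentially. dist (\<zeta> (s m)) l < \<epsilon> / 2"
    using limz \<epsilon> by (intro tendstoD) auto
  then obtain m0 where m0: "\<And>m. m \<ge> m0 \<Longrightarrow> dist (\<zeta> (s m)) l < \<epsilon> / 2"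
    by (auto simp: eventually_sequentially)
  have "g l \<noteq> 0"
  proof (rule Hurwitz_no_zeros[of "ball l e" "\<lambda>m. F (s (m + m0))" g])
    show "F (s (n + m0)) holomorphic_on ball l e" for n
      using hol e(3) unfolding F_def by (rule holomorphic_on_subset)
    show "g holomorphic_on ball l e" using g e(3) by (rule holomorphic_on_subset)
    show "uniform_limit A (\<lambda>n. F (s (n + m0))) g sequentially"
      if "compact A" "A \<subseteq> ball l e" for A
      using filterlim_compose[OF unifs[of A] filterlim_add_const_nat_at_top[of m0]] that e(3) by auto
    show "\<not> g constant_on ball l e"
    proof
      assume "g constant_on ball l e"
      then obtain k where k: "\<forall>z\<in>ball l e. g z = k" unfolding constant_on_def by blast
      then have "k = 0" using gl e(1) by (metis centre_in_ball)
      with k have g0: "g z = 0" if "z \<in> ball l e" for z using that by simp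
      have "g z0 = 0"
        by (rule analytic_continuation_open[OF open_ball \<Omega>(1) _ \<Omega>(2) e(3) g holomorphic_on_const _ z0(1)])
           (use e(1) g0 in auto)
      moreover have "a \<le> cmod (g z0)"
        by (rule Lim_norm_lbound[OF _ pw[OF z0(1)]]) (auto simp: F_def z0)
      ultimately show False using z0 by simp
    qed
    show "F (s (n + m0)) z \<noteq> 0" if z: "z \<in> ball l e" for n z
      unfolding F_def
    proof (rule \<zeta>(3))
      show "z \<in> \<Omega>" using z e(3) by auto
      have "dist (\<zeta> (s (n + m0))) z \<le> dist (\<zeta> (s (n + m0))) l + dist l z"
        by (rule dist_triangle)
      also have "\<dots> < \<epsilon>" using m0[of "n + m0"] z e(2) by simp
      finally show "dist (\<zeta> (s (n + m0))) z < \<epsilon>" .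
    qed
    show "l \<in> ball l e" using e(1) by simp
  qed auto
  with gl show False by simp
qed

section \<open>The quotients of Sobolev and standard orthogonal polynomials\<close>

context sobolev
begin

definition SP_ratio :: "nat \<Rightarrow> complex \<Rightarrow> complex" where
  "SP_ratio n z = cpoly (S n) z / cpoly (P n) z"

lemma sobolev_eq_ratio_mult: "z \<notin> seg \<Longrightarrow> cpoly (S n) z = SP_ratio n z * cpoly (P n) z"
  using OP_nonzero_off_seg[of z n] by (simp add: SP_ratio_def)

lemma SP_ratio_holomorphic: "SP_ratio n holomorphic_on - seg"
  unfolding SP_ratio_def using OP_nonzero_off_seg
  by (intro holomorphic_on_divide holomorphic_cpoly) auto

lemma SP_ratio_bound:
  assumes C: "B (S n) (S n) \<le> C * L2_form M (P n) (P n)" and z: "0 < \<kappa>" "cmod z + 1 \<le> \<kappa> * seg_dist z"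
  shows "cmod (SP_ratio n z) \<le> \<kappa>\<^sup>2 * ((1 + C) / 2)"
proof -
  have "0 < \<kappa> * seg_dist z" using z norm_ge_zero[of z] by linarith
  then have zs: "z \<notin> seg" using z(1)
    by (intro not_in_seg_if_seg_dist_pos) (simp add: zero_less_mult_iff)
  have "(LINT x|M. (cmod (cpoly (S n) (complex_of_real x)))\<^sup>2) = L2_form M (S n) (S n)"
    unfolding L2_form_eq[of "S n" "S n"] by (simp add: cpoly_of_real power2_eq_square)
  also have "\<dots> \<le> C * L2_form M (P n) (P n)" using sobolev_mass_le(1)[of "S n"] C by linarith
  finally have "cmod (cpoly (S n) z) \<le> \<kappa>\<^sup>2 * ((1 + C) / 2) * cmod (cpoly (P n) z)"
    by (intro poly_bound_by_OP z) (simp add: degree_map_poly)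
  then show ?thesis using OP_nonzero_off_seg[OF zs, of n]
    by (simp add: SP_ratio_def norm_divide pos_divide_le_eq)
qed

text \<open>Comparison with \<open>x (S\<^sub>n - P\<^sub>n)\<close>, whose degree is still at most \<open>n\<close>, gains a factor of \<open>1 / |z|\<close>.
The 9 is the square of the ratio 3 that bounds \<open>(|z| + 1) / seg_dist z\<close> for \<open>|z| \<ge> 2\<close>.\<close>

lemma SP_ratio_near_infinity:
  assumes C: "B (S n) (S n) \<le> C * L2_form M (P n) (P n)" and z: "2 \<le> cmod z"
  shows "cmod z * cmod (SP_ratio n z - 1) \<le> 9 * ((3 + 2 * C) / 2)"
proof -
  let ?L = "L2_form M (P n) (P n)"
  have z3: "cmod z + 1 \<le> 3 * seg_dist z" using seg_dist_far[of z] z by linarith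
  then have zs: "z \<notin> seg" using z by (intro not_in_seg_if_seg_dist_pos) linarith
  define f where "f = [:0, 1:] * (S n - P n)"
  have "degree f \<le> n"
  proof (cases "S n = P n")
    case False
    have "degree (S n - P n) < n"
      using False by (intro L2.degree_diff_monic_OP sob.degree_monic_OP sob.lead_coeff_monic_OP)
    then show ?thesis unfolding f_def using degree_mult_le[of "[:0, 1:]" "S n - P n"] by simp
  qed (simp add: f_def)
  then have deg: "degree (map_poly complex_of_real f) \<le> n" by (simp add: degree_map_poly)
  have "(LINT x|M. (cmod (cpoly f (complex_of_real x)))\<^sup>2) \<le>
     (LINT x|M. 2 * (poly (S n) x * poly (S n) x) + 2 * (poly (P n) x * poly (P n) x))"
  proof (rule integral_mono_Icc)
    show "integrable M (\<lambda>x. (cmod (cpoly f (complex_of_real x)))\<^sup>2)"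
      by (intro integrable_everywhere_continuous continuous_intros)
    show "integrable M (\<lambda>x. 2 * (poly (S n) x * poly (S n) x) + 2 * (poly (P n) x * poly (P n) x))"
      by (intro integrable_everywhere_continuous continuous_intros)
    fix x :: real assume x: "x \<in> {-1..1}"
    let ?s = "poly (S n) x" and ?p = "poly (P n) x"
    have "x\<^sup>2 \<le> 1" using x by (simp add: abs_square_le_1 abs_le_iff)
    have "(cmod (cpoly f (complex_of_real x)))\<^sup>2 = x\<^sup>2 * (?s - ?p)\<^sup>2"
      unfolding cpoly_of_real norm_of_real power2_abs by (simp add: f_def power_mult_distrib)
    also have "\<dots> \<le> 1 * (?s - ?p)\<^sup>2" using \<open>x\<^sup>2 \<le> 1\<close>
      by (intro mult_right_mono) auto
    also have "\<dots> \<le> 2 * (?s * ?s) + 2 * (?p * ?p)"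
      using zero_le_power2[of "?s + ?p"] by (simp add: power2_sum power2_diff) (simp add: power2_eq_square)
    finally show "(cmod (cpoly f (complex_of_real x)))\<^sup>2 \<le> 2 * (?s * ?s) + 2 * (?p * ?p)" .
  qed
  also have "\<dots> = 2 * L2_form M (S n) (S n) + 2 * ?L"
    unfolding L2_form_eq[of "S n" "S n"] L2_form_eq[of "P n" "P n"]
    by (subst Bochner_Integration.integral_add)
       (auto intro!: integrable_everywhere_continuous continuous_intros)
  also have "\<dots> \<le> (2 * C + 2) * ?L" using sobolev_mass_le(1)[of "S n"] C by (simp add: algebra_simps)
  finally have "cmod (cpoly f z) \<le> 3\<^sup>2 * ((1 + (2 * C + 2)) / 2) * cmod (cpoly (P n) z)"
    by (intro poly_bound_by_OP deg z3) auto
  moreover have "cpoly f z = z * (SP_ratio n z - 1) * cpoly (P n) z"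
    unfolding f_def cpoly_mult cpoly_diff sobolev_eq_ratio_mult[OF zs]
    by (simp add: map_poly_pCons algebra_simps)
  ultimately have "cmod z * cmod (SP_ratio n z - 1) * cmod (cpoly (P n) z) \<le> 9 * ((3 + 2 * C) / 2) * cmod (cpoly (P n) z)"
    by (simp add: norm_mult add.commute)
  then show ?thesis using OP_nonzero_off_seg[OF zs, of n] by simp
qed

text \<open>Differentiate \<open>S\<^sub>n = (S\<^sub>n / P\<^sub>n) P\<^sub>n\<close> by Leibniz' rule \<open>d\<^sub>j\<close> times at \<open>c\<^sub>j\<close> and divide by the derivative
of order \<open>d\<^sub>j\<close> of \<open>P\<^sub>n\<close>. The left-hand side tends to 0, as \<open>\<parallel>P\<^sub>n\<parallel>\<close> is geometrically small compared
with \<open>P\<^sub>n(c\<^sub>j)\<close>. On the right-hand side, the terms with a derivative of the quotient carry a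
lower derivative of \<open>P\<^sub>n\<close>, which is smaller by a factor of order \<open>n\<close>, and Cauchy's inequality bounds
the derivatives of the quotient. What remains is the value of the quotient.\<close>

lemma SP_ratio_tendsto_0_at_mass_point:
  assumes C: "0 \<le> C" "\<And>n. n \<ge> n0 \<Longrightarrow> B (S n) (S n) \<le> C * L2_form M (P n) (P n)"
    and j: "j \<in> {1..N}" and c: "c j \<notin> {-1..1}"
  shows "(\<lambda>n. SP_ratio n (complex_of_real (c j))) \<longlonglongrightarrow> 0"
proof -
  let ?c = "complex_of_real (c j)" and ?d = "d j"
  have cseg: "?c \<notin> seg" using c by (auto simp: seg_def)
  have c1: "1 < \<bar>c j\<bar>" using c by auto
  have op: "open (- seg)" using closed_seg by (simp add: open_Compl)
  obtain r where r: "r > 0" "cball ?c r \<subseteq> - seg"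
    using op cseg open_contains_cball[of "- seg"] by auto
  have "cball ?c r \<inter> seg = {}" using r(2) by blast
  then obtain \<kappa> where \<kappa>: "\<kappa> > 0" "\<And>z. z \<in> cball ?c r \<Longrightarrow> cmod z + 1 \<le> \<kappa> * seg_dist z"
    using exists_seg_dist_ratio[OF closed_cball] by blast
  obtain \<theta> C1 where \<theta>: "\<theta> > 1" "C1 > 0" "\<And>n z. cmod z + 1 \<le> \<kappa> * seg_dist z \<Longrightarrow>
    L2_form M (P n) (P n) * \<theta> ^ n \<le> C1 * (cmod (cpoly (P n) z))\<^sup>2"
    using OP_growth[OF \<kappa>(1)] by blast
  define B0 where "B0 = \<kappa>\<^sup>2 * ((1 + C) / 2)"
  define E where "E = (\<Sum>i\<in>{1..?d}. real (?d choose i) * (fact i * B0 / r ^ i))"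
  have B0: "B0 \<ge> 0" unfolding B0_def using C by simp
  have E: "E \<ge> 0" unfolding E_def using B0 r by (intro sum_nonneg) auto
  define A where "A = \<bar>c j\<bar> + 1"
  have A: "A > 0" by (simp add: A_def)
  define n1 where "n1 = max n0 (nat \<lceil>real ?d + A\<rceil>)"
  define u where "u n = sqrt (C * C1 / \<eta> j * inverse (\<theta> ^ n)) + E * (A / (real n - real ?d))" for n
  have bound: "cmod (SP_ratio n ?c) \<le> u n" if n: "n \<ge> n1" for n
  proof -
    let ?L = "L2_form M (P n) (P n)"
    define L where "L = (real n - real ?d) / A"
    have nd: "real ?d + A \<le> real n" using n unfolding n1_def by linarith
    have L1: "1 \<le> L" unfolding L_def using nd A by (simp add: le_divide_eq)
    define q where "q i = \<bar>poly ((pderiv ^^ i) (P n)) (c j)\<bar>" for i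
    have q: "cmod (cpoly ((pderiv ^^ i) (P n)) ?c) = q i" for i by (simp add: q_def cpoly_of_real)
    have dom: "L * q i \<le> q ?d" if "i < ?d" for i
      unfolding q_def
    proof (rule derivative_dominates)
      show "lead_coeff (P n) = 1" using L2.lead_coeff_monic_OP[of n] by simp
      show "cpoly (P n) z = 0 \<Longrightarrow> z \<in> seg" for z using OP_nonzero_off_seg by blast
      show "real ?d + L * (\<bar>c j\<bar> + 1) \<le> real (degree (P n))"
        unfolding L_def A_def[symmetric] using A by simp
    qed (use that L1 c1 in auto)
    have q0: "q 0 \<le> q ?d"
    proof (cases "?d = 0")
      case False
      have "q 0 \<le> L * q 0" using L1 by (simp add: q_def mult_le_cancel_right1)
      with dom[of 0] False show ?thesis by simp
    qed simp
    have "q 0 = cmod (cpoly (P n) ?c)" using q[of 0] by simp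
    then have q0pos: "q 0 > 0" using OP_nonzero_off_seg[OF cseg, of n] by simp
    have Gd: "cmod ((deriv ^^ i) (SP_ratio n) ?c) \<le> fact i * B0 / r ^ i" for i
    proof (rule Cauchy_inequality[OF _ _ r(1)])
      have sub: "ball ?c r \<subseteq> - seg" using r(2) ball_subset_cball by blast
      show "SP_ratio n holomorphic_on ball ?c r" by (rule holomorphic_on_subset[OF SP_ratio_holomorphic sub])
      show "continuous_on (cball ?c r) (SP_ratio n)"
        by (rule holomorphic_on_imp_continuous_on[OF holomorphic_on_subset[OF SP_ratio_holomorphic r(2)]])
      show "cmod (SP_ratio n x) \<le> B0" if "cmod (?c - x) = r" for x
        unfolding B0_def using that n by (intro SP_ratio_bound C \<kappa>) (auto simp: n1_def dist_norm)
    qed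
    have "(deriv ^^ ?d) (cpoly (S n)) ?c = (deriv ^^ ?d) (\<lambda>w. SP_ratio n w * cpoly (P n) w) ?c"
      using cseg op by (intro higher_deriv_transform_within_open[of _ "- seg"] holomorphic_cpoly
        holomorphic_on_mult SP_ratio_holomorphic sobolev_eq_ratio_mult) auto
    also have "\<dots> = (\<Sum>i = 0..?d. of_nat (?d choose i) * (deriv ^^ i) (SP_ratio n) ?c * (deriv ^^ (?d - i)) (cpoly (P n)) ?c)"
      using cseg op by (intro higher_deriv_mult[of _ "- seg"] holomorphic_cpoly SP_ratio_holomorphic) auto
    also have "\<dots> = SP_ratio n ?c * cpoly ((pderiv ^^ ?d) (P n)) ?c +
      (\<Sum>i\<in>{1..?d}. of_nat (?d choose i) * (deriv ^^ i) (SP_ratio n) ?c * cpoly ((pderiv ^^ (?d - i)) (P n)) ?c)"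
      unfolding deriv_cpoly_funpow by (simp add: sum.atLeast_Suc_atMost)
    finally have eq: "SP_ratio n ?c * cpoly ((pderiv ^^ ?d) (P n)) ?c = cpoly ((pderiv ^^ ?d) (S n)) ?c -
      (\<Sum>i\<in>{1..?d}. of_nat (?d choose i) * (deriv ^^ i) (SP_ratio n) ?c * cpoly ((pderiv ^^ (?d - i)) (P n)) ?c)"
      unfolding deriv_cpoly_funpow by simp
    have tail: "cmod (\<Sum>i\<in>{1..?d}. of_nat (?d choose i) * (deriv ^^ i) (SP_ratio n) ?c * cpoly ((pderiv ^^ (?d - i)) (P n)) ?c)
      \<le> E * (q ?d / L)"
      unfolding E_def sum_distrib_right
    proof (rule sum_norm_le)
      fix i assume i: "i \<in> {1..?d}"
      have "q (?d - i) \<le> q ?d / L" using dom[of "?d - i"] i L1 by (simp add: le_divide_eq mult.commute)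
      then have "real (?d choose i) * cmod ((deriv ^^ i) (SP_ratio n) ?c) * q (?d - i) \<le>
         real (?d choose i) * (fact i * B0 / r ^ i) * (q ?d / L)"
        using Gd[of i] B0 r by (intro mult_mono mult_left_mono mult_nonneg_nonneg) (auto simp: q_def)
      then show "cmod (of_nat (?d choose i) * (deriv ^^ i) (SP_ratio n) ?c * cpoly ((pderiv ^^ (?d - i)) (P n)) ?c)
        \<le> real (?d choose i) * (fact i * B0 / r ^ i) * (q ?d / L)"
        by (simp only: norm_mult q norm_of_nat)
    qed
    define sd where "sd = poly ((pderiv ^^ ?d) (S n)) (c j)"
    have "\<eta> j * sd\<^sup>2 \<le> C * ?L" using sobolev_mass_le(2)[OF j, of "S n"] C(2)[of n] n
      by (simp add: sd_def n1_def)
    moreover have "?L \<le> C1 * (q 0)\<^sup>2 * inverse (\<theta> ^ n)"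
      using \<theta>(3)[of ?c n] \<kappa>(2)[of ?c] r(1) \<theta>(1) q[of 0] by (simp add: field_simps)
    then have "C * ?L \<le> C * (C1 * (q 0)\<^sup>2 * inverse (\<theta> ^ n))" using C(1)
      by (rule mult_left_mono)
    ultimately have "\<eta> j * sd\<^sup>2 \<le> C * (C1 * (q 0)\<^sup>2 * inverse (\<theta> ^ n))"
      by (rule order_trans)
    then have "sd\<^sup>2 \<le> C * (C1 * (q 0)\<^sup>2 * inverse (\<theta> ^ n)) / \<eta> j"
      using \<eta>_pos[OF j] by (simp add: pos_le_divide_eq mult.commute)
    also have "\<dots> = C * C1 / \<eta> j * inverse (\<theta> ^ n) * (q 0)\<^sup>2" by simp
    finally have "sd\<^sup>2 \<le> C * C1 / \<eta> j * inverse (\<theta> ^ n) * (q 0)\<^sup>2" .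
    then have "sqrt (sd\<^sup>2) \<le> sqrt (C * C1 / \<eta> j * inverse (\<theta> ^ n) * (q 0)\<^sup>2)"
      by (rule real_sqrt_le_mono)
    then have "\<bar>sd\<bar> \<le> sqrt (C * C1 / \<eta> j * inverse (\<theta> ^ n)) * q 0"
      using q0pos by (simp only: real_sqrt_mult real_sqrt_abs abs_of_pos)
    also have "\<dots> \<le> sqrt (C * C1 / \<eta> j * inverse (\<theta> ^ n)) * q ?d"
      using q0 C \<theta> \<eta>_pos[OF j]
        by (intro mult_left_mono real_sqrt_ge_zero mult_nonneg_nonneg divide_nonneg_pos) auto
    finally have sd: "\<bar>sd\<bar> \<le> sqrt (C * C1 / \<eta> j * inverse (\<theta> ^ n)) * q ?d" .
    have "cmod (SP_ratio n ?c) * q ?d = cmod (SP_ratio n ?c * cpoly ((pderiv ^^ ?d) (P n)) ?c)"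
      by (simp only: norm_mult q)
    also have "\<dots> \<le> \<bar>sd\<bar> + E * (q ?d / L)"
      unfolding eq using tail by (intro order_trans[OF norm_triangle_ineq4] add_mono) (auto simp: sd_def cpoly_of_real)
    also have "\<dots> \<le> u n * q ?d" using sd unfolding u_def L_def by (simp add: algebra_simps)
    finally show ?thesis using q0 q0pos by simp
  qed
  have "u \<longlonglongrightarrow> sqrt (C * C1 / \<eta> j * 0) + E * 0"
    unfolding u_def
  proof (intro tendsto_intros)
    show "(\<lambda>n. inverse (\<theta> ^ n)) \<longlonglongrightarrow> 0" using \<theta>(1)
      by (rule LIMSEQ_inverse_realpow_zero)
    have "filterlim (\<lambda>n. - real ?d + real n) at_top sequentially"
      by (rule filterlim_tendsto_add_at_top[OF tendsto_const filterlim_real_sequentially])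
    then have "filterlim (\<lambda>n. real n - real ?d) at_infinity sequentially"
      by (intro filterlim_at_top_imp_at_infinity) simp
    then show "(\<lambda>n. A / (real n - real ?d)) \<longlonglongrightarrow> 0"
      by (intro tendsto_divide_0[OF tendsto_const])
  qed
  then have "u \<longlonglongrightarrow> 0" by simp
  then show ?thesis
    by (rule Lim_null_comparison[rotated]) (use bound in \<open>auto simp: eventually_sequentially\<close>)
qed

end

section \<open>Location of the zeros\<close>

lemma inj_on_if_sequentially_ordered:
  assumes "sequentially_ordered N c d"
  shows "inj_on c {1..N}"
proof -
  obtain \<pi> where bij: "bij_betw \<pi> {1..N} {1..N}"
    and hull: "\<And>k. k \<in> {1..N} \<Longrightarrow> c (\<pi> k) \<notin> convex hull ({-1<..<1} \<union> (\<lambda>i. c (\<pi> i)) ` {1..<k})"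
    using assms unfolding sequentially_ordered_def by blast
  have ne: "c (\<pi> i) \<noteq> c (\<pi> k)" if "i \<in> {1..N}" "k \<in> {1..N}" "i < k" for i k
  proof
    assume eq: "c (\<pi> i) = c (\<pi> k)"
    have "c (\<pi> i) \<in> convex hull ({-1<..<1} \<union> (\<lambda>i. c (\<pi> i)) ` {1..<k})"
      using that by (intro hull_inc) auto
    with hull[OF that(2)] eq show False by simp
  qed
  have "inj_on (c \<circ> \<pi>) {1..N}"
  proof (rule inj_onI, rule ccontr)
    fix i k assume "i \<in> {1..N}" "k \<in> {1..N}" "(c \<circ> \<pi>) i = (c \<circ> \<pi>) k" "i \<noteq> k"
    then show False using ne[of i k] ne[of k i] by (cases "i < k") auto
  qed
  then have "inj_on c (\<pi> ` {1..N})" by (rule inj_on_imageI)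
  moreover have "\<pi> ` {1..N} = {1..N}" using bij by (simp add: bij_betw_def)
  ultimately show ?thesis by simp
qed

lemma finite_set_separation:
  fixes A :: "'a::metric_space set"
  assumes "finite A"
  shows "\<exists>e>0. \<forall>x\<in>A. \<forall>y\<in>A. x \<noteq> y \<longrightarrow> e \<le> dist x y"
proof -
  define D where "D = insert 1 ((\<lambda>(x, y). dist x y) ` {(x, y) \<in> A \<times> A. x \<noteq> y})"
  have "finite {(x, y) \<in> A \<times> A. x \<noteq> y}"
    by (rule finite_subset[of _ "A \<times> A"]) (use assms in auto)
  then have fin: "finite D" unfolding D_def by (intro finite.insertI finite_imageI)
  have "Min D \<in> D" by (rule Min_in[OF fin]) (simp add: D_def)
  then have "Min D > 0" by (auto simp: D_def)
  moreover have "Min D \<le> dist x y" if "x \<in> A" "y \<in> A" "x \<noteq> y" for x y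
    using that by (intro Min_le[OF fin]) (auto simp: D_def)
  ultimately show ?thesis by blast
qed

context sobolev
begin

text \<open>A small value of \<open>S\<^sub>n / P\<^sub>n\<close> in \<open>K\<close> would give a zero of \<open>S\<^sub>n\<close> outside the segment and away from the
\<open>c\<^sub>j\<close>; together with the zeros near the \<open>N\<close> points \<open>c\<^sub>j\<close> and at least \<open>n - N\<close> zeros in \<open>(-1,1)\<close> this
exceeds the degree.\<close>

lemma SP_ratio_bounded_below:
  assumes nevai: "Nevai_class_0_1 M" and seq: "sequentially_ordered N c d"
    and c: "\<And>j. j \<in> {1..N} \<Longrightarrow> c j \<notin> {-1..1}"
    and K: "closed K" "K \<inter> complex_of_real ` ({-1..1} \<union> c ` {1..N}) = {}"
  shows "\<exists>\<delta>>0. \<forall>\<^sub>F n in sequentially. \<forall>z\<in>K. \<delta> \<le> cmod (SP_ratio n z)"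
proof -
  obtain C n0 where C: "0 \<le> C" "\<And>n. n \<ge> n0 \<Longrightarrow> B (S n) (S n) \<le> C * L2_form M (P n) (P n)"
    using sobolev_norm_bound[OF nevai] by blast
  define R where "R = 27 + 18 * C"
  have R27: "27 \<le> R" using C(1) by (simp add: R_def)
  \<comment> \<open>The radius \<open>R\<close> is chosen such that \<open>SP_ratio_near_infinity\<close> gives a deviation of at most \<open>1/2\<close>.\<close>
  have far: "1 / 2 \<le> cmod (SP_ratio n z)" if "n \<ge> n0" "R \<le> cmod z" for n z
  proof -
    have z2: "2 \<le> cmod z" using that(2) C(1) unfolding R_def by linarith
    have "cmod z * cmod (SP_ratio n z - 1) \<le> R / 2"
      using SP_ratio_near_infinity[OF C(2)[OF that(1)] z2] by (simp add: R_def)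
    also have "\<dots> \<le> cmod z * (1 / 2)" using that(2) by simp
    finally have "cmod (SP_ratio n z - 1) \<le> 1 / 2" using z2 by (simp only: mult_le_cancel_left_pos)
    then show ?thesis using norm_triangle_ineq3[of 1 "1 - SP_ratio n z"] norm_minus_commute[of "SP_ratio n z" 1] by simp
  qed
  have op: "open (- seg)" using closed_seg by (simp add: open_Compl)
  have near: "\<exists>\<delta>>0. \<forall>n\<ge>n0. \<forall>z\<in>A. cmod (SP_ratio n z) < \<delta> \<longrightarrow> (\<exists>w. w \<notin> seg \<and> dist z w < \<epsilon> \<and> SP_ratio n w = 0)"
    if A: "compact A" "A \<inter> seg = {}" and \<epsilon>: "\<epsilon> > 0" for A \<epsilon>
  proof -
    have "\<exists>\<delta>>0. \<forall>n. \<forall>z\<in>A. cmod (SP_ratio (n + n0) z) < \<delta> \<longrightarrow>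
        (\<exists>w\<in>- seg. dist z w < \<epsilon> \<and> SP_ratio (n + n0) w = 0)"
    proof (rule zero_near_small_value[OF op])
      show "connected (- seg)"
        by (rule connected_complement_bounded_convex) (simp_all add: compact_imp_bounded compact_seg convex_seg)
      show "SP_ratio (n + n0) holomorphic_on - seg" for n by (rule SP_ratio_holomorphic)
      show "\<exists>B. \<forall>n. \<forall>z\<in>K. cmod (SP_ratio (n + n0) z) \<le> B"
        if cK: "compact K" "K \<subseteq> - seg" for K
      proof -
        have "K \<inter> seg = {}" using cK(2) by blast
        then obtain \<kappa> where "\<kappa> > 0" "\<And>z. z \<in> K \<Longrightarrow> cmod z + 1 \<le> \<kappa> * seg_dist z"
          using exists_seg_dist_ratio[OF compact_imp_closed[OF cK(1)]] by blast
        then have "\<forall>n. \<forall>z\<in>K. cmod (SP_ratio (n + n0) z) \<le> \<kappa>\<^sup>2 * ((1 + C) / 2)"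
          using SP_ratio_bound[OF C(2)] by simp
        then show ?thesis by blast
      qed
      show "complex_of_real R \<in> - seg" using R27 by (auto simp: seg_def)
      show "1 / 2 \<le> cmod (SP_ratio (n + n0) (complex_of_real R))" for n using R27 by (intro far) auto
    qed (use A \<epsilon> in auto)
    then obtain \<delta> where \<delta>: "\<delta> > 0" "\<And>n z. z \<in> A \<Longrightarrow> cmod (SP_ratio (n + n0) z) < \<delta> \<Longrightarrow>
        \<exists>w\<in>- seg. dist z w < \<epsilon> \<and> SP_ratio (n + n0) w = 0" by blast
    have "\<exists>w. w \<notin> seg \<and> dist z w < \<epsilon> \<and> SP_ratio n w = 0"
      if "n \<ge> n0" "z \<in> A" "cmod (SP_ratio n z) < \<delta>" for n z
      using \<delta>(2)[of z "n - n0"] that by auto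
    with \<delta>(1) show ?thesis by blast
  qed
  define Y where "Y = complex_of_real ` c ` {1..N}"
  have finY: "finite Y" by (simp add: Y_def)
  have cardY: "card Y = N"
  proof -
    have "card Y = card (c ` {1..N})" unfolding Y_def by (rule card_image) (simp add: inj_on_def)
    also have "\<dots> = N" using card_image[OF inj_on_if_sequentially_ordered[OF seq]] by simp
    finally show ?thesis .
  qed
  have Yseg: "Y \<inter> seg = {}" using c by (auto simp: Y_def seg_def)
  define K' where "K' = K \<inter> cball 0 R"
  have K': "compact K'" "K' \<inter> seg = {}" "K' \<inter> Y = {}"
  proof -
    show "compact K'" unfolding K'_def using K(1) by (intro closed_Int_compact) auto
    show "K' \<inter> seg = {}" "K' \<inter> Y = {}" using K(2) by (auto simp: K'_def seg_def Y_def)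
  qed
  obtain e1 where e1: "e1 > 0" "\<forall>x\<in>Y. \<forall>y\<in>Y. x \<noteq> y \<longrightarrow> e1 \<le> dist x y"
    using finite_set_separation[OF finY] by blast
  obtain e2 where e2: "e2 > 0" "\<forall>x\<in>K'. \<forall>y\<in>Y. e2 \<le> dist x y"
    using separate_compact_closed[OF K'(1) finite_imp_closed[OF finY] K'(3)] by blast
  define \<epsilon> where "\<epsilon> = min e1 e2 / 2"
  have \<epsilon>: "\<epsilon> > 0" "2 * \<epsilon> \<le> e1" "2 * \<epsilon> \<le> e2" using e1(1) e2(1)
    by (auto simp: \<epsilon>_def)
  obtain \<delta>1 where \<delta>1: "\<delta>1 > 0" "\<forall>n\<ge>n0. \<forall>z\<in>Y. cmod (SP_ratio n z) < \<delta>1 \<longrightarrow> (\<exists>w. w \<notin> seg \<and> dist z w < \<epsilon> \<and> SP_ratio n w = 0)"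
    using near[OF finite_imp_compact[OF finY] Yseg \<epsilon>(1)] by blast
  obtain \<delta>2 where \<delta>2: "\<delta>2 > 0" "\<forall>n\<ge>n0. \<forall>z\<in>K'. cmod (SP_ratio n z) < \<delta>2 \<longrightarrow> (\<exists>w. w \<notin> seg \<and> dist z w < \<epsilon> \<and> SP_ratio n w = 0)"
    using near[OF K'(1,2) \<epsilon>(1)] by blast
  have "\<forall>\<^sub>F n in sequentially. \<forall>y\<in>Y. cmod (SP_ratio n y) < \<delta>1"
  proof (rule eventually_ball_finite[OF finY], rule ballI)
    fix y assume "y \<in> Y"
    then obtain j where j: "j \<in> {1..N}" "y = complex_of_real (c j)" by (auto simp: Y_def)
    have "(\<lambda>n. SP_ratio n y) \<longlonglongrightarrow> 0" unfolding j(2)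
      by (rule SP_ratio_tendsto_0_at_mass_point[OF C j(1) c[OF j(1)]])
    from tendstoD[OF this \<delta>1(1)] show "\<forall>\<^sub>F n in sequentially. cmod (SP_ratio n y) < \<delta>1" by simp
  qed
  then have "\<forall>\<^sub>F n in sequentially. \<forall>z\<in>K. min \<delta>2 (1 / 2) \<le> cmod (SP_ratio n z)"
    using eventually_ge_at_top[of n0]
  proof eventually_elim
    case (elim n)
    show ?case
    proof (rule ballI, rule ccontr)
      fix z assume z: "z \<in> K" and small: "\<not> min \<delta>2 (1 / 2) \<le> cmod (SP_ratio n z)"
      have "cmod z < R" using far[of n z] elim(2) small by (cases "R \<le> cmod z") auto
      then have zK: "z \<in> K'" using z by (simp add: K'_def)
      then obtain w where w: "w \<notin> seg" "dist z w < \<epsilon>" "SP_ratio n w = 0"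
        using \<delta>2(2) elim(2) small by (meson min.coboundedI1 not_le)
      have "\<forall>y\<in>Y. \<exists>v. v \<notin> seg \<and> dist y v < \<epsilon> \<and> SP_ratio n v = 0"
        using \<delta>1(2) elim by blast
      then obtain f where f: "\<And>y. y \<in> Y \<Longrightarrow> f y \<notin> seg" "\<And>y. y \<in> Y \<Longrightarrow> dist y (f y) < \<epsilon>"
        "\<And>y. y \<in> Y \<Longrightarrow> SP_ratio n (f y) = 0" by metis
      obtain X where X: "finite X" "X \<subseteq> {-1<..<1}" "n \<le> card X + N" "\<And>x. x \<in> X \<Longrightarrow> poly (S n) x = 0"
        using sobolev_zeros_in_interval[OF seq, of n] by blast
      have injf: "inj_on f Y"
      proof (rule inj_onI, rule ccontr)
        fix x y assume xy: "x \<in> Y" "y \<in> Y" "f x = f y" "x \<noteq> y"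
        have "dist x y \<le> dist x (f x) + dist (f x) y" by (rule dist_triangle)
        then have "dist x y < 2 * \<epsilon>" using f(2)[OF xy(1)] f(2)[OF xy(2)] xy(3)
          by (simp add: dist_commute)
        with e1(2) xy \<epsilon>(2) show False by force
      qed
      have wf: "w \<notin> f ` Y"
      proof
        assume "w \<in> f ` Y"
        then obtain y where y: "y \<in> Y" "w = f y" by blast
        have "dist z y \<le> dist z w + dist w y" by (rule dist_triangle)
        then have "dist z y < 2 * \<epsilon>" using w(2) f(2)[OF y(1)] y(2) by (simp add: dist_commute)
        with e2(2) zK y \<epsilon>(3) show False by force
      qed
      define Z where "Z = insert w (f ` Y)"
      have "card Z = N + 1" unfolding Z_def using finY wf injf cardY by (simp add: card_image)
      moreover have "complex_of_real ` X \<subseteq> seg"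
        unfolding seg_def using X(2) by (intro image_mono) auto
      then have "Z \<inter> complex_of_real ` X = {}"
        using w(1) f(1) unfolding Z_def by blast
      moreover have "card (complex_of_real ` X) = card X" by (intro card_image inj_onI) simp
      ultimately have "card (Z \<union> complex_of_real ` X) = card X + N + 1"
        using X(1) finY by (subst card_Un_disjoint) (auto simp: Z_def)
      moreover have "Z \<union> complex_of_real ` X \<subseteq> {v. cpoly (S n) v = 0}"
        using w f X(4) sobolev_eq_ratio_mult[of _ n] by (auto simp: Z_def cpoly_of_real)
      moreover have S0: "map_poly complex_of_real (S n) \<noteq> 0"
      proof
        assume "map_poly complex_of_real (S n) = 0"
        then have "coeff (map_poly complex_of_real (S n)) n = 0" by simp
        then show False by (simp add: coeff_map_poly sob.lead_coeff_monic_OP)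
      qed
      ultimately have "card X + N + 1 \<le> card {v. cpoly (S n) v = 0}"
        using poly_roots_finite[OF S0] by (metis card_mono)
      also have "\<dots> \<le> degree (map_poly complex_of_real (S n))" by (rule card_poly_roots_bound[OF S0])
      also have "\<dots> = n" by (simp add: degree_map_poly)
      finally show False using X(3) by simp
    qed
  qed
  moreover have "min \<delta>2 (1 / 2) > 0" using \<delta>2(1) by simp
  ultimately show ?thesis by blast
qed

end

section \<open>The remainder and its decay\<close>

lemma closed_finite_part:
  assumes "compactin Riemann_sphere K"
  shows "closed {z. Some z \<in> K}"
proof -
  have "Hausdorff_space Riemann_sphere"
    by (simp add: Hausdorff_space_Alexandroff_compactification locally_compact_space_euclidean)
  then have "closedin Riemann_sphere K" using assms by (rule compactin_imp_closedin)
  from closedin_continuous_map_preimage[OF continuous_map_Some this] show ?thesis by simp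
qed

lemma tendsto_inverse_distance: "((\<lambda>z::complex. A / (cmod z - 1)) \<longlongrightarrow> (0::real)) at_infinity"
proof -
  have "filterlim (\<lambda>z::complex. - 1 + cmod z) at_top at_infinity"
    by (rule filterlim_tendsto_add_at_top[OF tendsto_const filterlim_norm_at_top])
  then have "filterlim (\<lambda>z::complex. cmod z - 1) at_infinity at_infinity"
    by (intro filterlim_at_top_imp_at_infinity) simp
  then show ?thesis by (rule tendsto_divide_0[OF tendsto_const])
qed

context measure_on_Icc
begin

lemma isCont_transform:
  fixes f :: "real \<Rightarrow> complex"
  assumes f: "continuous_on UNIV f" and z: "z \<notin> seg"
  shows "isCont (\<lambda>z. LINT x|M. f x / (z - complex_of_real x)) z"
proof -
  let ?T = "\<lambda>z. LINT x|M. f x / (z - complex_of_real x)"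
  have g: "seg_dist z > 0" by (rule seg_dist_pos[OF z])
  define A where "A = (LINT x|M. cmod (f x))"
  have bound: "cmod (?T w - ?T z) \<le> A * (2 / (seg_dist z)\<^sup>2) * cmod (w - z)"
    if w: "dist w z < seg_dist z / 2" for w
  proof -
    have wx: "seg_dist z / 2 \<le> cmod (w - complex_of_real x)" if "x \<in> {-1..1}" for x
      using seg_dist_le[OF that, of z] w norm_triangle_ineq[of "z - w" "w - complex_of_real x"]
      by (simp add: dist_norm norm_minus_commute)
    have ws: "w \<notin> seg"
      using wx g by (force simp: seg_def)
    have "?T w - ?T z = (LINT x|M. f x / (w - complex_of_real x) - f x / (z - complex_of_real x))"
      using integrable_transform[OF f] z ws by (subst Bochner_Integration.integral_diff) auto
    also have "cmod \<dots> \<le> (LINT x|M. cmod (f x / (w - complex_of_real x) - f x / (z - complex_of_real x)))"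
      by (rule integral_norm_bound)
    also have "\<dots> \<le> (LINT x|M. cmod (f x) * (2 / (seg_dist z)\<^sup>2 * cmod (w - z)))"
    proof (rule integral_mono_Icc)
      show "integrable M (\<lambda>x. cmod (f x / (w - complex_of_real x) - f x / (z - complex_of_real x)))"
        using integrable_transform[OF f] z ws by (intro integrable_norm Bochner_Integration.integrable_diff)
      show "integrable M (\<lambda>x. cmod (f x) * (2 / (seg_dist z)\<^sup>2 * cmod (w - z)))"
        using f by (intro integrable_everywhere_continuous continuous_intros)
      fix x :: real assume x: "x \<in> {-1..1}"
      let ?u = "w - complex_of_real x" and ?v = "z - complex_of_real x"
      have uv: "?u \<noteq> 0" "?v \<noteq> 0" using not_in_seg[OF ws x] not_in_seg[OF z x] by auto
      have "f x / ?u - f x / ?v = f x * (z - w) / (?u * ?v)" using uv by (simp add: field_simps)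
      then have "cmod (f x / ?u - f x / ?v) = cmod (f x) * cmod (w - z) / (cmod ?u * cmod ?v)"
        by (simp add: norm_mult norm_divide norm_minus_commute)
      also have "\<dots> \<le> cmod (f x) * cmod (w - z) / (seg_dist z / 2 * seg_dist z)"
        using g uv wx[OF x] seg_dist_le[OF x, of z]
        by (intro divide_left_mono mult_mono mult_nonneg_nonneg mult_pos_pos) auto
      also have "\<dots> = cmod (f x) * (2 / (seg_dist z)\<^sup>2 * cmod (w - z))"
        by (simp add: power2_eq_square)
      finally show "cmod (f x / ?u - f x / ?v) \<le> cmod (f x) * (2 / (seg_dist z)\<^sup>2 * cmod (w - z))" .
    qed
    also have "\<dots> = A * (2 / (seg_dist z)\<^sup>2 * cmod (w - z))"
      unfolding A_def by (rule integral_mult_left_zero)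
    finally show ?thesis by (simp only: mult.assoc)
  qed
  have "((\<lambda>w. ?T w - ?T z) \<longlongrightarrow> 0) (at z)"
  proof (rule Lim_null_comparison)
    show "\<forall>\<^sub>F w in at z. cmod (?T w - ?T z) \<le> A * (2 / (seg_dist z)\<^sup>2) * cmod (w - z)"
      unfolding eventually_at using bound g by (intro exI[of _ "seg_dist z / 2"]) auto
    have "((\<lambda>w. A * (2 / (seg_dist z)\<^sup>2) * cmod (w - z)) \<longlongrightarrow> A * (2 / (seg_dist z)\<^sup>2) * cmod (z - z)) (at z)"
      by (intro tendsto_intros)
    then show "((\<lambda>w. A * (2 / (seg_dist z)\<^sup>2) * cmod (w - z)) \<longlongrightarrow> 0) (at z)" by simp
  qed
  then show ?thesis unfolding isCont_def by (rule LIM_zero_cancel)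
qed

end

context sobolev
begin

lemma rho_nonneg: "x \<in> {-1..1} \<Longrightarrow> 0 \<le> rho N c d x"
  unfolding rho_def by (intro mult_nonneg_nonneg prod_nonneg zero_le_power) auto

lemma continuous_rho: "continuous_on A (rho N c d)"
  unfolding rho_def by (intro continuous_intros)

lemma set_integral_mu_rho:
  fixes f :: "real \<Rightarrow> complex"
  assumes f: "f \<in> borel_measurable borel"
  shows "(LINT x:{-1..1}|mu_rho M N c d. f x) = (LINT x|M. complex_of_real (rho N c d x) * f x)"
proof -
  have rho: "rho N c d \<in> borel_measurable borel"
    by (intro measurable_continuous continuous_rho)
  have "(LINT x:{-1..1}|mu_rho M N c d. f x) = (LINT x|M. rho N c d x *\<^sub>R (indicat_real {-1..1} x *\<^sub>R f x))"
    unfolding set_lebesgue_integral_def mu_rho_def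
  proof (rule integral_density)
    show "(\<lambda>x. indicat_real {-1..1} x *\<^sub>R f x) \<in> borel_measurable M"
      unfolding measurable_cong_sets[OF sets_M refl] using f by measurable
    show "rho N c d \<in> borel_measurable M"
      unfolding measurable_cong_sets[OF sets_M refl] by (rule rho)
    show "AE x in M. 0 \<le> rho N c d x" using AE_Icc by eventually_elim (rule rho_nonneg)
  qed
  also have "\<dots> = (LINT x:{-1..1}|M. complex_of_real (rho N c d x) * f x)"
    unfolding set_lebesgue_integral_def
      by (intro Bochner_Integration.integral_cong refl) (simp add: scaleR_conv_of_real)
  also have "\<dots> = (LINT x|M. complex_of_real (rho N c d x) * f x)"
    using rho f by (intro set_integral_Icc) measurable
  finally show ?thesis .
qed

definition weight :: "nat \<Rightarrow> real \<Rightarrow> real" where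
  "weight k x = rho N c d x * poly (monic_OP (L2_form (mu_rho M N c d)) (k - 1)) x"

lemma continuous_weight: "continuous_on A (weight k)"
  unfolding weight_def by (intro continuous_intros continuous_rho)

lemma mu_hat_eq: "mu_hat M N c d k z = (LINT x|M. complex_of_real (weight k x) / (z - complex_of_real x))"
proof -
  let ?q = "\<lambda>x. complex_of_real (poly (monic_OP (L2_form (mu_rho M N c d)) (k - 1)) x)"
  have "?q \<in> borel_measurable borel" by (intro measurable_continuous continuous_intros)
  then show ?thesis
    unfolding mu_hat_def by (subst set_integral_mu_rho[OF measurable_transform]) (simp_all add: weight_def)
qed

text \<open>Up to sign, the numerator of the error of approximation; see \<open>assoc_ratio_eq\<close>.\<close>

definition remainder :: "nat \<Rightarrow> nat \<Rightarrow> complex \<Rightarrow> complex" where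
  "remainder k n z = (LINT x|M. complex_of_real (poly (S n) x * weight k x) / (z - complex_of_real x))"

lemma assoc_poly_eq:
  assumes z: "z \<notin> seg"
  shows "assoc_poly M N c d \<eta> k n z = cpoly (S (n + k)) z * mu_hat M N c d k z - remainder k (n + k) z"
proof -
  let ?q = "\<lambda>x. complex_of_real (poly (monic_OP (L2_form (mu_rho M N c d)) (k - 1)) x)"
  let ?s = "\<lambda>x. complex_of_real (poly (S (n + k)) x)"
  have "assoc_poly M N c d \<eta> k n z =
    (LINT x:{-1..1}|mu_rho M N c d. (cpoly (S (n + k)) z - ?s x) * ?q x / (z - complex_of_real x))"
    unfolding assoc_poly_def
  proof (rule set_lebesgue_integral_cong)
    show "{-1..1} \<in> sets (mu_rho M N c d)" by (simp add: mu_rho_def sets_M)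
    show "\<forall>x. x \<in> {-1..1} \<longrightarrow> diff_quot (S (n + k)) z x * ?q x =
      (cpoly (S (n + k)) z - ?s x) * ?q x / (z - complex_of_real x)"
    proof (intro allI impI)
      fix x :: real assume "x \<in> {-1..1}"
      then have "z \<noteq> complex_of_real x" using not_in_seg[OF z, of x] by auto
      then show "diff_quot (S (n + k)) z x * ?q x = (cpoly (S (n + k)) z - ?s x) * ?q x / (z - complex_of_real x)"
        by (simp add: diff_quot_def)
    qed
  qed
  also have "\<dots> = (LINT x|M. complex_of_real (rho N c d x) *
      ((cpoly (S (n + k)) z - ?s x) * ?q x / (z - complex_of_real x)))"
    by (intro set_integral_mu_rho measurable_transform measurable_continuous continuous_intros)
  also have "\<dots> = (LINT x|M. cpoly (S (n + k)) z * (complex_of_real (weight k x) / (z - complex_of_real x)) -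
      complex_of_real (poly (S (n + k)) x * weight k x) / (z - complex_of_real x))"
    by (intro Bochner_Integration.integral_cong refl)
      (simp add: weight_def diff_divide_distrib algebra_simps)
  also have "\<dots> = cpoly (S (n + k)) z * mu_hat M N c d k z - remainder k (n + k) z"
    unfolding mu_hat_eq remainder_def
  proof (subst Bochner_Integration.integral_diff)
    show "integrable M (\<lambda>x. cpoly (S (n + k)) z * (complex_of_real (weight k x) / (z - complex_of_real x)))"
      by (intro integrable_mult_right integrable_transform z continuous_intros continuous_weight)
    show "integrable M (\<lambda>x. complex_of_real (poly (S (n + k)) x * weight k x) / (z - complex_of_real x))"
      by (intro integrable_transform z continuous_intros continuous_weight)
  qed (simp only: integral_mult_right_zero)
  finally show ?thesis .
qed

lemma assoc_ratio_eq:
  assumes "z \<notin> seg" "cpoly (S (n + k)) z \<noteq> 0"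
  shows "assoc_ratio M N c d \<eta> k n z = mu_hat M N c d k z - remainder k (n + k) z / cpoly (S (n + k)) z"
  unfolding assoc_ratio_def assoc_poly_eq[OF assms(1)] using assms(2) by (simp add: diff_divide_distrib)

lemma isCont_assoc_ratio:
  assumes z: "z \<notin> seg" "cpoly (S (n + k)) z \<noteq> 0"
  shows "isCont (assoc_ratio M N c d \<eta> k n) z"
proof -
  let ?f = "\<lambda>z. mu_hat M N c d k z - remainder k (n + k) z / cpoly (S (n + k)) z"
  have cont: "isCont ?f z"
    unfolding mu_hat_eq remainder_def using z continuous_weight
    by (intro isCont_diff isCont_divide isCont_transform poly_isCont continuous_intros) auto
  have ev: "\<forall>\<^sub>F w in nhds z. assoc_ratio M N c d \<eta> k n w = ?f w"
  proof -
    have "\<forall>\<^sub>F w in nhds z. w \<in> - seg"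
      using closed_seg z(1) by (intro eventually_nhds_in_open) (auto simp: open_Compl)
    moreover have "\<forall>\<^sub>F w in nhds z. cpoly (S (n + k)) w \<noteq> 0"
    proof -
      have "open {w. cpoly (S (n + k)) w \<noteq> 0}" by (intro open_Collect_neq continuous_intros)
      then have "\<forall>\<^sub>F w in nhds z. w \<in> {w. cpoly (S (n + k)) w \<noteq> 0}"
        using z(2) by (intro eventually_nhds_in_open) auto
      then show ?thesis by simp
    qed
    ultimately show ?thesis by eventually_elim (simp add: assoc_ratio_eq)
  qed
  show ?thesis unfolding isCont_cong[OF ev] by (rule cont)
qed

text \<open>The mean of \<open>|S\<^sub>n|\<close> is compared with \<open>l = \<parallel>P\<^sub>n\<parallel>\<close> through \<open>2 |s| \<le> s\<^sup>2 / l + l\<close>.\<close>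

lemma remainder_bound:
  assumes C: "0 \<le> C" "B (S n) (S n) \<le> C * L2_form M (P n) (P n)" and z: "z \<notin> seg"
    and H: "\<And>x. x \<in> {-1..1} \<Longrightarrow> \<bar>weight k x\<bar> \<le> H"
  shows "seg_dist z * cmod (remainder k n z) \<le>
           H * (C + measure M (space M)) / 2 * sqrt (L2_form M (P n) (P n))"
proof -
  define L where "L = L2_form M (P n) (P n)"
  have L: "L > 0" unfolding L_def by (rule L2.pos) simp
  define l where "l = sqrt L"
  have l: "l > 0" "l * l = L" using L by (simp_all add: l_def)
  have H0: "0 \<le> H" by (rule order_trans[OF abs_ge_zero H[of 0]]) simp
  have S2: "(LINT x|M. poly (S n) x * poly (S n) x) \<le> C * L"
    using C(2) sobolev_mass_le(1)[of "S n"] unfolding L_def L2_form_eq[of "S n" "S n", symmetric] by linarith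
  have "cmod (remainder k n z) \<le> (LINT x|M. cmod (complex_of_real (poly (S n) x * weight k x))) / seg_dist z"
    unfolding remainder_def by (intro norm_transform_le z continuous_intros continuous_weight)
  then have "seg_dist z * cmod (remainder k n z) \<le> (LINT x|M. cmod (complex_of_real (poly (S n) x * weight k x)))"
    using seg_dist_pos[OF z] by (simp add: pos_le_divide_eq mult.commute)
  also have "\<dots> \<le> (LINT x|M. H / 2 * (poly (S n) x * poly (S n) x / l + l))"
  proof (rule integral_mono_Icc)
    show "integrable M (\<lambda>x. cmod (complex_of_real (poly (S n) x * weight k x)))"
      by (intro integrable_everywhere_continuous continuous_intros continuous_weight)
    show "integrable M (\<lambda>x. H / 2 * (poly (S n) x * poly (S n) x / l + l))"
      using l by (intro integrable_everywhere_continuous continuous_intros) auto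
    fix x :: real assume x: "x \<in> {-1..1}"
    let ?s = "poly (S n) x"
    have "0 \<le> (\<bar>?s\<bar> - l)\<^sup>2" by simp
    then have "2 * \<bar>?s\<bar> * l \<le> ?s * ?s + l * l" by (simp add: power2_eq_square algebra_simps)
    then have "2 * \<bar>?s\<bar> \<le> (?s * ?s + l * l) / l" using l(1) by (simp add: pos_le_divide_eq)
    also have "\<dots> = ?s * ?s / l + l" using l(1) by (simp add: add_divide_distrib)
    finally have "\<bar>?s\<bar> \<le> (?s * ?s / l + l) / 2" by simp
    then have "\<bar>?s\<bar> * \<bar>weight k x\<bar> \<le> (?s * ?s / l + l) / 2 * H"
      using H[OF x] l by (intro mult_mono) auto
    then show "cmod (complex_of_real (?s * weight k x)) \<le> H / 2 * (?s * ?s / l + l)"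
      by (simp only: norm_of_real abs_mult) (simp add: mult.commute)
  qed
  also have "\<dots> = H / 2 * ((LINT x|M. poly (S n) x * poly (S n) x) / l + l * measure M (space M))"
  proof -
    have "integrable M (\<lambda>x. poly (S n) x * poly (S n) x / l)"
      using l by (intro integrable_everywhere_continuous continuous_intros) auto
    then show ?thesis by (simp add: mult.commute)
  qed
  also have "\<dots> \<le> H / 2 * (C * L / l + l * measure M (space M))"
    using S2 l H0 by (intro mult_left_mono add_mono divide_right_mono) auto
  also have "C * L / l = C * l" using l by (simp flip: l(2))
  also have "H / 2 * (C * l + l * measure M (space M)) = H * (C + measure M (space M)) / 2 * l"
    by (simp add: algebra_simps)
  finally show ?thesis unfolding l_def L_def .
qed

text \<open>The factor \<open>1 / seg_dist z\<close> is kept in the estimate because it determines the limit at infinity of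
each single quotient.\<close>

lemma assoc_ratio_uniform_estimate:
  assumes nevai: "Nevai_class_0_1 M" and seq: "sequentially_ordered N c d"
    and c: "\<And>j. j \<in> {1..N} \<Longrightarrow> c j \<notin> {-1..1}"
    and K: "closed K" "K \<inter> complex_of_real ` ({-1..1} \<union> c ` {1..N}) = {}"
  shows "\<exists>e. e \<longlonglongrightarrow> 0 \<and> (\<forall>\<^sub>F n in sequentially. \<forall>z\<in>K. cpoly (S (n + k)) z \<noteq> 0 \<and>
           cmod (assoc_ratio M N c d \<eta> k n z - mu_hat M N c d k z) \<le> e n / seg_dist z)"
proof -
  obtain \<delta> where \<delta>: "\<delta> > 0" "\<forall>\<^sub>F n in sequentially. \<forall>z\<in>K. \<delta> \<le> cmod (SP_ratio n z)"
    using SP_ratio_bounded_below[OF nevai seq c K] by blast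
  obtain C n0 where C: "0 \<le> C" "\<And>n. n \<ge> n0 \<Longrightarrow> B (S n) (S n) \<le> C * L2_form M (P n) (P n)"
    using sobolev_norm_bound[OF nevai] by blast
  have Kseg: "K \<inter> seg = {}" using K(2) unfolding seg_def by blast
  obtain \<kappa> where \<kappa>: "\<kappa> > 0" "\<And>z. z \<in> K \<Longrightarrow> cmod z + 1 \<le> \<kappa> * seg_dist z"
    using exists_seg_dist_ratio[OF K(1) Kseg] by blast
  obtain \<theta> C1 where \<theta>: "\<theta> > 1" "C1 > 0" "\<And>n z. cmod z + 1 \<le> \<kappa> * seg_dist z \<Longrightarrow>
    L2_form M (P n) (P n) * \<theta> ^ n \<le> C1 * (cmod (cpoly (P n) z))\<^sup>2"
    using OP_growth[OF \<kappa>(1)] by blast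
  have "bounded (weight k ` {-1..1})"
    by (intro compact_imp_bounded compact_continuous_image continuous_weight) simp
  then obtain H where "\<forall>x\<in>{-1..1}. \<bar>weight k x\<bar> \<le> H" by (auto simp: bounded_iff)
  then have H: "\<And>x. x \<in> {-1..1} \<Longrightarrow> \<bar>weight k x\<bar> \<le> H" by blast
  have H0: "0 \<le> H" by (rule order_trans[OF abs_ge_zero H[of 0]]) simp
  define W where "W = H * (C + measure M (space M)) / 2"
  have W: "0 \<le> W" unfolding W_def using H0 C(1) by simp
  define e where "e m = W * sqrt (C1 * inverse (\<theta> ^ m)) / \<delta>" for m
  have e: "e \<longlonglongrightarrow> 0"
  proof -
    have "e \<longlonglongrightarrow> W * sqrt (C1 * 0) / \<delta>"
      unfolding e_def using \<delta>(1) by (intro tendsto_intros LIMSEQ_inverse_realpow_zero \<theta>(1)) auto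
    then show ?thesis by simp
  qed
  have "\<forall>\<^sub>F m in sequentially. \<forall>z\<in>K. cpoly (S m) z \<noteq> 0 \<and> cmod (remainder k m z / cpoly (S m) z) \<le> e m / seg_dist z"
    using \<delta>(2) eventually_ge_at_top[of n0]
  proof eventually_elim
    case (elim m)
    show ?case
    proof
      fix z assume z: "z \<in> K"
      let ?L = "L2_form M (P m) (P m)"
      have zs: "z \<notin> seg" using z Kseg by blast
      have g: "seg_dist z > 0" by (rule seg_dist_pos[OF zs])
      have P0: "cmod (cpoly (P m) z) > 0" using OP_nonzero_off_seg[OF zs] by simp
      have "?L \<le> C1 * inverse (\<theta> ^ m) * (cmod (cpoly (P m) z))\<^sup>2"
        using \<theta>(3)[OF \<kappa>(2)[OF z], of m] \<theta>(1) by (simp add: field_simps)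
      then have "sqrt ?L \<le> sqrt (C1 * inverse (\<theta> ^ m) * (cmod (cpoly (P m) z))\<^sup>2)"
        by (rule real_sqrt_le_mono)
      then have sL: "sqrt ?L \<le> sqrt (C1 * inverse (\<theta> ^ m)) * cmod (cpoly (P m) z)"
        using P0 by (simp only: real_sqrt_mult real_sqrt_abs abs_of_pos)
      have Sm: "\<delta> * cmod (cpoly (P m) z) \<le> cmod (cpoly (S m) z)"
        unfolding sobolev_eq_ratio_mult[OF zs] norm_mult using elim(1) z by (intro mult_right_mono) auto
      then have S0: "cmod (cpoly (S m) z) > 0" using \<delta>(1) P0
        by (intro less_le_trans[OF mult_pos_pos Sm])
      have "seg_dist z * cmod (remainder k m z) \<le> W * sqrt ?L"
        unfolding W_def by (rule remainder_bound[OF C(1) C(2)[OF elim(2)] zs H])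
      also have "\<dots> \<le> W * (sqrt (C1 * inverse (\<theta> ^ m)) * cmod (cpoly (P m) z))"
        using sL W by (rule mult_left_mono)
      also have "\<dots> = e m * (\<delta> * cmod (cpoly (P m) z))" unfolding e_def using \<delta>(1) by simp
      also have "\<dots> \<le> e m * cmod (cpoly (S m) z)"
        using Sm W \<delta>(1) \<theta> by (intro mult_left_mono) (auto simp: e_def)
      finally have "cmod (remainder k m z / cpoly (S m) z) \<le> e m / seg_dist z"
        using g S0 by (simp add: norm_divide divide_le_eq pos_le_divide_eq mult.commute mult.left_commute)
      then show "cpoly (S m) z \<noteq> 0 \<and> cmod (remainder k m z / cpoly (S m) z) \<le> e m / seg_dist z"
        using S0 by auto
    qed
  qed
  then have "\<forall>\<^sub>F n in sequentially. \<forall>z\<in>K. cpoly (S (n + k)) z \<noteq> 0 \<and>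
      cmod (remainder k (n + k) z / cpoly (S (n + k)) z) \<le> e (n + k) / seg_dist z"
    by (simp only: eventually_sequentially_seg[of "\<lambda>m. \<forall>z\<in>K. cpoly (S m) z \<noteq> 0 \<and>
      cmod (remainder k m z / cpoly (S m) z) \<le> e m / seg_dist z"])
  then have "\<forall>\<^sub>F n in sequentially. \<forall>z\<in>K. cpoly (S (n + k)) z \<noteq> 0 \<and>
           cmod (assoc_ratio M N c d \<eta> k n z - mu_hat M N c d k z) \<le> e (n + k) / seg_dist z"
  proof eventually_elim
    case (elim n)
    show ?case
    proof
      fix z assume z: "z \<in> K"
      then have zs: "z \<notin> seg" using Kseg by blast
      have S0: "cpoly (S (n + k)) z \<noteq> 0" using elim z by blast
      show "cpoly (S (n + k)) z \<noteq> 0 \<and>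
           cmod (assoc_ratio M N c d \<eta> k n z - mu_hat M N c d k z) \<le> e (n + k) / seg_dist z"
        unfolding assoc_ratio_eq[OF zs S0] using elim z by simp
    qed
  qed
  moreover have "(\<lambda>n. e (n + k)) \<longlonglongrightarrow> 0" using e
    by (rule LIMSEQ_ignore_initial_segment)
  ultimately show ?thesis by (intro exI[of _ "\<lambda>n. e (n + k)"]) simp
qed

lemma mu_hat_tendsto_0: "(mu_hat M N c d k \<longlongrightarrow> 0) at_infinity"
proof (rule Lim_null_comparison)
  let ?A = "LINT x|M. cmod (complex_of_real (weight k x))"
  have A: "0 \<le> ?A" by (intro integral_nonneg_AE) simp
  show "\<forall>\<^sub>F z in at_infinity. cmod (mu_hat M N c d k z) \<le> ?A / (cmod z - 1)"
    unfolding eventually_at_infinity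
  proof (intro exI[of _ 2] allI impI)
    fix z :: complex assume z: "2 \<le> cmod z"
    have g: "cmod z - 1 \<le> seg_dist z" by (rule seg_dist_far)
    then have zs: "z \<notin> seg" using z by (intro not_in_seg_if_seg_dist_pos) linarith
    have "cmod (mu_hat M N c d k z) \<le> ?A / seg_dist z"
      unfolding mu_hat_eq by (intro norm_transform_le zs continuous_intros continuous_weight)
    also have "\<dots> \<le> ?A / (cmod z - 1)" using A g z by (intro divide_left_mono) auto
    finally show "cmod (mu_hat M N c d k z) \<le> ?A / (cmod z - 1)" .
  qed
  show "((\<lambda>z. ?A / (cmod z - 1)) \<longlongrightarrow> 0) at_infinity"
    by (rule tendsto_inverse_distance)
qed

end

section \<open>Uniform convergence\<close>

theorem theorem2:
  fixes M :: "real measure" and N :: nat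
    and c :: "nat \<Rightarrow> real" and d :: "nat \<Rightarrow> nat" and \<eta> :: "nat \<Rightarrow> real"
    and k :: nat and K :: "complex option set"
  assumes "borel_measure_Icc M"
    and "\<forall>j\<in>{1..N}. \<eta> j > 0"
    and "\<forall>j\<in>{1..N}. c j \<notin> {-1..1}"
    and "sequentially_ordered N c d"
    and "Nevai_class_0_1 M"
    and "k \<ge> 1"
    and "compactin Riemann_sphere K"
    and "K \<subseteq> Omega_star N c"
  shows "(\<forall>\<^sub>F n in sequentially. \<forall>p\<in>K. finite_at (assoc_ratio M N c d \<eta> k n) p) \<and>
         uniform_limit K (\<lambda>n. limit_ext (assoc_ratio M N c d \<eta> k n))
           (mu_hat_ext M N c d k) sequentially"
proof -
  interpret sobolev M N c d \<eta>
    using assms(1,2) by unfold_locales auto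
  let ?R = "assoc_ratio M N c d \<eta> k" and ?h = "mu_hat M N c d k"
  let ?X = "complex_of_real ` ({-1..1} \<union> c ` {1..N})"
  have c: "\<And>j. j \<in> {1..N} \<Longrightarrow> c j \<notin> {-1..1}" using assms(3) by blast
  define K0 where "K0 = {z. Some z \<in> K}"
  have "compact ({-1..1} \<union> c ` {1..N})"
    by (rule compact_Un[OF compact_Icc finite_imp_compact]) simp
  then have "bounded ?X"
    by (intro compact_imp_bounded compact_continuous_image continuous_intros)
  then obtain r where r: "\<And>z. z \<in> ?X \<Longrightarrow> cmod z \<le> r" unfolding bounded_iff by blast
  \<comment> \<open>Adding a neighbourhood of infinity makes the estimate yield the limits at infinity as well.\<close>
  define K1 where "K1 = K0 \<union> {z. r + 1 \<le> cmod z}"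
  have K1: "closed K1" "K1 \<inter> ?X = {}"
  proof -
    have "closed {z::complex. r + 1 \<le> cmod z}" by (intro closed_Collect_le continuous_intros)
    then show "closed K1" unfolding K1_def K0_def
      by (intro closed_Un closed_finite_part assms(7))
    have "K0 \<inter> ?X = {}" using assms(8) unfolding K0_def Omega_star_def by blast
    moreover have "z \<notin> ?X" if "r + 1 \<le> cmod z" for z using r[of z] that by linarith
    ultimately show "K1 \<inter> ?X = {}" unfolding K1_def by blast
  qed
  have K1seg: "K1 \<inter> seg = {}" using K1(2) unfolding seg_def by blast
  obtain \<kappa> where \<kappa>: "\<kappa> > 0" "\<And>z. z \<in> K1 \<Longrightarrow> cmod z + 1 \<le> \<kappa> * seg_dist z"
    using exists_seg_dist_ratio[OF K1(1) K1seg] by blast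
  obtain e where e: "e \<longlonglongrightarrow> 0" "\<forall>\<^sub>F n in sequentially. \<forall>z\<in>K1. cpoly (S (n + k)) z \<noteq> 0 \<and>
      cmod (?R n z - ?h z) \<le> e n / seg_dist z"
    using assoc_ratio_uniform_estimate[OF assms(5,4) c K1] by blast
  have at_inf: "(?R n \<longlongrightarrow> 0) at_infinity"
    if n: "\<forall>z\<in>K1. cpoly (S (n + k)) z \<noteq> 0 \<and> cmod (?R n z - ?h z) \<le> e n / seg_dist z" for n
  proof -
    have "((\<lambda>z. ?R n z - ?h z) \<longlongrightarrow> 0) at_infinity"
    proof (rule Lim_null_comparison)
      show "\<forall>\<^sub>F z in at_infinity. cmod (?R n z - ?h z) \<le> \<bar>e n\<bar> / (cmod z - 1)"
        unfolding eventually_at_infinity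
      proof (intro exI[of _ "max 2 (r + 1)"] allI impI)
        fix z :: complex assume z: "max 2 (r + 1) \<le> cmod z"
        have "z \<in> K1" using z by (simp add: K1_def)
        then have "cmod (?R n z - ?h z) \<le> e n / seg_dist z" using n by blast
        also have "\<dots> \<le> \<bar>e n\<bar> / seg_dist z" using seg_dist_nonneg[of z]
          by (intro divide_right_mono) auto
        also have "\<dots> \<le> \<bar>e n\<bar> / (cmod z - 1)" using seg_dist_far[of z] z
          by (intro divide_left_mono mult_pos_pos) auto
        finally show "cmod (?R n z - ?h z) \<le> \<bar>e n\<bar> / (cmod z - 1)" .
      qed
    qed (rule tendsto_inverse_distance)
    from tendsto_add[OF this mu_hat_tendsto_0[of k]] show ?thesis by simp
  qed
  have at_fin: "(?R n \<longlongrightarrow> ?R n z) (at z)"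
    if "\<forall>z\<in>K1. cpoly (S (n + k)) z \<noteq> 0 \<and> cmod (?R n z - ?h z) \<le> e n / seg_dist z" "Some z \<in> K" for n z
  proof -
    have "z \<in> K1" using that(2) by (simp add: K1_def K0_def)
    then have "z \<notin> seg" "cpoly (S (n + k)) z \<noteq> 0" using that(1) K1seg by blast+
    then show ?thesis using isCont_assoc_ratio unfolding isCont_def by blast
  qed
  have "\<forall>\<^sub>F n in sequentially. \<forall>p\<in>K. finite_at (?R n) p"
    using e(2)
  proof eventually_elim
    case (elim n)
    show ?case
    proof
      fix p assume p: "p \<in> K"
      show "finite_at (?R n) p"
      proof (cases p)
        case None
        then show ?thesis using at_inf[OF elim] unfolding finite_at_def sphere_at_def by auto
      next
        case (Some z)
        then show ?thesis using at_fin[OF elim, of z] p unfolding finite_at_def sphere_at_def by auto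
      qed
    qed
  qed
  moreover have "uniform_limit K (\<lambda>n. limit_ext (?R n)) (mu_hat_ext M N c d k) sequentially"
    unfolding uniform_limit_iff
  proof (intro allI impI)
    fix \<epsilon> :: real assume \<epsilon>: "\<epsilon> > 0"
    have "\<forall>\<^sub>F n in sequentially. \<bar>e n\<bar> < \<epsilon> / \<kappa>"
      using tendstoD[OF e(1), of "\<epsilon> / \<kappa>"] \<epsilon> \<kappa>(1) by simp
    with e(2) show "\<forall>\<^sub>F n in sequentially. \<forall>p\<in>K. dist (limit_ext (?R n) p) (mu_hat_ext M N c d k p) < \<epsilon>"
    proof eventually_elim
      case (elim n)
      show ?case
      proof
        fix p assume p: "p \<in> K"
        show "dist (limit_ext (?R n) p) (mu_hat_ext M N c d k p) < \<epsilon>"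
        proof (cases p)
          case None
          have "limit_ext (?R n) p = 0"
            unfolding None limit_ext_def sphere_at_def option.case
            by (rule tendsto_Lim[OF _ at_inf[OF elim(1)]]) (rule trivial_limit_at_infinity)
          then show ?thesis using \<epsilon> by (simp add: None mu_hat_ext_def)
        next
          case (Some z)
          have zK: "Some z \<in> K" using p Some by simp
          then have z1: "z \<in> K1" by (simp add: K1_def K0_def)
          have "limit_ext (?R n) p = ?R n z"
            unfolding Some limit_ext_def sphere_at_def option.case
            by (rule tendsto_Lim[OF _ at_fin[OF elim(1) zK]]) simp
          moreover have "cmod (?R n z - ?h z) < \<epsilon>"
          proof -
            have "1 \<le> \<kappa> * seg_dist z" using \<kappa>(2)[OF z1] norm_ge_zero[of z] by linarith
            then have g: "1 / \<kappa> \<le> seg_dist z" using \<kappa>(1)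
              by (simp add: pos_divide_le_eq mult.commute)
            have "0 < 1 / \<kappa>" using \<kappa>(1) by simp
            then have g0: "0 < seg_dist z" using g by (rule less_le_trans)
            have "cmod (?R n z - ?h z) \<le> e n / seg_dist z" using elim(1) z1 by blast
            also have "\<dots> \<le> \<bar>e n\<bar> / seg_dist z" using g0 by (intro divide_right_mono) auto
            also have "\<dots> \<le> \<bar>e n\<bar> / (1 / \<kappa>)" using g g0 \<kappa>(1)
              by (intro divide_left_mono) auto
            also have "\<dots> < \<epsilon>" using elim(2) \<kappa>(1) by (simp add: pos_less_divide_eq)
            finally show ?thesis .
          qed
          ultimately show ?thesis by (simp add: Some mu_hat_ext_def dist_norm)
        qed
      qed
    qed
  qed
  ultimately show ?thesis by blast
qed

end
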